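(* Let $n\ge 2$ and let $T\in V=\mathbb{C}^2\otimes \mathbb{C}^n\otimes \mathbb{C}^{n+2}$ be a general tensor. Then the projective span $\langle Z_T\rangle$ of the singular vector triples of $T$ has codimension $n-1$ in the projectivized critical space $\mathbb{P}(H_T)$.
   Context: Everything is over $\mathbb{C}$. "General" means: for all $T$ in some nonempty Zariski open subset of $V$. Let $V=V_1\otimes\cdots\otimes V_m$ with $\dim V_i=n_i+1$ (here $m=3$), each $V_i=\mathbb{C}^{n_i+1}$ equipped with the complexification of a positive definite real quadratic form; use coordinates with respect to orthonormal bases, so that $V_i$ is identified with its dual. A singular vector $m$-tuple of $T=(t_{i_1\cdots i_m})\in V$ is a tuple $(\mathbf{x}_1,\dots,\mathbf{x}_m)$ of nonzero vectors $\mathbf{x}_i\in V_i$ such that for every $i$ the contraction $T(\mathbf{x}_1\otimes\cdots\otimes\widehat{\mathbf{x}_i}\otimes\cdots\otimes\mathbf{x}_m)\in V_i$ and $\mathbf{x}_i$ are linearly dependent (all $2\times 2$ minors of the matrix with these two rows vanish). $Z_T\subset\mathbb{P}(V)$ is the set of points $[\mathbf{x}_1\otimes\cdots\otimes\mathbf{x}_m]$ with $(\mathbf{x}_1,\dots,\mathbf{x}_m)$ a singular vector $m$-tuple of $T$, and $\langle Z_T\rangle$ is its projective linear span. The critical space $H_T\subset V$ is the linear subspace of all $z=(z_{i_1\cdots i_m})$ satisfying, for all $\ell\in\{1,\dots,m\}$ and all $1\le p<q\le n_\ell+1$, $\sum\left(t_{i_1\cdots p\cdots i_m}z_{i_1\cdots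 q\cdots i_m}-t_{i_1\cdots q\cdots i_m}z_{i_1\cdots p\cdots i_m}\right)=0$, where $p,q$ are in position $\ell$ and the sum is over all the other indices. One always has $\langle Z_T\rangle\subset\mathbb{P}(H_T)$. *)

theory Defs
  imports "HOL-Analysis.Analysis"
begin

text \<open>
  All vector spaces are coordinate spaces \<open>complex ^ 'i\<close>. Linear notions over the complex numbers are
  those of the interpretation \<open>vec\<close> (\<open>vec.span\<close>, \<open>vec.subspace\<close>, \<open>vec.dim\<close>); the unqualified
  \<open>span\<close>, \<open>subspace\<close> and \<open>dim\<close> are the real ones. The tensor product of \<open>complex ^ 'a\<close>,
  \<open>complex ^ 'b\<close> and \<open>complex ^ 'c\<close> is \<open>complex ^ ('a \<times> 'b \<times> 'c)\<close>, in coordinates with respect to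
  orthonormal bases of the three factors.
\<close>

subsection \<open>Zariski topology\<close>

definition polynomial_fun :: "(complex ^ 'i \<Rightarrow> complex) \<Rightarrow> bool" where
  "polynomial_fun f \<longleftrightarrow>
     (\<exists>(A :: ('i \<Rightarrow> nat) set) c. finite A \<and>
        (\<forall>x. f x = (\<Sum>\<alpha>\<in>A. c \<alpha> * (\<Prod>i\<in>UNIV. (x $ i) ^ \<alpha> i))))"

definition zariski_closed :: "(complex ^ 'i) set \<Rightarrow> bool" where
  "zariski_closed S \<longleftrightarrow>
     (\<exists>F. (\<forall>f\<in>F. polynomial_fun f) \<and> S = {x. \<forall>f\<in>F. f x = 0})"

definition zariski_open :: "(complex ^ 'i) set \<Rightarrow> bool" where
  "zariski_open U \<longleftrightarrow> zariski_closed (- U)"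

definition for_general :: "(complex ^ 'i \<Rightarrow> bool) \<Rightarrow> bool" where
  "for_general P \<longleftrightarrow> (\<exists>U. zariski_open U \<and> U \<noteq> {} \<and> (\<forall>T\<in>U. P T))"

subsection \<open>Projective spaces\<close>

text \<open>A point of a projective space is a line through the origin, as a set of vectors.\<close>

definition proj_point :: "complex ^ 'i \<Rightarrow> (complex ^ 'i) set" where
  "proj_point v = vec.span {v}"

definition projectivization :: "(complex ^ 'i) set \<Rightarrow> (complex ^ 'i) set set" where
  "projectivization W = proj_point ` (W - {0})"

definition proj_span :: "(complex ^ 'i) set set \<Rightarrow> (complex ^ 'i) set set" where
  "proj_span Z = \<Inter> {projectivization W | W. vec.subspace W \<and> Z \<subseteq> projectivization W}"

text \<open>
  For a projective linear subspace \<open>L\<close>; the union of the lines in \<open>L\<close> is the affine cone over \<open>L\<close>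
  (up to the origin when \<open>L\<close> is empty, which has dimension \<open>-1\<close>).
\<close>

definition proj_dim :: "(complex ^ 'i) set set \<Rightarrow> int" where
  "proj_dim L = int (vec.dim (\<Union>L)) - 1"

definition has_codim_in ::
  "(complex ^ 'i) set set \<Rightarrow> (complex ^ 'i) set set \<Rightarrow> nat \<Rightarrow> bool" where
  "has_codim_in L M c \<longleftrightarrow> L \<subseteq> M \<and> proj_dim M - proj_dim L = int c"

subsection \<open>Singular vector triples\<close>

definition tensor3 ::
  "complex ^ 'a \<Rightarrow> complex ^ 'b \<Rightarrow> complex ^ 'c \<Rightarrow> complex ^ ('a::finite \<times> 'b::finite \<times> 'c::finite)" where
  "tensor3 x y z = vec_lambda (\<lambda>(i, j, k). x $ i * y $ j * z $ k)"

definition contract1 ::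
  "complex ^ ('a::finite \<times> 'b::finite \<times> 'c::finite) \<Rightarrow> complex ^ 'b \<Rightarrow> complex ^ 'c \<Rightarrow> complex ^ 'a" where
  "contract1 T y z = (\<chi> i. \<Sum>j\<in>UNIV. \<Sum>k\<in>UNIV. T $ (i, j, k) * y $ j * z $ k)"

definition contract2 ::
  "complex ^ ('a::finite \<times> 'b::finite \<times> 'c::finite) \<Rightarrow> complex ^ 'a \<Rightarrow> complex ^ 'c \<Rightarrow> complex ^ 'b" where
  "contract2 T x z = (\<chi> j. \<Sum>i\<in>UNIV. \<Sum>k\<in>UNIV. T $ (i, j, k) * x $ i * z $ k)"

definition contract3 ::
  "complex ^ ('a::finite \<times> 'b::finite \<times> 'c::finite) \<Rightarrow> complex ^ 'a \<Rightarrow> complex ^ 'b \<Rightarrow> complex ^ 'c" where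
  "contract3 T x y = (\<chi> k. \<Sum>i\<in>UNIV. \<Sum>j\<in>UNIV. T $ (i, j, k) * x $ i * y $ j)"

text \<open>
  Linear dependence of two vectors: all 2 by 2 minors of the matrix with rows \<open>u\<close> and \<open>v\<close> vanish.
  General index types carry no order, so \<open>p\<close> and \<open>q\<close> run over all pairs of indices instead of \<open>p < q\<close>;
  as the minors are alternating in \<open>p\<close> and \<open>q\<close> this adds no condition. The same applies to the
  equations of the critical space below.
\<close>

definition minors_vanish :: "complex ^ 'a \<Rightarrow> complex ^ 'a \<Rightarrow> bool" where
  "minors_vanish u v \<longleftrightarrow> (\<forall>p q. u $ p * v $ q - u $ q * v $ p = 0)"

definition singular_triple ::
  "complex ^ ('a::finite \<times> 'b::finite \<times> 'c::finite) \<Rightarrow> complex ^ 'a \<Rightarrow> complex ^ 'b \<Rightarrow> complex ^ 'c \<Rightarrow> bool" where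
  "singular_triple T x y z \<longleftrightarrow>
     x \<noteq> 0 \<and> y \<noteq> 0 \<and> z \<noteq> 0 \<and>
     minors_vanish (contract1 T y z) x \<and>
     minors_vanish (contract2 T x z) y \<and>
     minors_vanish (contract3 T x y) z"

definition singular_points ::
  "complex ^ ('a::finite \<times> 'b::finite \<times> 'c::finite) \<Rightarrow> (complex ^ ('a \<times> 'b \<times> 'c)) set set" where
  "singular_points T = {proj_point (tensor3 x y z) | x y z. singular_triple T x y z}"

subsection \<open>The critical space\<close>

definition critical_space ::
  "complex ^ ('a::finite \<times> 'b::finite \<times> 'c::finite) \<Rightarrow> (complex ^ ('a \<times> 'b \<times> 'c)) set" where
  "critical_space T = {z.
     (\<forall>p q. (\<Sum>j\<in>UNIV. \<Sum>k\<in>UNIV. T $ (p, j, k) * z $ (q, j, k) - T $ (q, j, k) * z $ (p, j, k)) = 0) \<and>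
     (\<forall>p q. (\<Sum>i\<in>UNIV. \<Sum>k\<in>UNIV. T $ (i, p, k) * z $ (i, q, k) - T $ (i, q, k) * z $ (i, p, k)) = 0) \<and>
     (\<forall>p q. (\<Sum>i\<in>UNIV. \<Sum>j\<in>UNIV. T $ (i, j, p) * z $ (i, j, q) - T $ (i, j, q) * z $ (i, j, p)) = 0)}"

end

theory Submission
  imports Defs "HOL-Computational_Algebra.Fundamental_Theorem_Algebra"
begin

text \<open>
  For general \<open>T\<close> the vector \<open>T(x, y)\<close> never vanishes, so in a singular triple \<open>z\<close> is a multiple of
  \<open>T(x, y)\<close>, and the triples correspond to the critical pairs \<open>(x, y)\<close> of the biquadratic form
  \<open>q(x, y) = T(x, y) \<bullet> T(x, y)\<close>. The tensor \<open>x \<otimes> y \<otimes> T(x, y)\<close> is the image of the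
  Veronese point \<open>x\<^sup>2 \<otimes> y\<^sup>2\<close> under a linear map determined by \<open>T\<close> that is injective on
  \<open>S\<^sup>2 \<otimes> S\<^sup>2\<close>, so it remains to find the dimension of the span of the Veronese points of the critical
  pairs. They satisfy \<open>1 + n(n-1)/2\<close> independent linear equations, which gives \<open>n\<^sup>2 + 2n - 1\<close> as an
  upper bound. For \<open>q = \<Sum> l\<^sub>i(x)\<^sup>2 y\<^sub>i\<^sup>2\<close> with sufficiently general lines \<open>l\<^sub>i\<close> all
  critical pairs that are needed can be written down; they are nondegenerate and attain the bound. Hence the
  bound is attained on a Euclidean open set of tensors. Since the set of tensors that attain it is constructible
  (it is the projection of an algebraic set), it contains a nonempty Zariski open set. Finally, the equations of
  the critical space are independent for general \<open>T\<close>, so its dimension is \<open>n\<^sup>2 + 3n - 2\<close>.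
\<close>

subsection \<open>Bilinear duality on coordinate spaces\<close>

text \<open>The two counts react differently to the third factor: \<open>n^2 + 2n - 1\<close> does
  not involve its dimension, whereas the dimension of the critical space does. With
  \<open>n + 1\<close> in place of \<open>n + 2\<close> the same count of equations would give equal
  dimensions; the extra coordinate opens the gap \<open>n - 1\<close>.

  The shape of the proof comes from the lower bound. Critical pairs depend on \<open>T\<close>
  algebraically but not polynomially, so independent critical pairs of one special tensor do not
  directly give a nonvanishing polynomial in \<open>T\<close>. Regular pairs are therefore moved
  along with \<open>T\<close> by an open mapping argument, and their independence is certified by a
  dual family, which turns "there are \<open>d\<close> independent critical pairs" into polynomial
  equations in auxiliary unknowns that can be eliminated one at a time.

  The diagonal form is chosen because it decouples \<open>y\<close>: criticality in \<open>y\<close>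
  only asks that \<open>l_i(x)^2\<close> takes one common value over all \<open>i\<close> with
  \<open>y_i\<close> nonzero. Pairs with at most two nonzero coordinates of \<open>y\<close> already
  suffice, and they pin down an annihilating form entry by entry.\<close>

definition bil :: "complex ^ 'i \<Rightarrow> complex ^ 'i \<Rightarrow> complex" where
  "bil u v = (\<Sum>i\<in>UNIV. u $ i * v $ i)"

lemma bil_commute: "bil u v = bil v u"
  by (simp add: bil_def mult.commute)

lemma bil_add_right: "bil u (v + w) = bil u v + bil u w"
  by (simp add: bil_def distrib_left sum.distrib)

lemma bil_diff_right: "bil u (v - w) = bil u v - bil u w"
  by (simp add: bil_def right_diff_distrib sum_subtractf)

lemma bil_scale_right: "bil u (c *s v) = c * bil u v"
  by (simp add: bil_def sum_distrib_left mult.left_commute)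

lemma bil_zero_right [simp]: "bil u 0 = 0"
  by (simp add: bil_def)

lemma bil_zero_left [simp]: "bil 0 u = 0"
  by (simp add: bil_def)

lemma bil_sum_right: "bil u (\<Sum>i\<in>I. v i) = (\<Sum>i\<in>I. bil u (v i))"
  by (induction I rule: infinite_finite_induct) (simp_all add: bil_add_right)

lemma bil_axis_right: "bil u (axis i 1) = u $ i"
  by (simp add: bil_def axis_def if_distrib cong: if_cong)

lemma subspace_bil: "vec.subspace {w. bil u w = 0}"
  by (rule vec.subspaceI) (simp_all add: bil_add_right bil_scale_right)

definition annihilator :: "(complex ^ 'i) set \<Rightarrow> (complex ^ 'i) set" where
  "annihilator U = {w. \<forall>u\<in>U. bil u w = 0}"

lemma annihilatorI: "(\<And>u. u \<in> U \<Longrightarrow> bil u w = 0) \<Longrightarrow> w \<in> annihilator U"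
  by (simp add: annihilator_def)

lemma annihilatorD: "w \<in> annihilator U \<Longrightarrow> u \<in> U \<Longrightarrow> bil u w = 0"
  by (simp add: annihilator_def)

lemma subspace_annihilator: "vec.subspace (annihilator U)"
  unfolding annihilator_def
  by (rule vec.subspaceI) (simp_all add: bil_add_right bil_scale_right)

lemma annihilator_span [simp]: "annihilator (vec.span U) = annihilator U"
proof
  show "annihilator (vec.span U) \<subseteq> annihilator U"
    by (auto simp: annihilator_def vec.span_base)
  show "annihilator U \<subseteq> annihilator (vec.span U)"
  proof
    fix w assume "w \<in> annihilator U"
    then have "U \<subseteq> {u. bil w u = 0}"
      by (auto simp: annihilator_def bil_commute)
    then have "vec.span U \<subseteq> {u. bil w u = 0}"
      by (rule vec.span_minimal) (rule subspace_bil)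
    then show "w \<in> annihilator (vec.span U)"
      by (auto simp: annihilator_def bil_commute)
  qed
qed

text \<open>A vector outside \<open>U\<close> enlarges a basis of \<open>U\<close> to a bigger
  independent set, so a linear map can be prescribed to kill \<open>U\<close> but not
  \<open>w\<close>; \<open>bil\<close> represents one of its coordinates. Orthogonal projection is
  no substitute, since \<open>bil\<close> has isotropic vectors.\<close>

lemma separating_functional:
  fixes w :: "complex ^ 'i"
  assumes "vec.subspace U" and "w \<notin> U"
  obtains r where "r \<in> annihilator U" and "bil r w = 1"
proof -
  obtain B where B: "B \<subseteq> U" "vec.independent B" "vec.span B = U"
    by (metis assms(1) vec.basis_exists vec.span_subspace)
  then have "vec.independent (insert w B)"
    using assms(2) by (simp add: vec.independent_insert)
  from vec.linear_independent_extend[OF this, of "\<lambda>x. if x = w then 1 else 0"]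
  obtain g :: "complex ^ 'i \<Rightarrow> complex ^ 'i" where g: "Vector_Spaces.linear (*s) (*s) g"
    and g_eq: "\<And>x. x \<in> insert w B \<Longrightarrow> g x = (if x = w then 1 else 0)"
    by blast
  interpret g: Vector_Spaces.linear "(*s)" "(*s)" g by (rule g)
  \<comment> \<open>The extended map \<open>g\<close> has values in the whole space and sends
    \<open>w\<close> to the all-ones vector, so any fixed coordinate of it is a functional with
    value 1 at \<open>w\<close>.\<close>
  define i0 :: 'i where "i0 = undefined"
  define r where "r = (\<chi> i. g (axis i 1) $ i0)"
  have r: "bil r x = g x $ i0" for x
  proof -
    have "g x = g (\<Sum>i\<in>UNIV. x $ i *s axis i 1)"
      by (simp add: basis_expansion)
    then show ?thesis
      by (simp add: g.sum g.scale bil_def r_def mult.commute)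
  qed
  have "b \<noteq> w" if "b \<in> B" for b
    using that B assms(2) by blast
  then have "r \<in> annihilator B"
    by (intro annihilatorI) (simp add: bil_commute[of _ r] r g_eq)
  then have "r \<in> annihilator U"
    using annihilator_span[of B] B(3) by simp
  moreover have "bil r w = 1"
    using g_eq[of w] by (simp add: r)
  ultimately show ?thesis by (rule that)
qed

lemma span_eq_UNIV_of_annihilator:
  assumes "annihilator S \<subseteq> {0}"
  shows "vec.span S = UNIV"
proof (rule ccontr)
  assume "vec.span S \<noteq> UNIV"
  then obtain w where "w \<notin> vec.span S" by blast
  then obtain r where r: "r \<in> annihilator (vec.span S)" "bil r w = 1"
    using separating_functional[OF vec.subspace_span] by blast
  with assms have "r = 0" by auto
  with r(2) show False by simp
qed

section \<open>Finite families of vectors and dual families\<close>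

lemma span_family:
  fixes v :: "'a \<Rightarrow> complex ^ 'i"
  assumes "finite I"
  shows "vec.span (v ` I) = range (\<lambda>c. \<Sum>i\<in>I. c i *s v i)"
proof
  show "range (\<lambda>c. \<Sum>i\<in>I. c i *s v i) \<subseteq> vec.span (v ` I)"
    by (blast intro: vec.span_sum vec.span_scale vec.span_base)
  have "x \<in> range (\<lambda>c. \<Sum>i\<in>I. c i *s v i)" if "x \<in> vec.span (v ` I)" for x
    using that
  proof (induction rule: vec.span_induct_alt)
    case base
    show ?case by (rule range_eqI[of _ _ "\<lambda>_. 0"]) simp
  next
    case (step a x y)
    then obtain c k where ck: "y = (\<Sum>i\<in>I. c i *s v i)" "k \<in> I" "x = v k" by blast
    have "(\<Sum>i\<in>I. (if i = k then a else 0) *s v i) = (\<Sum>i\<in>I. if i = k then a *s v i else 0)"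
      by (rule sum.cong) auto
    also have "\<dots> = a *s x" using ck assms(1) by simp
    finally have "a *s x + y = (\<Sum>i\<in>I. ((if i = k then a else 0) + c i) *s v i)"
      by (simp add: ck(1) vec.scale_left_distrib sum.distrib)
    then show ?case by (intro range_eqI[where x = "\<lambda>i. (if i = k then a else 0) + c i"])
  qed
  then show "vec.span (v ` I) \<subseteq> range (\<lambda>c. \<Sum>i\<in>I. c i *s v i)" by blast
qed

definition indep_family :: "'a set \<Rightarrow> ('a \<Rightarrow> complex ^ 'i) \<Rightarrow> bool" where
  "indep_family I v \<longleftrightarrow> (\<forall>c. (\<Sum>i\<in>I. c i *s v i) = 0 \<longrightarrow> (\<forall>i\<in>I. c i = 0))"

text \<open>Each \<open>v i\<close> lies outside the span of the others and is separated from it.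
  The dual family is the certificate of independence used below: it turns an open condition into
  polynomial equations in additional unknowns.\<close>

lemma indep_family_dual:
  fixes v :: "'a \<Rightarrow> complex ^ 'i"
  assumes "finite I" and ind: "indep_family I v"
  obtains r where "\<And>i j. i \<in> I \<Longrightarrow> j \<in> I \<Longrightarrow> bil (r i) (v j) = (if i = j then 1 else 0)"
proof -
  have "\<exists>r. \<forall>j\<in>I. bil r (v j) = (if i = j then 1 else 0)" if i: "i \<in> I" for i
  proof -
    have "v i \<notin> vec.span (v ` (I - {i}))"
    proof
      assume "v i \<in> vec.span (v ` (I - {i}))"
      then obtain c where c: "v i = (\<Sum>j\<in>I-{i}. c j *s v j)"
        using assms(1) by (auto simp: span_family)
      have "(\<Sum>j\<in>I. (c(i := -1)) j *s v j) = - v i + (\<Sum>j\<in>I-{i}. (c(i := -1)) j *s v j)"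
        using i \<open>finite I\<close> by (simp add: sum.remove[of I i])
      also have "(\<Sum>j\<in>I-{i}. (c(i := -1)) j *s v j) = (\<Sum>j\<in>I-{i}. c j *s v j)"
        by (rule sum.cong) auto
      finally have "(\<Sum>j\<in>I. (c(i := -1)) j *s v j) = 0"
        using c by simp
      then have "(c(i := -1)) i = 0"
        using ind i unfolding indep_family_def by blast
      then show False by simp
    qed
    then obtain r where r: "r \<in> annihilator (vec.span (v ` (I - {i})))" "bil r (v i) = 1"
      using separating_functional[OF vec.subspace_span] by blast
    then have "bil r (v j) = 0" if "j \<in> I" "j \<noteq> i" for j
      using that annihilatorD[of r "v ` (I - {i})" "v j"] by (auto simp: bil_commute)
    with r(2) show ?thesis by (intro exI[of _ r]) auto
  qed
  then obtain r where "\<And>i. i \<in> I \<Longrightarrow> \<forall>j\<in>I. bil (r i) (v j) = (if i = j then 1 else 0)"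
    by metis
  then show ?thesis using that by blast
qed

lemma indep_family_of_dual:
  assumes "finite I" "\<And>i j. i \<in> I \<Longrightarrow> j \<in> I \<Longrightarrow> bil (r i) (v j) = (if i = j then 1 else 0)"
  shows "indep_family I v"
  unfolding indep_family_def
proof (intro allI impI ballI)
  fix c i assume s: "(\<Sum>j\<in>I. c j *s v j) = 0" and i: "i \<in> I"
  have "0 = bil (r i) (\<Sum>j\<in>I. c j *s v j)" by (simp add: s)
  also have "\<dots> = (\<Sum>j\<in>I. c j * (if i = j then 1 else 0))"
    unfolding bil_sum_right using assms(2)[OF i] by (intro sum.cong) (auto simp: bil_scale_right)
  also have "\<dots> = c i"
    using assms(1) i by (simp add: if_distrib cong: if_cong)
  finally show "c i = 0" by simp
qed

lemma indep_family_independent: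
  fixes v :: "'a \<Rightarrow> complex ^ 'i"
  assumes "finite I" and ind: "indep_family I v"
  shows "inj_on v I" "vec.independent (v ` I)"
proof -
  obtain r where r: "\<And>i j. i \<in> I \<Longrightarrow> j \<in> I \<Longrightarrow> bil (r i) (v j) = (if i = j then 1 else 0)"
    using indep_family_dual[OF assms] by blast
  show inj: "inj_on v I"
  proof (rule inj_onI)
    fix i j assume "i \<in> I" "j \<in> I" "v i = v j"
    then have "bil (r i) (v i) = bil (r i) (v j)" by simp
    with r[of i i] r[of i j] \<open>i \<in> I\<close> \<open>j \<in> I\<close> show "i = j" by (auto split: if_splits)
  qed
  show "vec.independent (v ` I)"
    unfolding vec.independent_explicit_finite_subsets
  proof (intro allI impI ballI)
    fix A u b assume A: "A \<subseteq> v ` I" "finite A" "(\<Sum>v\<in>A. u v *s v) = 0" and b: "b \<in> A"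
    define c where "c i = (if v i \<in> A then u (v i) else 0)" for i
    have "(\<Sum>i\<in>I. c i *s v i) = (\<Sum>w\<in>v ` I. (if w \<in> A then u w else 0) *s w)"
      using inj by (simp add: sum.reindex c_def)
    also have "\<dots> = (\<Sum>w\<in>A. u w *s w)"
      using A(1) assms(1) by (intro sum.mono_neutral_cong_right) auto
    finally have s: "(\<Sum>i\<in>I. c i *s v i) = 0" using A(3) by simp
    from b A(1) obtain i where i: "i \<in> I" "b = v i" by blast
    have "c i = 0" using ind s i(1) unfolding indep_family_def by blast
    then show "u b = 0" using i b by (simp add: c_def)
  qed
qed

text \<open>The complement of the annihilator is spanned by the dual family, not by \<open>v\<close>
  itself: \<open>bil\<close> may degenerate on the span of \<open>v\<close>, which can then meet its
  own annihilator.\<close>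

lemma dim_annihilator_family:
  fixes v :: "'a \<Rightarrow> complex ^ 'i"
  assumes "finite I" and ind: "indep_family I v"
  shows "vec.dim (annihilator (v ` I)) + card I = CARD('i)"
proof -
  obtain r where r: "\<And>i j. i \<in> I \<Longrightarrow> j \<in> I \<Longrightarrow> bil (r i) (v j) = (if i = j then 1 else 0)"
    using indep_family_dual[OF assms] by blast
  have "indep_family I r"
    using assms(1) by (rule indep_family_of_dual[where r = v]) (auto simp: bil_commute[of "v _"] r)
  note indr = indep_family_independent[OF assms(1) this]
  have coeff: "bil (v j) (\<Sum>i\<in>I. c i *s r i) = c j" if "j \<in> I" for c j
  proof -
    have "bil (v j) (\<Sum>i\<in>I. c i *s r i) = (\<Sum>i\<in>I. c i * (if i = j then 1 else 0))"
      unfolding bil_sum_right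
      by (intro sum.cong refl) (simp add: bil_scale_right bil_commute[of "v j"] r that)
    also have "\<dots> = c j" using that assms(1) by (simp add: if_distrib cong: if_cong)
    finally show ?thesis .
  qed
  let ?R = "vec.span (r ` I)"
  let ?A = "annihilator (v ` I)"
  have dimR: "vec.dim ?R = card I"
    using indr by (simp add: vec.dim_eq_card_independent card_image)
  have spanI: "(\<Sum>i\<in>I. c i *s r i) \<in> ?R" for c
    by (intro vec.span_sum vec.span_scale vec.span_base) auto
  have decomp: "\<exists>c. z - (\<Sum>i\<in>I. c i *s r i) \<in> ?A" for z
    by (rule exI[of _ "\<lambda>i. bil (v i) z"]) (auto intro!: annihilatorI simp: bil_diff_right coeff)
  have inR: "\<exists>c. z = (\<Sum>i\<in>I. c i *s r i)" if "z \<in> ?R" for z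
    using that assms(1) by (auto simp: span_family)
  have "?A \<inter> ?R \<subseteq> {0}"
  proof
    fix z assume z: "z \<in> ?A \<inter> ?R"
    then obtain c where c: "z = (\<Sum>i\<in>I. c i *s r i)" using inR by blast
    have "c j = 0" if "j \<in> I" for j
      using coeff[OF that, of c] z that c annihilatorD[of z "v ` I" "v j"] by auto
    then show "z \<in> {0}" by (simp add: c)
  qed
  then have "?A \<inter> ?R = {0}"
    using vec.subspace_0[OF subspace_annihilator] vec.span_zero by blast
  moreover have "{x + y | x y. x \<in> ?A \<and> y \<in> ?R} = UNIV"
  proof -
    have "z \<in> {x + y | x y. x \<in> ?A \<and> y \<in> ?R}" for z
    proof -
      obtain c where "z - (\<Sum>i\<in>I. c i *s r i) \<in> ?A" using decomp by blast
      moreover have "z = (z - (\<Sum>i\<in>I. c i *s r i)) + (\<Sum>i\<in>I. c i *s r i)" by simp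
      ultimately show ?thesis using spanI by blast
    qed
    then show ?thesis by blast
  qed
  ultimately have "vec.dim (UNIV :: (complex ^ 'i) set) + vec.dim {0 :: complex ^ 'i} = vec.dim ?A + vec.dim ?R"
    using vec.dim_sums_Int[OF subspace_annihilator[of "v ` I"] vec.subspace_span[of "r ` I"]] by simp
  moreover have "vec.dim (UNIV :: (complex ^ 'i) set) = CARD('i)"
    by (rule vec_dim_card)
  ultimately show ?thesis using dimR by (simp add: vec.dim_eq_0)
qed

lemma indep_family_card_le:
  fixes v :: "'a \<Rightarrow> complex ^ 'i"
  assumes "finite I" and "indep_family I v" and "v ` I \<subseteq> U"
  shows "card I \<le> vec.dim U"
  using vec.independent_card_le_dim[OF assms(3)] indep_family_independent[OF assms(1,2)]
  by (simp add: card_image)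

subsection \<open>Constructible sets and elimination of quantifiers\<close>

text \<open>Functions of assignments rather than of vectors: eliminating an unknown is then an
  update at one index, and the index type can be enlarged by auxiliary unknowns.\<close>

inductive_set polys :: "(('v \<Rightarrow> complex) \<Rightarrow> complex) set" where
  polys_const: "(\<lambda>_. c) \<in> polys"
| polys_var: "(\<lambda>v. v i) \<in> polys"
| polys_add: "f \<in> polys \<Longrightarrow> g \<in> polys \<Longrightarrow> (\<lambda>v. f v + g v) \<in> polys"
| polys_mult: "f \<in> polys \<Longrightarrow> g \<in> polys \<Longrightarrow> (\<lambda>v. f v * g v) \<in> polys"

lemma polys_uminus: "f \<in> polys \<Longrightarrow> (\<lambda>v. - f v) \<in> polys"
  using polys_mult[OF polys_const[of "-1"]] by simp

lemma polys_diff: "f \<in> polys \<Longrightarrow> g \<in> polys \<Longrightarrow> (\<lambda>v. f v - g v) \<in> polys"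
  using polys_add[OF _ polys_uminus, of f g] by simp

lemma polys_sum: "(\<And>i. i \<in> I \<Longrightarrow> f i \<in> polys) \<Longrightarrow> (\<lambda>v. \<Sum>i\<in>I. f i v) \<in> polys"
  by (induction I rule: infinite_finite_induct) (auto intro: polys_const polys_add)

lemmas polys_intros = polys_const polys_var polys_add polys_mult polys_uminus polys_diff polys_sum

lemma polys_line:
  assumes "f \<in> polys"
  shows "\<exists>p. \<forall>t. f (\<lambda>i. a i + t * b i) = poly p t"
  using assms
proof induction
  case (polys_const c)
  show ?case by (rule exI[of _ "[:c:]"]) simp
next
  case (polys_var i)
  show ?case by (rule exI[of _ "[:a i, b i:]"]) simp
next
  case (polys_add f g)
  then obtain p q where "\<forall>t. f (\<lambda>i. a i + t * b i) = poly p t" "\<forall>t. g (\<lambda>i. a i + t * b i) = poly q t"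
    by blast
  then show ?case by (intro exI[of _ "p + q"]) simp
next
  case (polys_mult f g)
  then obtain p q where "\<forall>t. f (\<lambda>i. a i + t * b i) = poly p t" "\<forall>t. g (\<lambda>i. a i + t * b i) = poly q t"
    by blast
  then show ?case by (intro exI[of _ "p * q"]) simp
qed

text \<open>On the line through \<open>v\<close> and \<open>w\<close> both factors become nonzero
  polynomials in one variable, hence so does their product. This is the irreducibility of affine
  space.\<close>

lemma polys_mult_nonzero:
  assumes "f \<in> polys" "g \<in> polys" "f v \<noteq> 0" "g w \<noteq> 0"
  shows "\<exists>u. f u * g u \<noteq> 0"
proof -
  obtain p where p: "\<And>t. f (\<lambda>i. v i + t * (w i - v i)) = poly p t"
    using polys_line[OF assms(1), of v "\<lambda>i. w i - v i"] by blast
  obtain q where q: "\<And>t. g (\<lambda>i. v i + t * (w i - v i)) = poly q t"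
    using polys_line[OF assms(2), of v "\<lambda>i. w i - v i"] by blast
  have "p \<noteq> 0" using p[of 0] assms(3) by auto
  moreover have "q \<noteq> 0" using q[of 1] assms(4) by auto
  ultimately have "p * q \<noteq> 0" by simp
  then obtain t where "poly (p * q) t \<noteq> 0"
    using poly_all_0_iff_0 by blast
  then show ?thesis using p[of t] q[of t] by (metis poly_mult)
qed

inductive_set constructible :: "('v \<Rightarrow> complex) set set" where
  constructible_zeros: "f \<in> polys \<Longrightarrow> {v. f v = 0} \<in> constructible"
| constructible_Compl: "S \<in> constructible \<Longrightarrow> - S \<in> constructible"
| constructible_Int: "S \<in> constructible \<Longrightarrow> S' \<in> constructible \<Longrightarrow> S \<inter> S' \<in> constructible"

lemma constructible_Un:
  assumes "S \<in> constructible" "S' \<in> constructible" shows "S \<union> S' \<in> constructible"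
proof -
  have "- (- S \<inter> - S') \<in> constructible"
    using assms by (intro constructible_Compl constructible_Int)
  then show ?thesis by (simp add: Compl_Int)
qed

lemma constructible_empty: "{} \<in> constructible"
  using constructible_zeros[OF polys_const[of 1]] by simp

lemma constructible_UNIV: "UNIV \<in> constructible"
  using constructible_Compl[OF constructible_empty] by simp

lemma constructible_nonzeros: "f \<in> polys \<Longrightarrow> {v. f v \<noteq> 0} \<in> constructible"
  using constructible_Compl[OF constructible_zeros, of f] by (simp add: Collect_neg_eq[symmetric] Compl_eq)

lemma constructible_INT:
  "finite I \<Longrightarrow> (\<And>i. i \<in> I \<Longrightarrow> S i \<in> constructible) \<Longrightarrow> (\<Inter>i\<in>I. S i) \<in> constructible"
  by (induction I rule: finite_induct) (auto intro: constructible_UNIV constructible_Int)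

lemma constructible_UN:
  "finite I \<Longrightarrow> (\<And>i. i \<in> I \<Longrightarrow> S i \<in> constructible) \<Longrightarrow> (\<Union>i\<in>I. S i) \<in> constructible"
  by (induction I rule: finite_induct) (auto intro: constructible_empty constructible_Un)

section \<open>Normal form: finite unions of sets given by equations and one inequation\<close>

definition basic_set :: "(('v \<Rightarrow> complex) \<Rightarrow> complex) list \<times> (('v \<Rightarrow> complex) \<Rightarrow> complex) \<Rightarrow> ('v \<Rightarrow> complex) set" where
  "basic_set b = {v. (\<forall>f\<in>set (fst b). f v = 0) \<and> snd b v \<noteq> 0}"

definition basic_data :: "((('v \<Rightarrow> complex) \<Rightarrow> complex) list \<times> (('v \<Rightarrow> complex) \<Rightarrow> complex)) set" where
  "basic_data = {b. set (fst b) \<subseteq> polys \<and> snd b \<in> polys}"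

definition basic_unions :: "('v \<Rightarrow> complex) set set" where
  "basic_unions = {\<Union>b\<in>B. basic_set b | B. finite B \<and> B \<subseteq> basic_data}"

lemma basic_unionsI: "finite B \<Longrightarrow> B \<subseteq> basic_data \<Longrightarrow> (\<Union>b\<in>B. basic_set b) \<in> basic_unions"
  by (auto simp: basic_unions_def)

lemma basic_unionsE:
  assumes "S \<in> basic_unions"
  obtains B where "finite B" "B \<subseteq> basic_data" "S = (\<Union>b\<in>B. basic_set b)"
  using assms by (auto simp: basic_unions_def)

lemma basic_unions_Int:
  fixes S S' :: "('a \<Rightarrow> complex) set"
  assumes "S \<in> basic_unions" "S' \<in> basic_unions"
  shows "S \<inter> S' \<in> basic_unions"
proof -
  obtain B where B: "finite B" "B \<subseteq> basic_data" "S = (\<Union>b\<in>B. basic_set b)"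
    using assms(1) by (rule basic_unionsE)
  obtain B' where B': "finite B'" "B' \<subseteq> basic_data" "S' = (\<Union>b\<in>B'. basic_set b)"
    using assms(2) by (rule basic_unionsE)
  define f where "f p = (fst (fst p) @ fst (snd p), \<lambda>v. snd (fst p) v * snd (snd p) v)"
    for p :: "((('a \<Rightarrow> complex) \<Rightarrow> complex) list \<times> (('a \<Rightarrow> complex) \<Rightarrow> complex)) \<times> _"
  have f: "basic_set (f p) = basic_set (fst p) \<inter> basic_set (snd p)" for p
    by (auto simp: basic_set_def f_def)
  have "S \<inter> S' = (\<Union>b\<in>f ` (B \<times> B'). basic_set b)"
    unfolding B(3) B'(3) by (auto simp: f)
  moreover have fd: "f p \<in> basic_data" if "fst p \<in> basic_data" "snd p \<in> basic_data" for p
    using that by (auto simp: basic_data_def f_def intro: polys_mult)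
  then have "f ` (B \<times> B') \<subseteq> basic_data"
    using B(2) B'(2) by (intro image_subsetI fd) (auto simp: mem_Times_iff)
  ultimately show ?thesis
    using basic_unionsI[of "f ` (B \<times> B')"] B(1) B'(1) by simp
qed

text \<open>Either the inequation fails or one of the equations does; each alternative is again a
  basic set.\<close>

lemma basic_unions_Compl_basic:
  assumes "b \<in> basic_data"
  shows "- basic_set b \<in> basic_unions"
proof -
  let ?B = "insert ([snd b], \<lambda>_. 1) ((\<lambda>f. ([], f)) ` set (fst b))"
  have "- basic_set b = (\<Union>b\<in>?B. basic_set b)"
    by (auto simp: basic_set_def)
  moreover have "?B \<subseteq> basic_data"
    using assms by (auto simp: basic_data_def intro: polys_const)
  ultimately show ?thesis using basic_unionsI[of ?B] by simp
qed

lemma basic_unions_Compl: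
  fixes S :: "('a \<Rightarrow> complex) set"
  assumes "S \<in> basic_unions"
  shows "- S \<in> basic_unions"
proof -
  obtain B where B: "finite B" "B \<subseteq> basic_data" "S = (\<Union>b\<in>B. basic_set b)"
    using assms by (rule basic_unionsE)
  have "- (\<Union>b\<in>B. basic_set b) \<in> basic_unions"
    using B(1,2)
  proof (induction B)
    case empty
    define b where "b = ([] :: (('a \<Rightarrow> complex) \<Rightarrow> complex) list, \<lambda>_ :: 'a \<Rightarrow> complex. 1 :: complex)"
    have "basic_set b = UNIV" by (simp add: basic_set_def b_def)
    moreover have "b \<in> basic_data" by (simp add: basic_data_def polys_const b_def)
    ultimately show ?case using basic_unionsI[of "{b}"] by simp
  next
    case (insert b B)
    have "- (\<Union>b\<in>insert b B. basic_set b) = - basic_set b \<inter> - (\<Union>b\<in>B. basic_set b)" by auto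
    then show ?case
      using insert basic_unions_Int basic_unions_Compl_basic by (metis insert_subset)
  qed
  then show ?thesis by (simp add: B(3))
qed

lemma constructible_basic_unions: "S \<in> constructible \<Longrightarrow> S \<in> basic_unions"
proof (induction rule: constructible.induct)
  case (constructible_zeros f)
  then have "{([f], \<lambda>_. 1)} \<subseteq> basic_data" by (simp add: basic_data_def polys_const)
  moreover have "{v. f v = 0} = (\<Union>b\<in>{([f], \<lambda>_. 1)}. basic_set b)" by (simp add: basic_set_def)
  ultimately show ?case using basic_unionsI[of "{([f], \<lambda>_. 1)}"] by simp
next
  case (constructible_Compl S)
  then show ?case by (simp add: basic_unions_Compl)
next
  case (constructible_Int S S')
  then show ?case by (simp add: basic_unions_Int)
qed

section \<open>Univariate polynomials whose coefficients depend polynomially on parameters\<close>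

definition param_poly :: "nat \<Rightarrow> (('v \<Rightarrow> complex) \<Rightarrow> complex poly) \<Rightarrow> bool" where
  "param_poly n F \<longleftrightarrow> (\<forall>v. degree (F v) \<le> n) \<and> (\<forall>k. (\<lambda>v. coeff (F v) k) \<in> polys)"

lemma param_poly_coeff: "param_poly n F \<Longrightarrow> (\<lambda>v. coeff (F v) k) \<in> polys"
  by (simp add: param_poly_def)

lemma param_poly_degree: "param_poly n F \<Longrightarrow> degree (F v) \<le> n"
  by (simp add: param_poly_def)

lemma param_poly_add: 
  assumes "param_poly n F" "param_poly m G" shows "param_poly (max n m) (\<lambda>v. F v + G v)"
  unfolding param_poly_def
proof (intro conjI allI)
  fix v show "degree (F v + G v) \<le> max n m"
    using assms by (intro degree_add_le) (auto simp: param_poly_def intro: le_trans)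
next
  fix k show "(\<lambda>v. coeff (F v + G v) k) \<in> polys"
    using assms by (auto simp: param_poly_def intro!: polys_intros)
qed

lemma param_poly_mult:
  assumes "param_poly n F" "param_poly m G" shows "param_poly (n + m) (\<lambda>v. F v * G v)"
  unfolding param_poly_def
proof (intro conjI allI)
  fix v
  have "degree (F v * G v) \<le> degree (F v) + degree (G v)" by (rule degree_mult_le)
  also have "\<dots> \<le> n + m" using assms by (intro add_mono) (auto simp: param_poly_def)
  finally show "degree (F v * G v) \<le> n + m" .
next
  fix k show "(\<lambda>v. coeff (F v * G v) k) \<in> polys"
    using assms by (auto simp: param_poly_def coeff_mult intro!: polys_intros)
qed

lemma param_poly_power: "param_poly n F \<Longrightarrow> param_poly (k * n) (\<lambda>v. F v ^ k)"
proof (induction k)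
  case 0
  show ?case by (simp add: param_poly_def polys_const)
next
  case (Suc k)
  then show ?case using param_poly_mult[of n F "k * n" "\<lambda>v. F v ^ k"] by (simp add: add.commute)
qed

text \<open>A polynomial in many unknowns is read as a polynomial in the unknown \<open>i\<close>
  alone, with a degree bound uniform in the others; the true degree may drop for special
  parameters.\<close>

lemma polys_update:
  assumes "f \<in> polys"
  shows "\<exists>n F. param_poly n F \<and> (\<forall>v c. f (v(i := c)) = poly (F v) c)"
  using assms
proof induction
  case (polys_const c)
  have "param_poly 0 (\<lambda>_. [:c:])"
    by (auto simp: param_poly_def coeff_pCons polys.polys_const split: nat.split)
  then show ?case by (intro exI[of _ 0] exI[of _ "\<lambda>_. [:c:]"]) simp
next
  case (polys_var j)
  show ?case
  proof (cases "j = i")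
    case True
    have "param_poly 1 (\<lambda>_. [:0, 1:])"
      by (simp add: param_poly_def polys.polys_const)
    with True show ?thesis by (intro exI[of _ 1] exI[of _ "\<lambda>_. [:0, 1:]"]) simp
  next
    case False
    have "(\<lambda>v. coeff [:v j:] k) \<in> polys" for k
      by (cases k) (auto intro: polys.polys_var polys.polys_const)
    then have "param_poly 0 (\<lambda>v. [:v j:])"
      by (simp add: param_poly_def)
    with False show ?thesis by (intro exI[of _ 0] exI[of _ "\<lambda>v. [:v j:]"]) simp
  qed
next
  case (polys_add f g)
  then obtain n F m G where "param_poly n F" "\<forall>v c. f (v(i := c)) = poly (F v) c"
    "param_poly m G" "\<forall>v c. g (v(i := c)) = poly (G v) c" by blast
  then show ?case
    by (intro exI[of _ "max n m"] exI[of _ "\<lambda>v. F v + G v"]) (simp add: param_poly_add del: fun_upd_apply)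
next
  case (polys_mult f g)
  then obtain n F m G where "param_poly n F" "\<forall>v c. f (v(i := c)) = poly (F v) c"
    "param_poly m G" "\<forall>v c. g (v(i := c)) = poly (G v) c" by blast
  then show ?case
    by (intro exI[of _ "n + m"] exI[of _ "\<lambda>v. F v * G v"]) (simp add: param_poly_mult del: fun_upd_apply)
qed

lemma constructible_param_poly_zero:
  assumes "param_poly n F" shows "{v. F v = 0} \<in> constructible"
proof -
  have "{v. F v = 0} = (\<Inter>k\<in>{..n}. {v. coeff (F v) k = 0})"
  proof (intro equalityI subsetI)
    fix v assume v: "v \<in> (\<Inter>k\<in>{..n}. {v. coeff (F v) k = 0})"
    have "coeff (F v) k = 0" for k
    proof (cases "k \<le> n")
      case True then show ?thesis using v by auto
    next
      case False
      then show ?thesis using param_poly_degree[OF assms, of v] by (intro coeff_eq_0) simp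
    qed
    then show "v \<in> {v. F v = 0}" by (simp add: poly_eq_iff)
  qed simp
  also have "\<dots> \<in> constructible"
    using param_poly_coeff[OF assms] by (intro constructible_INT constructible_zeros) auto
  finally show ?thesis .
qed

text \<open>One step of pseudo-division: \<open>m\<close> and \<open>n\<close> are degree bounds, so the coefficients used may vanish.\<close>

definition reduce :: "nat \<Rightarrow> nat \<Rightarrow> ('v \<Rightarrow> complex poly) \<Rightarrow> ('v \<Rightarrow> complex poly) \<Rightarrow> 'v \<Rightarrow> complex poly" where
  "reduce n m F G v = smult (coeff (F v) n) (G v) - monom (coeff (G v) m) (m - n) * F v"

lemma param_poly_reduce:
  assumes F: "param_poly n F" and G: "param_poly m G" and "n \<le> m" "0 < m"
  shows "param_poly (m - 1) (reduce n m F G)"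
  unfolding param_poly_def
proof (intro conjI allI)
  fix v
  show "degree (reduce n m F G v) \<le> m - 1"
  proof (rule degree_le, intro allI impI)
    fix k assume "m - 1 < k"
    then consider "k = m" | "m < k" using \<open>0 < m\<close> by linarith
    then show "coeff (reduce n m F G v) k = 0"
    proof cases
      case 1
      then show ?thesis
        using \<open>n \<le> m\<close> by (simp add: reduce_def coeff_monom_mult)
    next
      case 2
      then have "coeff (G v) k = 0" "coeff (F v) (k - (m - n)) = 0"
        using param_poly_degree[OF F, of v] param_poly_degree[OF G, of v] \<open>n \<le> m\<close>
        by (auto intro!: coeff_eq_0)
      then show ?thesis by (simp add: reduce_def coeff_monom_mult)
    qed
  qed
next
  fix k
  show "(\<lambda>v. coeff (reduce n m F G v) k) \<in> polys"
    using param_poly_coeff[OF F] param_poly_coeff[OF G]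
    by (cases "m - n \<le> k") (auto simp: reduce_def coeff_monom_mult intro!: polys_intros)
qed

text \<open>Where the coefficient of \<open>F v\<close> at its degree bound is nonzero, scaling
  \<open>G v\<close> by it and subtracting a multiple of \<open>F v\<close> does not affect
  divisibility. So the bound of \<open>G\<close> can be lowered until it is below that of
  \<open>F\<close>, where divisibility means \<open>G v = 0\<close>; a constant \<open>F v\<close>
  is a unit.\<close>

lemma constructible_dvd:
  assumes F: "param_poly n F"
  shows "param_poly m G \<Longrightarrow> {v. coeff (F v) n \<noteq> 0 \<and> F v dvd G v} \<in> constructible"
proof (induction m arbitrary: G rule: less_induct)
  case (less m)
  have deg: "degree (F v) = n" if "coeff (F v) n \<noteq> 0" for v
    using le_degree[OF that] param_poly_degree[OF F, of v] by simp
  have nz: "{v. coeff (F v) n \<noteq> 0} \<in> constructible"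
    by (intro constructible_nonzeros param_poly_coeff[OF F])
  consider "n = 0" | "m < n" | "0 < n" "n \<le> m" by linarith
  then show ?case
  proof cases
    case 1
    have "F v dvd G v" if "coeff (F v) n \<noteq> 0" for v
    proof -
      have "F v = [:coeff (F v) 0:]" using degree_0_id[of "F v"] deg[OF that] 1 by simp
      moreover have "is_unit [:coeff (F v) 0:]" using that 1 by (simp add: is_unit_const_poly_iff dvd_field_iff)
      ultimately show ?thesis by (metis unit_imp_dvd)
    qed
    then have "{v. coeff (F v) n \<noteq> 0 \<and> F v dvd G v} = {v. coeff (F v) n \<noteq> 0}" by auto
    then show ?thesis using nz by simp
  next
    case 2
    have "F v dvd G v \<longleftrightarrow> G v = 0" if "coeff (F v) n \<noteq> 0" for v
      using dvd_imp_degree_le[of "F v" "G v"] deg[OF that] param_poly_degree[OF less.prems, of v] 2 by auto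
    then have "{v. coeff (F v) n \<noteq> 0 \<and> F v dvd G v} = {v. coeff (F v) n \<noteq> 0} \<inter> {v. G v = 0}" by auto
    then show ?thesis using nz constructible_param_poly_zero[OF less.prems] constructible_Int by simp
  next
    case 3
    have "F v dvd G v \<longleftrightarrow> F v dvd reduce n m F G v" if "coeff (F v) n \<noteq> 0" for v
    proof -
      have "F v dvd reduce n m F G v \<longleftrightarrow> F v dvd smult (coeff (F v) n) (G v)"
        unfolding reduce_def by (rule dvd_diff_left_iff) simp
      then show ?thesis using that by (simp add: dvd_smult_iff)
    qed
    then have "{v. coeff (F v) n \<noteq> 0 \<and> F v dvd G v} = {v. coeff (F v) n \<noteq> 0 \<and> F v dvd reduce n m F G v}" by auto
    then show ?thesis
      using less.IH[of "m - 1" "reduce n m F G"] param_poly_reduce[OF F less.prems] 3 by simp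
  qed
qed

section \<open>Systems of equations and one inequation in a single unknown\<close>

definition root_params :: "(nat \<times> (('v \<Rightarrow> complex) \<Rightarrow> complex poly)) list \<Rightarrow> (('v \<Rightarrow> complex) \<Rightarrow> complex poly) \<Rightarrow> ('v \<Rightarrow> complex) set" where
  "root_params K H = {v. \<exists>c. (\<forall>F\<in>snd ` set K. poly (F v) c = 0) \<and> poly (H v) c \<noteq> 0}"

definition drop_lead :: "nat \<Rightarrow> ('v \<Rightarrow> complex poly) \<Rightarrow> 'v \<Rightarrow> complex poly" where
  "drop_lead n F v = F v - monom (coeff (F v) n) n"

lemma param_poly_drop_lead:
  assumes F: "param_poly n F" and "0 < n"
  shows "param_poly (n - 1) (drop_lead n F)"
  unfolding param_poly_def
proof (intro conjI allI)
  fix v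
  show "degree (drop_lead n F v) \<le> n - 1"
  proof (rule degree_le, intro allI impI)
    fix k assume "n - 1 < k"
    then consider "k = n" | "n < k" using \<open>0 < n\<close> by linarith
    then show "coeff (drop_lead n F v) k = 0"
      using param_poly_degree[OF F, of v] by cases (auto simp: drop_lead_def intro: coeff_eq_0)
  qed
next
  fix k
  show "(\<lambda>v. coeff (drop_lead n F v) k) \<in> polys"
    using param_poly_coeff[OF F]
    by (cases "k = n") (auto simp: drop_lead_def intro!: polys_intros)
qed

text \<open>One step of the Euclidean algorithm with parameters. Where the coefficient at the bound
  vanishes, the bound of \<open>F\<close> drops; elsewhere \<open>G\<close> may be replaced by its
  reduction, which has the same common zeros with \<open>F\<close>.\<close>

lemma constructible_root_params_step:
  assumes F: "param_poly n F" and G: "param_poly m G" and "n \<le> m"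
    and drop0: "n = 0 \<Longrightarrow> root_params ((m, G) # K) H \<in> constructible"
    and drop: "0 < n \<Longrightarrow> root_params ((n - 1, drop_lead n F) # (m, G) # K) H \<in> constructible"
    and red: "0 < n \<Longrightarrow> root_params ((n, F) # (m - 1, reduce n m F G) # K) H \<in> constructible"
  shows "root_params ((n, F) # (m, G) # K) H \<in> constructible"
proof -
  let ?Z = "{v. coeff (F v) n = 0}"
  have Z: "?Z \<in> constructible" by (intro constructible_zeros param_poly_coeff[OF F])
  show ?thesis
  proof (cases "n = 0")
    case True
    have const: "F v = [:coeff (F v) n:]" for v
      using param_poly_degree[OF F, of v] True degree_0_id[of "F v"] by simp
    have "poly (F v) c = coeff (F v) n" for v c
      by (subst const) simp
    then have "root_params ((n, F) # (m, G) # K) H = ?Z \<inter> root_params ((m, G) # K) H"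
      by (auto simp: root_params_def)
    then show ?thesis using Z drop0[OF True] constructible_Int by simp
  next
    case False
    have "root_params ((n, F) # (m, G) # K) H =
        (?Z \<inter> root_params ((n - 1, drop_lead n F) # (m, G) # K) H) \<union>
        (- ?Z \<inter> root_params ((n, F) # (m - 1, reduce n m F G) # K) H)" (is "?L = ?R")
    proof -
      have "v \<in> ?L \<longleftrightarrow> v \<in> ?R" for v
      proof (cases "coeff (F v) n = 0")
        case True
        then show ?thesis by (simp add: root_params_def drop_lead_def)
      next
        case False
        then have "poly (F v) c = 0 \<and> poly (G v) c = 0 \<longleftrightarrow> poly (F v) c = 0 \<and> poly (reduce n m F G v) c = 0" for c
          by (auto simp: reduce_def)
        with False show ?thesis by (simp add: root_params_def) metis
      qed
      then show ?thesis by blast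
    qed
    then show ?thesis
      using Z drop red False
      by (simp add: constructible_Un constructible_Int constructible_Compl)
  qed
qed

text \<open>With one equation left, and where its degree is exactly \<open>n\<close>, every root of
  \<open>F\<close> is a root of \<open>H\<close> iff \<open>F\<close> divides \<open>H ^ n\<close>.
  This is where algebraic closedness enters: solvability is the negation of a divisibility
  condition.\<close>

lemma constructible_root_params_single:
  assumes F: "param_poly n F" and H: "param_poly h H"
    and drop0: "n = 0 \<Longrightarrow> root_params [] H \<in> constructible"
    and drop: "0 < n \<Longrightarrow> root_params [(n - 1, drop_lead n F)] H \<in> constructible"
  shows "root_params [(n, F)] H \<in> constructible"
proof -
  let ?Z = "{v. coeff (F v) n = 0}"
  have Z: "?Z \<in> constructible" by (intro constructible_zeros param_poly_coeff[OF F])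
  show ?thesis
  proof (cases "n = 0")
    case True
    have const: "F v = [:coeff (F v) n:]" for v
      using param_poly_degree[OF F, of v] True degree_0_id[of "F v"] by simp
    have "poly (F v) c = coeff (F v) n" for v c
      by (subst const) simp
    then have "root_params [(n, F)] H = ?Z \<inter> root_params [] H"
      by (auto simp: root_params_def)
    then show ?thesis using Z drop0[OF True] constructible_Int by simp
  next
    case False
    let ?D = "{v. coeff (F v) n \<noteq> 0 \<and> F v dvd H v ^ n}"
    have D: "?D \<in> constructible"
      using constructible_dvd[OF F param_poly_power[OF H]] .
    have "root_params [(n, F)] H =
        (?Z \<inter> root_params [(n - 1, drop_lead n F)] H) \<union> (- ?Z \<inter> - ?D)" (is "?L = ?R")
    proof -
      have "v \<in> ?L \<longleftrightarrow> v \<in> ?R" for v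
      proof (cases "coeff (F v) n = 0")
        case True
        then show ?thesis by (simp add: root_params_def drop_lead_def)
      next
        case nz: False
        have "degree (F v) = n"
          using le_degree[OF nz] param_poly_degree[OF F, of v] by simp
        moreover have "F v \<noteq> 0" using nz by auto
        ultimately have "(\<forall>c. poly (F v) c = 0 \<longrightarrow> poly (H v) c = 0) \<longleftrightarrow> F v dvd H v ^ n"
          using nullstellensatz_univariate[of "F v" "H v"] by simp
        with nz show ?thesis by (auto simp: root_params_def)
      qed
      then show ?thesis by blast
    qed
    then show ?thesis
      using Z D drop False by (simp add: constructible_Un constructible_Int constructible_Compl)
  qed
qed

lemma constructible_root_params:
  assumes H: "param_poly h H"
  shows "(\<And>n F. (n, F) \<in> set K \<Longrightarrow> param_poly n F) \<Longrightarrow> root_params K H \<in> constructible"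
\<comment> \<open>\<open>Suc\<close> makes the measure drop also when a polynomial with degree bound
  0 is removed from the list.\<close>
proof (induction "sum_list (map (Suc \<circ> fst) K)" arbitrary: K rule: less_induct)
  case less
  have empty: "root_params [] H \<in> constructible"
  proof -
    have "root_params [] H = - {v. H v = 0}"
      using poly_all_0_iff_0 by (auto simp: root_params_def)
    then show ?thesis using constructible_Compl[OF constructible_param_poly_zero[OF H]] by simp
  qed
  have IH: "root_params K' H \<in> constructible"
    if "sum_list (map (Suc \<circ> fst) K') < sum_list (map (Suc \<circ> fst) K)"
      "\<And>n F. (n, F) \<in> set K' \<Longrightarrow> param_poly n F" for K'
    using less.hyps that by blast
  consider "K = []" | n F where "K = [(n, F)]" | n F m G K' where "K = (n, F) # (m, G) # K'"
    by (metis neq_Nil_conv surj_pair)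
  then show ?case
  proof cases
    case 1
    then show ?thesis using empty by simp
  next
    case (2 n F)
    then have F: "param_poly n F" using less.prems by simp
    show ?thesis
      unfolding 2
    proof (rule constructible_root_params_single[OF F H empty])
      assume "0 < n"
      then show "root_params [(n - 1, drop_lead n F)] H \<in> constructible"
        using param_poly_drop_lead[OF F] by (intro IH) (auto simp: 2)
    qed
  next
    case (3 n F m G K')
    have main: "root_params ((n, F) # (m, G) # K') H \<in> constructible"
      if nm: "n \<le> m" and pp: "param_poly n F" "param_poly m G" 
        and K': "\<And>n F. (n, F) \<in> set K' \<Longrightarrow> param_poly n F"
        and sz: "sum_list (map (Suc \<circ> fst) K) = Suc n + Suc m + sum_list (map (Suc \<circ> fst) K')" for n F m G
    proof (rule constructible_root_params_step[OF pp nm])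
      show "root_params ((m, G) # K') H \<in> constructible"
        using pp K' sz by (intro IH) auto
    next
      assume "0 < n"
      then show "root_params ((n - 1, drop_lead n F) # (m, G) # K') H \<in> constructible"
        using param_poly_drop_lead[OF pp(1)] pp K' sz by (intro IH) auto
    next
      assume "0 < n"
      then show "root_params ((n, F) # (m - 1, reduce n m F G) # K') H \<in> constructible"
        using param_poly_reduce[OF pp nm] nm pp K' sz by (intro IH) auto
    qed
    have K': "\<And>n F. (n, F) \<in> set K' \<Longrightarrow> param_poly n F" and pp: "param_poly n F" "param_poly m G"
      using less.prems 3 by auto
    show ?thesis
    proof (cases "n \<le> m")
      case True
      then show ?thesis using main[of n m F G] K' pp 3 by simp
    next
      case False
      \<comment> \<open>Only the polynomial with the larger bound can be reduced, so the first two
        equations are exchanged if necessary.\<close>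
      have "root_params ((m, G) # (n, F) # K') H = root_params K H"
        unfolding root_params_def 3 by (simp add: conj_left_commute)
      then show ?thesis using main[of m n G F] False K' pp 3 by simp
    qed
  qed
qed

text \<open>An existential quantifier commutes with finite unions, and on a basic set it asks for
  the solvability of a system in one unknown. This is Chevalley's theorem for a coordinate
  projection.\<close>

lemma constructible_exists:
  assumes "S \<in> constructible"
  shows "{v. \<exists>c. v(i := c) \<in> S} \<in> constructible"
proof -
  obtain B where B: "finite B" "B \<subseteq> basic_data" "S = (\<Union>b\<in>B. basic_set b)"
    using constructible_basic_unions[OF assms] by (rule basic_unionsE)
  have "{v. \<exists>c. v(i := c) \<in> basic_set b} \<in> constructible" if "b \<in> basic_data" for b
  proof -
    obtain fs h where b: "b = (fs, h)" by fastforce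
    have polys: "\<And>f. f \<in> set fs \<Longrightarrow> f \<in> polys" "h \<in> polys"
      using that b by (auto simp: basic_data_def)
    obtain N P where P: "\<And>f. f \<in> set fs \<Longrightarrow> param_poly (N f) (P f)"
      "\<And>f v c. f \<in> set fs \<Longrightarrow> f (v(i := c)) = poly (P f v) c"
      using polys_update[OF polys(1), of _ i] by metis
    obtain n H where H: "param_poly n H" "\<And>v c. h (v(i := c)) = poly (H v) c"
      using polys_update[OF polys(2), of i] by blast
    have "{v. \<exists>c. v(i := c) \<in> basic_set b} = root_params (map (\<lambda>f. (N f, P f)) fs) H"
      by (auto simp: basic_set_def b root_params_def P(2) H(2))
    then show ?thesis
      using constructible_root_params[OF H(1), of "map (\<lambda>f. (N f, P f)) fs"] P(1) by auto
  qed
  then have "(\<Union>b\<in>B. {v. \<exists>c. v(i := c) \<in> basic_set b}) \<in> constructible"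
    using B by (intro constructible_UN) auto
  moreover have "{v. \<exists>c. v(i := c) \<in> S} = (\<Union>b\<in>B. {v. \<exists>c. v(i := c) \<in> basic_set b})"
    by (auto simp: B(3))
  ultimately show ?thesis by simp
qed

text \<open>The projection stays inside the same space of assignments: the result is invariant under
  changes in \<open>B\<close>, which spares a change of index type at every elimination.\<close>

lemma constructible_exists_finite:
  assumes "finite B" "S \<in> constructible"
  shows "{v. \<exists>w. (\<forall>i. i \<notin> B \<longrightarrow> w i = v i) \<and> w \<in> S} \<in> constructible"
  using assms(1)
proof induction
  case empty
  have "{v. \<exists>w. (\<forall>i. i \<notin> {} \<longrightarrow> w i = v i) \<and> w \<in> S} = S"
    by (auto simp: fun_eq_iff[symmetric])
  then show ?case using assms(2) by simp
next
  case (insert j B)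
  let ?S = "{v. \<exists>w. (\<forall>i. i \<notin> B \<longrightarrow> w i = v i) \<and> w \<in> S}"
  have "{v. \<exists>w. (\<forall>i. i \<notin> insert j B \<longrightarrow> w i = v i) \<and> w \<in> S} = {v. \<exists>c. v(j := c) \<in> ?S}"
  proof (intro equalityI subsetI)
    fix v assume "v \<in> {v. \<exists>w. (\<forall>i. i \<notin> insert j B \<longrightarrow> w i = v i) \<and> w \<in> S}"
    then obtain w where w: "\<forall>i. i \<notin> insert j B \<longrightarrow> w i = v i" "w \<in> S" by blast
    then have "v(j := w j) \<in> ?S" by (auto intro!: exI[of _ w])
    then show "v \<in> {v. \<exists>c. v(j := c) \<in> ?S}" by blast
  next
    fix v assume "v \<in> {v. \<exists>c. v(j := c) \<in> ?S}"
    then show "v \<in> {v. \<exists>w. (\<forall>i. i \<notin> insert j B \<longrightarrow> w i = v i) \<and> w \<in> S}"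
      by (auto split: if_splits)
  qed
  then show ?case using constructible_exists[OF insert.IH, of j] by simp
qed

text \<open>A zero set is everything or avoids the points where \<open>f\<close> is nonzero;
  complements swap the alternatives; for intersections the product of the two witnesses works and is
  nonzero by irreducibility.\<close>

lemma constructible_dichotomy:
  assumes "S \<in> constructible"
  shows "\<exists>f\<in>polys. (\<exists>v. f v \<noteq> 0) \<and> ((\<forall>v. f v \<noteq> 0 \<longrightarrow> v \<in> S) \<or> (\<forall>v. f v \<noteq> 0 \<longrightarrow> v \<notin> S))"
  using assms
proof induction
  case (constructible_zeros f)
  show ?case
  proof (cases "\<forall>v. f v = 0")
    case True
    then show ?thesis by (intro bexI[OF _ polys_const[of 1]]) auto
  next
    case False
    then show ?thesis using constructible_zeros by (intro bexI[of _ f]) auto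
  qed
next
  case (constructible_Compl S)
  then show ?case by auto
next
  case (constructible_Int S S')
  then obtain f g where fg: "f \<in> polys" "g \<in> polys" "\<exists>v. f v \<noteq> 0" "\<exists>v. g v \<noteq> 0"
    "(\<forall>v. f v \<noteq> 0 \<longrightarrow> v \<in> S) \<or> (\<forall>v. f v \<noteq> 0 \<longrightarrow> v \<notin> S)"
    "(\<forall>v. g v \<noteq> 0 \<longrightarrow> v \<in> S') \<or> (\<forall>v. g v \<noteq> 0 \<longrightarrow> v \<notin> S')" by blast
  show ?case
    using fg polys_mult_nonzero[OF fg(1,2)]
    by (intro bexI[OF _ polys_mult[OF fg(1,2)]]) (auto 4 3)
qed

subsection \<open>Polynomial functions and general position\<close>

lemma vec_nth_vec_lambda: "($) (vec_lambda u) = u"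
  by (rule ext) simp

lemma polynomial_fun_const: "polynomial_fun (\<lambda>_ :: complex ^ 'i. c)"
  unfolding polynomial_fun_def
  by (rule exI[of _ "{\<lambda>_. 0}"], rule exI[of _ "\<lambda>_. c"]) simp

lemma polynomial_fun_nth: "polynomial_fun (\<lambda>x :: complex ^ 'i. x $ k)"
proof -
  have "(\<Prod>i\<in>UNIV. (x $ i) ^ (if i = k then 1 else 0)) = x $ k" for x :: "complex ^ 'i"
  proof -
    have "(\<Prod>i\<in>UNIV. (x $ i) ^ (if i = k then 1 else 0)) = (\<Prod>i\<in>UNIV. if i = k then x $ i else 1)"
      by (rule prod.cong) auto
    then show ?thesis by simp
  qed
  then show ?thesis
    unfolding polynomial_fun_def
    by (intro exI[of _ "{\<lambda>i. if i = k then 1 else 0}"] exI[of _ "\<lambda>_. 1"]) simp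
qed

lemma polynomial_fun_add:
  assumes "polynomial_fun f" "polynomial_fun g"
  shows "polynomial_fun (\<lambda>x. f x + g x)"
proof -
  obtain A c where A: "finite A" "\<And>x. f x = (\<Sum>\<alpha>\<in>A. c \<alpha> * (\<Prod>i\<in>UNIV. (x $ i) ^ \<alpha> i))"
    using assms(1) by (auto simp: polynomial_fun_def)
  obtain B d where B: "finite B" "\<And>x. g x = (\<Sum>\<alpha>\<in>B. d \<alpha> * (\<Prod>i\<in>UNIV. (x $ i) ^ \<alpha> i))"
    using assms(2) by (auto simp: polynomial_fun_def)
  define e where "e \<alpha> = (if \<alpha> \<in> A then c \<alpha> else 0) + (if \<alpha> \<in> B then d \<alpha> else 0)" for \<alpha>
  have "f x + g x = (\<Sum>\<alpha>\<in>A \<union> B. e \<alpha> * (\<Prod>i\<in>UNIV. (x $ i) ^ \<alpha> i))" for x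
  proof -
    have "f x = (\<Sum>\<alpha>\<in>A \<union> B. (if \<alpha> \<in> A then c \<alpha> else 0) * (\<Prod>i\<in>UNIV. (x $ i) ^ \<alpha> i))"
      unfolding A(2) using A(1) B(1) by (intro sum.mono_neutral_cong_left) auto
    moreover have "g x = (\<Sum>\<alpha>\<in>A \<union> B. (if \<alpha> \<in> B then d \<alpha> else 0) * (\<Prod>i\<in>UNIV. (x $ i) ^ \<alpha> i))"
      unfolding B(2) using A(1) B(1) by (intro sum.mono_neutral_cong_left) auto
    ultimately show ?thesis by (simp add: e_def distrib_right sum.distrib)
  qed
  then show ?thesis
    unfolding polynomial_fun_def using A(1) B(1)
    by (intro exI[of _ "A \<union> B"] exI[of _ e]) simp
qed

lemma polynomial_fun_sum:
  "(\<And>i. i \<in> I \<Longrightarrow> polynomial_fun (f i)) \<Longrightarrow> polynomial_fun (\<lambda>x. \<Sum>i\<in>I. f i x)"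
  by (induction I rule: infinite_finite_induct) (auto intro: polynomial_fun_const polynomial_fun_add)

lemma polynomial_fun_monomial: "polynomial_fun (\<lambda>x. c * (\<Prod>i\<in>UNIV. (x $ i) ^ \<alpha> i))"
  unfolding polynomial_fun_def by (rule exI[of _ "{\<alpha>}"], rule exI[of _ "\<lambda>_. c"]) simp

lemma polynomial_fun_mult:
  assumes "polynomial_fun f" "polynomial_fun g"
  shows "polynomial_fun (\<lambda>x. f x * g x)"
proof -
  obtain A c where A: "finite A" "\<And>x. f x = (\<Sum>\<alpha>\<in>A. c \<alpha> * (\<Prod>i\<in>UNIV. (x $ i) ^ \<alpha> i))"
    using assms(1) by (auto simp: polynomial_fun_def)
  obtain B d where B: "finite B" "\<And>x. g x = (\<Sum>\<alpha>\<in>B. d \<alpha> * (\<Prod>i\<in>UNIV. (x $ i) ^ \<alpha> i))"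
    using assms(2) by (auto simp: polynomial_fun_def)
  have "f x * g x = (\<Sum>\<alpha>\<in>A. \<Sum>\<beta>\<in>B. (c \<alpha> * d \<beta>) * (\<Prod>i\<in>UNIV. (x $ i) ^ (\<alpha> i + \<beta> i)))" for x
    by (simp add: A(2) B(2) sum_product power_add prod.distrib mult_ac)
  moreover have "polynomial_fun (\<lambda>x. \<Sum>\<alpha>\<in>A. \<Sum>\<beta>\<in>B. (c \<alpha> * d \<beta>) * (\<Prod>i\<in>UNIV. (x $ i) ^ (\<alpha> i + \<beta> i)))"
    by (intro polynomial_fun_sum polynomial_fun_monomial)
  ultimately show ?thesis by simp
qed

lemma polynomial_fun_uminus: "polynomial_fun f \<Longrightarrow> polynomial_fun (\<lambda>x. - f x)"
  using polynomial_fun_mult[OF polynomial_fun_const[of "-1"], of f] by simp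

lemma polynomial_fun_diff:
  "polynomial_fun f \<Longrightarrow> polynomial_fun g \<Longrightarrow> polynomial_fun (\<lambda>x. f x - g x)"
  using polynomial_fun_add[OF _ polynomial_fun_uminus, of f g] by simp

lemma polynomial_fun_prod:
  "(\<And>i. i \<in> I \<Longrightarrow> polynomial_fun (f i)) \<Longrightarrow> polynomial_fun (\<lambda>x. \<Prod>i\<in>I. f i x)"
  by (induction I rule: infinite_finite_induct) (auto intro: polynomial_fun_const polynomial_fun_mult)

lemma polynomial_fun_if:
  "(b \<Longrightarrow> polynomial_fun f) \<Longrightarrow> (\<not> b \<Longrightarrow> polynomial_fun g) \<Longrightarrow> polynomial_fun (\<lambda>x. if b then f x else g x)"
  by (cases b) simp_all

lemmas polynomial_fun_intros =
  polynomial_fun_const polynomial_fun_nth polynomial_fun_add polynomial_fun_mult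
  polynomial_fun_uminus polynomial_fun_diff polynomial_fun_sum polynomial_fun_prod polynomial_fun_if

lemma polynomial_fun_polys:
  assumes "f \<in> polys" "\<And>i. polynomial_fun (\<lambda>x. e x i)"
  shows "polynomial_fun (\<lambda>x. f (e x))"
  using assms(1) by induction (auto intro: polynomial_fun_intros assms(2))

lemma polys_polynomial_fun:
  assumes "polynomial_fun f"
  obtains g where "g \<in> polys" "\<And>x. f x = g (($) x)"
proof -
  obtain A c where A: "finite A" "\<And>x. f x = (\<Sum>\<alpha>\<in>A. c \<alpha> * (\<Prod>i\<in>UNIV. (x $ i) ^ \<alpha> i))"
    using assms by (auto simp: polynomial_fun_def)
  have pow: "(\<lambda>v. v i ^ k) \<in> polys" for i :: 'a and k
    by (induction k) (auto intro: polys_intros)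
  have prod: "(\<lambda>v. \<Prod>i\<in>I. v i ^ \<alpha> i) \<in> polys" for I :: "'a set" and \<alpha>
    by (induction I rule: infinite_finite_induct) (auto intro: polys_intros pow)
  have "(\<lambda>v. \<Sum>\<alpha>\<in>A. c \<alpha> * (\<Prod>i\<in>UNIV. v i ^ \<alpha> i)) \<in> polys"
    by (intro polys_intros prod)
  then show ?thesis using that A(2) by blast
qed

lemma continuous_on_polynomial_fun:
  assumes "polynomial_fun f" shows "continuous_on UNIV f"
proof -
  obtain A c where A: "finite A" "\<And>x. f x = (\<Sum>\<alpha>\<in>A. c \<alpha> * (\<Prod>i\<in>UNIV. (x $ i) ^ \<alpha> i))"
    using assms by (auto simp: polynomial_fun_def)
  have "f = (\<lambda>x. \<Sum>\<alpha>\<in>A. c \<alpha> * (\<Prod>i\<in>UNIV. (x $ i) ^ \<alpha> i))"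
    using A(2) by blast
  then show ?thesis by (simp add: continuous_intros)
qed

section \<open>Rules for general tensors\<close>

lemma for_generalI:
  assumes "polynomial_fun F" "F T0 \<noteq> 0" "\<And>T. F T \<noteq> 0 \<Longrightarrow> P T"
  shows "for_general P"
proof -
  have "zariski_closed (- {T. F T \<noteq> 0})"
    unfolding zariski_closed_def using assms(1) by (intro exI[of _ "{F}"]) auto
  then show ?thesis
    unfolding for_general_def zariski_open_def using assms(2,3)
    by (intro exI[of _ "{T. F T \<noteq> 0}"]) auto
qed

lemma for_generalE:
  assumes "for_general P"
  obtains F T0 where "polynomial_fun F" "F T0 \<noteq> 0" "\<And>T. F T \<noteq> 0 \<Longrightarrow> P T"
proof -
  obtain U where U: "zariski_closed (- U)" "U \<noteq> {}" "\<And>T. T \<in> U \<Longrightarrow> P T"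
    using assms by (auto simp: for_general_def zariski_open_def)
  obtain \<F> where F: "\<And>f. f \<in> \<F> \<Longrightarrow> polynomial_fun f" "- U = {x. \<forall>f\<in>\<F>. f x = 0}"
    using U(1) unfolding zariski_closed_def by blast
  from U(2) obtain T0 where "T0 \<in> U" by blast
  then have "T0 \<notin> - U" by simp
  then obtain f where "f \<in> \<F>" "f T0 \<noteq> 0" unfolding F(2) by blast
  moreover have "P T" if "f T \<noteq> 0" for T
  proof -
    have "T \<notin> - U" unfolding F(2) using \<open>f \<in> \<F>\<close> that by blast
    then show ?thesis using U(3) by simp
  qed
  ultimately show ?thesis using that F(1) by blast
qed

lemma for_general_mono:
  "for_general P \<Longrightarrow> (\<And>T. P T \<Longrightarrow> Q T) \<Longrightarrow> for_general Q"
  unfolding for_general_def by blast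

lemma for_general_conj:
  assumes "for_general P" "for_general Q"
  shows "for_general (\<lambda>T. P T \<and> Q T)"
proof -
  obtain F S where F: "polynomial_fun F" "F S \<noteq> 0" "\<And>T. F T \<noteq> 0 \<Longrightarrow> P T"
    using assms(1) by (rule for_generalE) blast
  obtain G S' where G: "polynomial_fun G" "G S' \<noteq> 0" "\<And>T. G T \<noteq> 0 \<Longrightarrow> Q T"
    using assms(2) by (rule for_generalE) blast
  obtain f where f: "f \<in> polys" "\<And>x. F x = f (($) x)" using polys_polynomial_fun[OF F(1)] by blast
  obtain g where g: "g \<in> polys" "\<And>x. G x = g (($) x)" using polys_polynomial_fun[OF G(1)] by blast
  obtain u where "f u * g u \<noteq> 0"
    using polys_mult_nonzero[OF f(1) g(1)] F(2) G(2) f(2) g(2) by metis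
  moreover have "f u = F (vec_lambda u)" "g u = G (vec_lambda u)"
    by (simp_all add: f(2) g(2) vec_nth_vec_lambda)
  ultimately have "F (vec_lambda u) * G (vec_lambda u) \<noteq> 0" by simp
  then show ?thesis
    by (rule for_generalI[OF polynomial_fun_mult[OF F(1) G(1)]]) (simp add: F(3) G(3))
qed

text \<open>A nonzero polynomial cannot vanish on a Euclidean open set: on the line from
  \<open>T0\<close> to a point where it is nonzero it has finitely many roots, while the open set
  contains infinitely many points of that line.\<close>

lemma for_general_meets_open:
  assumes "for_general P" "open U" "T0 \<in> U"
  shows "\<exists>T\<in>U. P T"
proof -
  obtain F S where F: "polynomial_fun F" "F S \<noteq> 0" "\<And>T. F T \<noteq> 0 \<Longrightarrow> P T"
    using assms(1) by (rule for_generalE) blast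
  obtain f where f: "f \<in> polys" "\<And>x. F x = f (($) x)" using polys_polynomial_fun[OF F(1)] by blast
  obtain p where p: "\<And>t. f (\<lambda>i. T0 $ i + t * (S $ i - T0 $ i)) = poly p t"
    using polys_line[OF f(1), of "($) T0" "\<lambda>i. S $ i - T0 $ i"] by blast
  define L where "L t = (\<chi> i. T0 $ i + t * (S $ i - T0 $ i))" for t
  have L: "F (L t) = poly p t" for t
    by (simp add: f(2) L_def p vec_nth_vec_lambda)
  have "L 1 = S" "L 0 = T0" by (simp_all add: L_def vec_eq_iff)
  then have "p \<noteq> 0" using L[of 1] F(2) by auto
  have "continuous_on UNIV L"
    unfolding L_def by (intro continuous_on_vec_lambda continuous_intros)
  then have "open (L -` U)" using assms(2) by (simp add: continuous_open_vimage continuous_on_eq_continuous_at)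
  moreover have "0 \<in> L -` U" using \<open>L 0 = T0\<close> assms(3) by simp
  ultimately obtain \<epsilon> where "\<epsilon> > 0" "ball 0 \<epsilon> \<subseteq> L -` U" by (meson openE)
  then have "infinite (L -` U)"
    by (meson countable_finite finite_subset uncountable_ball)
  moreover have "finite {t. poly p t = 0}" using \<open>p \<noteq> 0\<close> by (rule poly_roots_finite)
  ultimately obtain t where "t \<in> L -` U" "poly p t \<noteq> 0"
    by (metis (mono_tags, lifting) finite_subset mem_Collect_eq subsetI)
  then show ?thesis using F(3)[of "L t"] L[of t] by auto
qed

text \<open>The auxiliary unknowns sit in the right summand and are eliminated. Of the two
  alternatives left for the resulting constructible set, the one where \<open>P\<close> fails
  generically contradicts the Euclidean open set on which \<open>P\<close> holds.\<close>

lemma for_general_of_constructible: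
  fixes P :: "complex ^ 'i \<Rightarrow> bool" and S :: "('i + 'b :: finite \<Rightarrow> complex) set"
  assumes S: "S \<in> constructible"
    and P: "\<And>T. P T \<longleftrightarrow> (\<exists>w. (\<forall>i. w (Inl i) = T $ i) \<and> w \<in> S)"
    and U: "open U" "T0 \<in> U" "\<And>T. T \<in> U \<Longrightarrow> P T"
  shows "for_general P"
proof -
  define S' where "S' = {v. \<exists>w. (\<forall>i. i \<notin> range Inr \<longrightarrow> w i = v i) \<and> w \<in> S}"
  have "S' \<in> constructible"
    unfolding S'_def using S by (intro constructible_exists_finite) auto
  then obtain f v0 where f: "f \<in> polys" "f v0 \<noteq> 0"
    "(\<forall>v. f v \<noteq> 0 \<longrightarrow> v \<in> S') \<or> (\<forall>v. f v \<noteq> 0 \<longrightarrow> v \<notin> S')"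
    using constructible_dichotomy by blast
  \<comment> \<open>The eliminated coordinates are filled with those of \<open>v0\<close>:
    membership in \<open>S'\<close> ignores them, and \<open>f\<close> stays nonzero at one
    tensor.\<close>
  define e where "e T = case_sum (($) T) (v0 \<circ> Inr)" for T :: "complex ^ 'i"
  have S'_iff: "e T \<in> S' \<longleftrightarrow> P T" for T
  proof -
    have "(\<forall>i. i \<notin> range Inr \<longrightarrow> w i = e T i) \<longleftrightarrow> (\<forall>i. w (Inl i) = T $ i)" for w
      by (auto simp: e_def split: sum.split)
    then show ?thesis by (simp add: S'_def P)
  qed
  have "polynomial_fun (\<lambda>T. e T i)" for i
    by (cases i) (simp_all add: e_def polynomial_fun_nth polynomial_fun_const)
  with f(1) have poly: "polynomial_fun (\<lambda>T. f (e T))"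
    by (rule polynomial_fun_polys[where f = f and e = e])
  have "e (\<chi> i. v0 (Inl i)) = v0"
    by (rule ext) (simp add: e_def split: sum.split)
  then have nz: "f (e (\<chi> i. v0 (Inl i))) \<noteq> 0" using f(2) by simp
  show ?thesis
    using f(3)
  proof
    assume "\<forall>v. f v \<noteq> 0 \<longrightarrow> v \<in> S'"
    then show ?thesis using S'_iff by (intro for_generalI[OF poly nz]) auto
  next
    assume "\<forall>v. f v \<noteq> 0 \<longrightarrow> v \<notin> S'"
    then have "for_general (\<lambda>T. \<not> P T)" using S'_iff by (intro for_generalI[OF poly nz]) auto
    from for_general_meets_open[OF this U(1,2)] U(3) show ?thesis by blast
  qed
qed

text \<open>The pairings with a dual family of the vectors at \<open>T0\<close> form a matrix that
  is polynomial in \<open>T\<close> and equal to the identity at \<open>T0\<close>; where its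
  determinant is nonzero, no nontrivial relation survives.\<close>

lemma indep_family_polynomial:
  fixes v :: "'a :: finite \<Rightarrow> complex ^ 'p \<Rightarrow> complex ^ 'i"
  assumes poly: "\<And>i k. polynomial_fun (\<lambda>T. v i T $ k)"
    and ind: "indep_family I (\<lambda>i. v i T0)"
  obtains F where "polynomial_fun F" "F T0 \<noteq> 0" "\<And>T. F T \<noteq> 0 \<Longrightarrow> indep_family I (\<lambda>i. v i T)"
proof -
  obtain r where r: "\<And>i j. i \<in> I \<Longrightarrow> j \<in> I \<Longrightarrow> bil (r i) (v j T0) = (if i = j then 1 else 0)"
    using indep_family_dual[OF _ ind] by auto
  \<comment> \<open>Outside \<open>I\<close> the matrix is completed by the identity, so that it is
    square over the whole index type and its determinant is that of the block over
    \<open>I\<close>.\<close>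
  define G :: "complex ^ 'p \<Rightarrow> complex ^ 'a ^ 'a" where
    "G T = (\<chi> i j. if i \<in> I \<and> j \<in> I then bil (r i) (v j T) else if i = j then 1 else 0)" for T
  have "G T0 = mat 1" by (simp add: G_def r mat_def vec_eq_iff)
  then have "det (G T0) \<noteq> 0" by simp
  moreover have "polynomial_fun (\<lambda>T. det (G T))"
    unfolding det_def G_def bil_def
    by (auto intro!: polynomial_fun_intros poly)
  moreover have "indep_family I (\<lambda>i. v i T)" if "det (G T) \<noteq> 0" for T
    unfolding indep_family_def
  proof (intro allI impI)
    fix c assume c: "(\<Sum>i\<in>I. c i *s v i T) = 0"
    define d :: "complex ^ 'a" where "d = (\<chi> i. if i \<in> I then c i else 0)"
    have "(G T *v d) $ i = 0" for i
    proof (cases "i \<in> I")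
      case True
      have "(G T *v d) $ i = (\<Sum>j\<in>I. bil (r i) (v j T) * c j)"
        unfolding matrix_vector_mult_def G_def d_def using True
        by (simp, intro sum.mono_neutral_cong_right) auto
      also have "\<dots> = bil (r i) (\<Sum>j\<in>I. c j *s v j T)"
        by (simp add: bil_sum_right bil_scale_right mult.commute)
      finally show ?thesis by (simp add: c)
    next
      case False
      have "(G T *v d) $ i = (\<Sum>j\<in>UNIV. if i = j then d $ j else 0)"
        unfolding matrix_vector_mult_def G_def using False by (auto simp: if_distrib[where f = "\<lambda>x. x * _"] cong: if_cong)
      then show ?thesis using False by (simp add: d_def)
    qed
    then have "G T *v d = 0" by (simp add: vec_eq_iff)
    moreover have "invertible (G T)" using that by (simp add: invertible_det_nz)
    ultimately have "d = 0"
      by (metis invertible_def matrix_left_invertible_ker)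
    then show "\<forall>i\<in>I. c i = 0"
      by (auto simp: d_def vec_eq_iff split: if_splits) 
  qed
  ultimately show ?thesis using that by blast
qed

lemma for_general_indep_family:
  fixes v :: "'a :: finite \<Rightarrow> complex ^ 'p \<Rightarrow> complex ^ 'i"
  assumes "\<And>i k. polynomial_fun (\<lambda>T. v i T $ k)" "indep_family I (\<lambda>i. v i T0)"
  shows "for_general (\<lambda>T. indep_family I (\<lambda>i. v i T))"
  by (rule indep_family_polynomial[OF assms]) (rule for_generalI)

lemma indep_family_open:
  fixes v :: "'a :: finite \<Rightarrow> complex ^ 'i"
  assumes "indep_family I v"
  obtains \<epsilon> where "\<epsilon> > 0" "\<And>w. (\<And>i. dist (w i) (v i) < \<epsilon>) \<Longrightarrow> indep_family I w"
proof -
  define e :: "('a \<Rightarrow> complex ^ 'i) \<Rightarrow> complex ^ ('a \<times> 'i)" where "e w = (\<chi> p. w (fst p) $ snd p)" for w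
  define d :: "'a \<Rightarrow> complex ^ ('a \<times> 'i) \<Rightarrow> complex ^ 'i" where "d i T = (\<chi> k. T $ (i, k))" for i T
  have de: "d i (e w) = w i" for i w by (simp add: d_def e_def vec_eq_iff)
  have "polynomial_fun (\<lambda>T. d i T $ k)" for i k by (simp add: d_def polynomial_fun_nth)
  moreover have "indep_family I (\<lambda>i. d i (e v))" using assms by (simp add: de)
  ultimately obtain F where F: "polynomial_fun F" "F (e v) \<noteq> 0"
    "\<And>T. F T \<noteq> 0 \<Longrightarrow> indep_family I (\<lambda>i. d i T)"
    by (rule indep_family_polynomial) blast
  have "open {T. F T \<noteq> 0}"
    using continuous_on_polynomial_fun[OF F(1)] open_Collect_neq[of F "\<lambda>_. 0"] by simp
  then obtain \<delta> where \<delta>: "\<delta> > 0" "ball (e v) \<delta> \<subseteq> {T. F T \<noteq> 0}"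
    using F(2) by (metis (mono_tags, lifting) mem_Collect_eq openE)
  let ?N = "real CARD('a \<times> 'i)"
  have N: "?N > 0" by simp
  show ?thesis
  \<comment> \<open>The distance in the product is at most the sum of the distances of the
    coordinates, and there are \<open>?N\<close> of them.\<close>
  proof (rule that[of "\<delta> / ?N"])
    show "\<delta> / ?N > 0" using \<delta>(1) N by simp
    fix w :: "'a \<Rightarrow> complex ^ 'i" assume w: "\<And>i. dist (w i) (v i) < \<delta> / ?N"
    have "dist (e w) (e v) \<le> (\<Sum>p\<in>UNIV. norm ((e w - e v) $ p))"
      unfolding dist_norm norm_vec_def by (rule L2_set_le_sum) simp
    also have "\<dots> < (\<Sum>p\<in>(UNIV :: ('a \<times> 'i) set). \<delta> / ?N)"
    proof (rule sum_strict_mono)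
      fix p :: "'a \<times> 'i"
      have "norm ((e w - e v) $ p) = norm ((w (fst p) - v (fst p)) $ snd p)"
        by (simp add: e_def)
      also have "\<dots> \<le> norm (w (fst p) - v (fst p))" by (rule Finite_Cartesian_Product.norm_nth_le)
      also have "\<dots> < \<delta> / ?N" using w[of "fst p"] by (simp add: dist_norm)
      finally show "norm ((e w - e v) $ p) < \<delta> / ?N" .
    qed auto
    also have "\<dots> = \<delta>" using N by simp
    finally have "e w \<in> ball (e v) \<delta>" by (simp add: dist_commute)
    then have "F (e w) \<noteq> 0" using \<delta>(2) by blast
    then show "indep_family I w" using F(3)[of "e w"] by (simp add: de)
  qed
qed

subsection \<open>Critical pairs and the forms vanishing on them\<close>

lemma sum_UNIV_prod: "(\<Sum>p\<in>UNIV. f p) = (\<Sum>a\<in>UNIV. \<Sum>b\<in>UNIV. f (a, b))"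
  for f :: "'a :: finite \<times> 'b :: finite \<Rightarrow> 'c :: comm_monoid_add"
  unfolding UNIV_Times_UNIV[symmetric] by (simp add: sum.cartesian_product)

definition slice :: "complex ^ (2 \<times> 'n::finite \<times> 'k::finite) \<Rightarrow> 2 \<Rightarrow> complex ^ 'n \<Rightarrow> 'k \<Rightarrow> complex" where
  "slice T a y k = (\<Sum>l\<in>UNIV. T $ (a, l, k) * y $ l)"

lemma contract3_slice: "contract3 T x y $ k = x $ 1 * slice T 1 y k + x $ 2 * slice T 2 y k"
  by (simp add: contract3_def slice_def sum_2 sum_distrib_left mult_ac)

lemma contract1_slice: "contract1 T y z $ a = (\<Sum>k\<in>UNIV. slice T a y k * z $ k)"
  unfolding contract1_def slice_def
  by (simp add: sum_distrib_right) (rule sum.swap)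

lemma contract2_2:
  fixes T :: "complex ^ (2 \<times> 'n::finite \<times> 'k::finite)"
  shows
  "contract2 T x z $ j = (\<Sum>k\<in>UNIV. (x $ 1 * T $ (1, j, k) + x $ 2 * T $ (2, j, k)) * z $ k)"
  by (simp add: contract2_def sum_2 distrib_right distrib_left sum.distrib mult_ac)

lemma sum_slice:
  "(\<Sum>j\<in>UNIV. \<Sum>l\<in>UNIV. (\<Sum>k\<in>UNIV. T $ (a, j, k) * T $ (b, l, k)) * (y $ j * y $ l)) =
   (\<Sum>k\<in>UNIV. slice T a y k * slice T b y k)"
proof -
  have "(\<Sum>k\<in>UNIV. slice T a y k * slice T b y k) =
      (\<Sum>k\<in>UNIV. \<Sum>j\<in>UNIV. \<Sum>l\<in>UNIV. T $ (a, j, k) * T $ (b, l, k) * (y $ j * y $ l))"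
    by (simp add: slice_def sum_product mult_ac)
  also have "\<dots> = (\<Sum>j\<in>UNIV. \<Sum>k\<in>UNIV. \<Sum>l\<in>UNIV. T $ (a, j, k) * T $ (b, l, k) * (y $ j * y $ l))"
    by (rule sum.swap)
  also have "\<dots> = (\<Sum>j\<in>UNIV. \<Sum>l\<in>UNIV. \<Sum>k\<in>UNIV. T $ (a, j, k) * T $ (b, l, k) * (y $ j * y $ l))"
    by (intro sum.cong refl) (rule sum.swap)
  finally show ?thesis by (simp add: sum_distrib_right)
qed

text \<open>The pair \<open>(x, y)\<close> extends to a singular triple by \<open>z = T(x, y)\<close>, when these vectors are nonzero.\<close>

definition critical_pair ::
  "complex ^ (2 \<times> 'n::finite \<times> 'k::finite) \<Rightarrow> complex ^ 2 \<Rightarrow> complex ^ 'n \<Rightarrow> bool" where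
  "critical_pair T x y \<longleftrightarrow>
     minors_vanish (contract1 T y (contract3 T x y)) x \<and>
     minors_vanish (contract2 T x (contract3 T x y)) y"

definition monom2 :: "complex ^ 2 \<Rightarrow> 3 \<Rightarrow> complex" where
  "monom2 x s = (if s = 1 then x $ 1 * x $ 1 else if s = 2 then x $ 1 * x $ 2 else x $ 2 * x $ 2)"

definition monom2_index :: "2 \<Rightarrow> 2 \<Rightarrow> 3" where
  "monom2_index a b = (if a = 1 \<and> b = 1 then 1 else if a = 2 \<and> b = 2 then 3 else 2)"

lemma monom2_index: "monom2 x (monom2_index a b) = x $ a * x $ b"
  using exhaust_2[of a] exhaust_2[of b] by (auto simp: monom2_def monom2_index_def)

text \<open>\<open>x\<close> enters through its three quadratic monomials, but \<open>y\<close>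
  through all products of two coordinates, which avoids ordering the index type. Symmetry in the
  last two indices is accounted for by the skew forms.\<close>

definition veronese :: "complex ^ 2 \<Rightarrow> complex ^ 'n \<Rightarrow> complex ^ (3 \<times> 'n::finite \<times> 'n)" where
  "veronese x y = (\<chi> p. monom2 x (fst p) * (y $ fst (snd p) * y $ snd (snd p)))"

lemma veronese_nth [simp]: "veronese x y $ (s, j, l) = monom2 x s * (y $ j * y $ l)"
  by (simp add: veronese_def)

definition gram :: "complex ^ (2 \<times> 'n::finite \<times> 'k::finite) \<Rightarrow> 2 \<Rightarrow> 2 \<Rightarrow> 'n \<Rightarrow> 'n \<Rightarrow> complex" where
  "gram T a b j l = (\<Sum>k\<in>UNIV. T $ (a, j, k) * T $ (b, l, k))"

text \<open>The coefficients of \<open>q(x, y) = T(x, y) \<bullet> T(x, y)\<close>, sorted by the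
  monomials in \<open>x\<close>; the middle one collects both mixed terms.\<close>

definition qcoeff :: "complex ^ (2 \<times> 'n::finite \<times> 'k::finite) \<Rightarrow> 3 \<Rightarrow> 'n \<Rightarrow> 'n \<Rightarrow> complex" where
  "qcoeff T s j l = (if s = 1 then gram T 1 1 j l else if s = 2 then gram T 1 2 j l + gram T 2 1 j l
     else gram T 2 2 j l)"

definition skew_form :: "3 \<Rightarrow> 'n \<Rightarrow> 'n \<Rightarrow> complex ^ (3 \<times> 'n::finite \<times> 'n)" where
  "skew_form s p q = axis (s, p, q) 1 - axis (s, q, p) 1"

text \<open>The biquadratic forms whose vanishing expresses criticality: \<open>form1\<close> for the factor \<open>x\<close>,
  \<open>form2\<close> for the factor \<open>y\<close>. The skew forms vanish at every Veronese point, because coefficients are not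
  symmetrised in the two indices of \<open>y\<close>.\<close>

definition form1 :: "complex ^ (2 \<times> 'n::finite \<times> 'k::finite) \<Rightarrow> complex ^ (3 \<times> 'n \<times> 'n)" where
  "form1 T = (\<chi> t. case t of (s, j, l) \<Rightarrow>
     if s = 1 then - gram T 2 1 j l else if s = 2 then gram T 1 1 j l - gram T 2 2 j l else gram T 1 2 j l)"

definition form2 :: "complex ^ (2 \<times> 'n::finite \<times> 'k::finite) \<Rightarrow> 'n \<Rightarrow> 'n \<Rightarrow> complex ^ (3 \<times> 'n \<times> 'n)" where
  "form2 T p q = (\<chi> t. case t of (s, j, l) \<Rightarrow>
     (if j = q then qcoeff T s p l else 0) - (if j = p then qcoeff T s q l else 0))"

lemma bil_skew_form: "bil (skew_form s p q) R = R $ (s, p, q) - R $ (s, q, p)"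
  by (simp add: bil_commute[of _ R] skew_form_def bil_diff_right bil_axis_right)

text \<open>With \<open>q\<close> written as a quadratic form in \<open>x\<close> with coefficients
  \<open>G a b\<close>, the contraction is half of its gradient; its minor with \<open>x\<close> has
  three monomials, and \<open>form1\<close> lists their coefficients.\<close>

lemma bil_form1:
  "bil (form1 T) (veronese x y) =
     contract1 T y (contract3 T x y) $ 1 * x $ 2 - contract1 T y (contract3 T x y) $ 2 * x $ 1"
proof -
  define G where "G a b = (\<Sum>k\<in>UNIV. slice T a y k * slice T b y k)" for a b :: 2
  have G: "(\<Sum>j\<in>UNIV. \<Sum>l\<in>UNIV. gram T a b j l * (y $ j * y $ l)) = G a b" for a b
    unfolding gram_def G_def by (rule sum_slice)
  have "bil (form1 T) (veronese x y) =
      - (x $ 1 * x $ 1) * (\<Sum>j\<in>UNIV. \<Sum>l\<in>UNIV. gram T 2 1 j l * (y $ j * y $ l))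
      + x $ 1 * x $ 2 * ((\<Sum>j\<in>UNIV. \<Sum>l\<in>UNIV. gram T 1 1 j l * (y $ j * y $ l))
           - (\<Sum>j\<in>UNIV. \<Sum>l\<in>UNIV. gram T 2 2 j l * (y $ j * y $ l)))
      + x $ 2 * x $ 2 * (\<Sum>j\<in>UNIV. \<Sum>l\<in>UNIV. gram T 1 2 j l * (y $ j * y $ l))"
    by (simp add: bil_def sum_UNIV_prod sum_3 form1_def monom2_def sum_distrib_left
        sum_subtractf[symmetric] sum_negf[symmetric] algebra_simps)
  also have "\<dots> = - (x $ 1 * x $ 1) * G 2 1 + x $ 1 * x $ 2 * (G 1 1 - G 2 2) + x $ 2 * x $ 2 * G 1 2"
    by (simp only: G)
  also have "contract1 T y (contract3 T x y) $ a = x $ 1 * G a 1 + x $ 2 * G a 2" for a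
    by (simp add: contract1_slice contract3_slice G_def distrib_left sum.distrib sum_distrib_left mult_ac)
  then have "- (x $ 1 * x $ 1) * G 2 1 + x $ 1 * x $ 2 * (G 1 1 - G 2 2) + x $ 2 * x $ 2 * G 1 2 =
     contract1 T y (contract3 T x y) $ 1 * x $ 2 - contract1 T y (contract3 T x y) $ 2 * x $ 1"
    by (simp add: algebra_simps)
  finally show ?thesis .
qed

text \<open>Both sides are half of the gradient of \<open>q\<close> in \<open>y\<close>, which is
  quadratic in \<open>x\<close> and linear in \<open>y\<close>.\<close>

lemma sum_qcoeff:
  "(\<Sum>s\<in>UNIV. \<Sum>l\<in>UNIV. qcoeff T s p l * (monom2 x s * y $ l)) = contract2 T x (contract3 T x y) $ p"
proof -
  have g: "(\<Sum>l\<in>UNIV. gram T a b p l * y $ l) = (\<Sum>k\<in>UNIV. T $ (a, p, k) * slice T b y k)" for a b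
  proof -
    have "(\<Sum>k\<in>UNIV. T $ (a, p, k) * slice T b y k) =
        (\<Sum>k\<in>UNIV. \<Sum>l\<in>UNIV. T $ (a, p, k) * T $ (b, l, k) * y $ l)"
      by (simp add: slice_def sum_distrib_left mult_ac)
    also have "\<dots> = (\<Sum>l\<in>UNIV. \<Sum>k\<in>UNIV. T $ (a, p, k) * T $ (b, l, k) * y $ l)"
      by (rule sum.swap)
    finally show ?thesis by (simp add: gram_def sum_distrib_right)
  qed
  have "(\<Sum>s\<in>UNIV. \<Sum>l\<in>UNIV. qcoeff T s p l * (monom2 x s * y $ l)) =
      x $ 1 * x $ 1 * (\<Sum>l\<in>UNIV. gram T 1 1 p l * y $ l)
      + x $ 1 * x $ 2 * ((\<Sum>l\<in>UNIV. gram T 1 2 p l * y $ l) + (\<Sum>l\<in>UNIV. gram T 2 1 p l * y $ l))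
      + x $ 2 * x $ 2 * (\<Sum>l\<in>UNIV. gram T 2 2 p l * y $ l)"
    by (simp add: sum_3 qcoeff_def monom2_def sum_distrib_left sum.distrib algebra_simps)
  also have "\<dots> = contract2 T x (contract3 T x y) $ p"
    unfolding g by (simp add: contract2_2 contract3_slice sum_distrib_left sum.distrib algebra_simps)
  finally show ?thesis .
qed

lemma bil_form2:
  "bil (form2 T p q) (veronese x y) =
     contract2 T x (contract3 T x y) $ p * y $ q - contract2 T x (contract3 T x y) $ q * y $ p"
proof -
  have *: "(\<Sum>s\<in>UNIV. \<Sum>j\<in>UNIV. \<Sum>l\<in>UNIV. (if j = q then qcoeff T s p l else 0) * (monom2 x s * (y $ j * y $ l)))
     = contract2 T x (contract3 T x y) $ p * y $ q" for p q
  proof -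
    have "(\<Sum>s\<in>UNIV. \<Sum>j\<in>UNIV. \<Sum>l\<in>UNIV. (if j = q then qcoeff T s p l else 0) * (monom2 x s * (y $ j * y $ l)))
       = (\<Sum>s\<in>UNIV. \<Sum>j\<in>UNIV. if j = q then (\<Sum>l\<in>UNIV. qcoeff T s p l * (monom2 x s * (y $ q * y $ l))) else 0)"
      by (intro sum.cong refl) auto
    also have "\<dots> = (\<Sum>s\<in>UNIV. \<Sum>l\<in>UNIV. qcoeff T s p l * (monom2 x s * y $ l)) * y $ q"
      by (simp add: sum_distrib_right sum_distrib_left mult_ac)
    finally show ?thesis by (simp add: sum_qcoeff)
  qed
  show ?thesis
    by (simp add: bil_def sum_UNIV_prod form2_def left_diff_distrib sum_subtractf *)
qed

text \<open>An injection \<open>e\<close> into the naturals stands in for an order on the index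
  type, so that each unordered pair of distinct indices is counted once.\<close>

definition pairs :: "('a \<Rightarrow> nat) \<Rightarrow> ('a \<times> 'a) set" where
  "pairs e = {(p, q). e p < e q}"

lemma card_pairs:
  fixes e :: "'a :: finite \<Rightarrow> nat"
  assumes "inj e"
  shows "2 * card (pairs e) + CARD('a) = CARD('a) * CARD('a)"
proof -
  let ?D = "range (\<lambda>p :: 'a. (p, p))"
  have "(UNIV :: ('a \<times> 'a) set) = pairs e \<union> (prod.swap ` pairs e \<union> ?D)"
  proof -
    have "(p, q) \<in> pairs e \<union> (prod.swap ` pairs e \<union> ?D)" for p q
      using injD[OF assms, of p q] by (cases "e p" "e q" rule: linorder_cases) (auto simp: pairs_def image_iff)
    then show ?thesis by (intro equalityI subsetI) (metis surj_pair, simp)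
  qed
  also have "card \<dots> = card (pairs e) + (card (prod.swap ` pairs e) + card ?D)"
    by (subst card_Un_disjoint, simp, simp, force simp: pairs_def, subst card_Un_disjoint) (auto simp: pairs_def)
  also have "card (prod.swap ` pairs e) = card (pairs e)"
    by (rule card_image) simp
  also have "card ?D = CARD('a)"
    by (rule card_image) (simp add: inj_on_def)
  finally show ?thesis by (simp add: card_cartesian_product flip: UNIV_Times_UNIV)
qed

definition skew_ext :: "('a \<Rightarrow> nat) \<Rightarrow> ('a \<times> 'a \<Rightarrow> complex) \<Rightarrow> 'a \<Rightarrow> 'a \<Rightarrow> complex" where
  "skew_ext e c p q = (if e p < e q then c (p, q) else 0) - (if e q < e p then c (q, p) else 0)"

lemma skew_ext_swap: "skew_ext e c q p = - skew_ext e c p q"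
  by (simp add: skew_ext_def)

lemma skew_ext_self [simp]: "skew_ext e c p p = 0"
  by (simp add: skew_ext_def)

lemma skew_ext_zeroD: "skew_ext e c = (\<lambda>_ _. 0) \<Longrightarrow> t \<in> pairs e \<Longrightarrow> c t = 0"
  by (auto simp: skew_ext_def pairs_def fun_eq_iff split: if_splits)

text \<open>Collecting terms turns a combination of elementary alternating equations into a product
  with the skew matrix of its coefficients. The independence proofs below thereby become matrix
  computations with skew unknowns.\<close>

lemma sum_pairs:
  fixes e :: "'a :: finite \<Rightarrow> nat" and c :: "'a \<times> 'a \<Rightarrow> complex"
  shows "(\<Sum>(p, q)\<in>pairs e. c (p, q) * ((if j = q then g p else 0) - (if j = p then g q else 0))) =
    (\<Sum>p\<in>UNIV. skew_ext e c p j * g p)"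
proof -
  have ind: "(\<Sum>t\<in>pairs e. F t) = (\<Sum>p\<in>UNIV. \<Sum>q\<in>UNIV. if e p < e q then F (p, q) else 0)"
    for F :: "'a \<times> 'a \<Rightarrow> complex"
  proof -
    have "(\<Sum>t\<in>pairs e. F t) = (\<Sum>t\<in>UNIV. if t \<in> pairs e then F t else 0)"
      by (rule sum.mono_neutral_cong_left) auto
    then show ?thesis by (simp add: sum_UNIV_prod pairs_def)
  qed
  have 1: "(\<Sum>p\<in>UNIV. \<Sum>q\<in>UNIV. if e p < e q then c (p, q) * (if j = q then g p else 0) else 0) =
      (\<Sum>p\<in>UNIV. (if e p < e j then c (p, j) else 0) * g p)"
  proof (rule sum.cong[OF refl])
    fix p
    have "(\<Sum>q\<in>UNIV. if e p < e q then c (p, q) * (if j = q then g p else 0) else 0) =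
        (\<Sum>q\<in>UNIV. if j = q then (if e p < e j then c (p, j) else 0) * g p else 0)"
      by (rule sum.cong) auto
    then show "(\<Sum>q\<in>UNIV. if e p < e q then c (p, q) * (if j = q then g p else 0) else 0) =
        (if e p < e j then c (p, j) else 0) * g p" by simp
  qed
  have 2: "(\<Sum>p\<in>UNIV. \<Sum>q\<in>UNIV. if e p < e q then c (p, q) * (if j = p then g q else 0) else 0) =
      (\<Sum>q\<in>UNIV. (if e j < e q then c (j, q) else 0) * g q)"
  proof -
    have "(\<Sum>p\<in>UNIV. \<Sum>q\<in>UNIV. if e p < e q then c (p, q) * (if j = p then g q else 0) else 0) =
        (\<Sum>p\<in>UNIV. if j = p then (\<Sum>q\<in>UNIV. (if e j < e q then c (j, q) else 0) * g q) else 0)"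
    proof (rule sum.cong[OF refl])
      fix p
      show "(\<Sum>q\<in>UNIV. if e p < e q then c (p, q) * (if j = p then g q else 0) else 0) =
        (if j = p then (\<Sum>q\<in>UNIV. (if e j < e q then c (j, q) else 0) * g q) else 0)"
      proof (cases "j = p")
        case True
        then show ?thesis by (auto intro!: sum.cong)
      next
        case False
        then show ?thesis by (simp cong: if_cong)
      qed
    qed
    then show ?thesis by simp
  qed
  have "(\<Sum>(p, q)\<in>pairs e. c (p, q) * ((if j = q then g p else 0) - (if j = p then g q else 0))) =
     (\<Sum>(p, q)\<in>pairs e. c (p, q) * (if j = q then g p else 0)) -
     (\<Sum>(p, q)\<in>pairs e. c (p, q) * (if j = p then g q else 0))"
    by (simp add: right_diff_distrib sum_subtractf case_prod_beta)
  also have "\<dots> = (\<Sum>p\<in>UNIV. (if e p < e j then c (p, j) else 0) * g p) -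
      (\<Sum>q\<in>UNIV. (if e j < e q then c (j, q) else 0) * g q)"
    unfolding ind by (simp only: prod.case 1 2)
  also have "\<dots> = (\<Sum>p\<in>UNIV. skew_ext e c p j * g p)"
    by (simp add: skew_ext_def left_diff_distrib sum_subtractf)
  finally show ?thesis .
qed

type_synonym 'n form_index = "(3 \<times> 'n \<times> 'n) + unit + 'n \<times> 'n"

definition forms :: "complex ^ (2 \<times> 'n::finite \<times> 'k::finite) \<Rightarrow> 'n form_index \<Rightarrow> complex ^ (3 \<times> 'n \<times> 'n)" where
  "forms T = case_sum (\<lambda>(s, p, q). skew_form s p q) (case_sum (\<lambda>_. form1 T) (\<lambda>(p, q). form2 T p q))"

text \<open>For injective \<open>e\<close> these are \<open>3n(n-1)/2\<close> skew forms that only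
  express symmetry, one form for \<open>x\<close>, since the plane has a single pair of indices, and
  \<open>n(n-1)/2\<close> forms for \<open>y\<close>.\<close>

definition form_indices :: "('n \<Rightarrow> nat) \<Rightarrow> 'n form_index set" where
  "form_indices e = (UNIV \<times> pairs e) <+> ({()} <+> pairs e)"

lemma card_form_indices:
  fixes e :: "'n :: finite \<Rightarrow> nat"
  shows "card (form_indices e) = 4 * card (pairs e) + 1"
  by (simp add: form_indices_def card_Plus card_cartesian_product)

lemma veronese_critical:
  assumes "critical_pair T x y"
  shows "veronese x y \<in> annihilator (forms T ` form_indices e)"
proof (rule annihilatorI)
  fix w assume "w \<in> forms T ` form_indices e"
  then obtain i where i: "w = forms T i" by blast
  have "bil (skew_form s p q) (veronese x y) = 0" for s p q
    by (simp add: bil_skew_form)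
  moreover have "bil (form1 T) (veronese x y) = 0"
    using assms by (simp add: bil_form1 critical_pair_def minors_vanish_def)
  moreover have "bil (form2 T p q) (veronese x y) = 0" for p q
    using assms by (simp add: bil_form2 critical_pair_def minors_vanish_def)
  ultimately show "bil w (veronese x y) = 0"
    unfolding i forms_def by (auto split: sum.split)
qed

section \<open>The linear map from Veronese points to decomposable tensors\<close>

definition apply3 :: "complex ^ (2 \<times> 'n::finite \<times> 'k::finite) \<Rightarrow> complex ^ (3 \<times> 'n \<times> 'n) \<Rightarrow> complex ^ (2 \<times> 'n \<times> 'k)" where
  "apply3 T M = (\<chi> t. case t of (a, j, k) \<Rightarrow> \<Sum>b\<in>UNIV. \<Sum>l\<in>UNIV. T $ (b, l, k) * M $ (monom2_index a b, j, l))"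

lemma apply3_nth: "apply3 T M $ (a, j, k) = (\<Sum>b\<in>UNIV. \<Sum>l\<in>UNIV. T $ (b, l, k) * M $ (monom2_index a b, j, l))"
  by (simp add: apply3_def)

lemma linear_apply3: "Vector_Spaces.linear (*s) (*s) (apply3 T)"
  unfolding Vector_Spaces.linear_iff
  by (auto simp: vec.vector_space_axioms vec_eq_iff apply3_nth sum.distrib distrib_left sum_distrib_left mult_ac)

lemma apply3_veronese: "apply3 T (veronese x y) = tensor3 x y (contract3 T x y)"
  by (auto simp: vec_eq_iff apply3_nth monom2_index tensor3_def contract3_def sum_distrib_left mult_ac)

definition sym_form :: "complex ^ (3 \<times> 'n::finite \<times> 'n) \<Rightarrow> bool" where
  "sym_form M \<longleftrightarrow> (\<forall>s j l. M $ (s, j, l) = M $ (s, l, j))"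

lemma subspace_sym_form: "vec.subspace {M. sym_form M}"
  by (rule vec.subspaceI) (auto simp: sym_form_def)

lemma sym_form_veronese: "sym_form (veronese x y)"
  by (simp add: sym_form_def mult.commute)

text \<open>Injectivity is independence of the images of the unit vectors, and this passes from one
  tensor to a general one.\<close>

lemma for_general_linear_injective:
  fixes W :: "complex ^ 'p \<Rightarrow> complex ^ 'a \<Rightarrow> complex ^ 'i"
  assumes lin: "\<And>T. Vector_Spaces.linear (*s) (*s) (W T)"
    and poly: "\<And>M k. polynomial_fun (\<lambda>T. W T M $ k)"
    and inj: "\<And>M. W T0 M = 0 \<Longrightarrow> M = 0"
  shows "for_general (\<lambda>T. \<forall>M. W T M = 0 \<longrightarrow> M = 0)"
proof -
  have eq: "(\<Sum>i\<in>UNIV. c i *s W T (axis i 1)) = W T (vec_lambda c)" for c T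
  proof -
    interpret Vector_Spaces.linear "(*s)" "(*s)" "W T" by (rule lin)
    have "W T (vec_lambda c) = W T (\<Sum>i\<in>UNIV. vec_lambda c $ i *s axis i 1)"
      by (simp only: basis_expansion)
    then show ?thesis by (simp add: sum scale)
  qed
  have "for_general (\<lambda>T. indep_family UNIV (\<lambda>i. W T (axis i 1)))"
  proof (rule for_general_indep_family[OF poly])
    show "indep_family UNIV (\<lambda>i. W T0 (axis i 1))"
      unfolding indep_family_def eq using inj by (metis vec_lambda_beta zero_index)
  qed
  then show ?thesis
  proof (rule for_general_mono, intro allI impI)
    fix T M assume ind: "indep_family UNIV (\<lambda>i. W T (axis i 1))" and M: "W T M = 0"
    have "(\<Sum>i\<in>UNIV. M $ i *s W T (axis i 1)) = 0"
      unfolding eq using M by simp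
    then have "\<forall>i\<in>UNIV. M $ i = 0"
      using ind[unfolded indep_family_def, rule_format, of "($) M"] by blast
    then show "M = 0" by (simp add: vec_eq_iff)
  qed
qed

subsection \<open>The critical space\<close>

text \<open>For the witness, a kernel element gives relations \<open>u + t v = 0\<close> between
  polynomials \<open>u\<close>, \<open>v\<close> in \<open>t\<close> of degree less than
  \<open>n\<close>, one for each choice of the indices \<open>a\<close> and \<open>j\<close>;
  symmetry forces them to be trivial. The products have degree at most \<open>n\<close>, which
  requires \<open>n + 1\<close> coordinates in the third factor.\<close>

lemma for_general_apply3_injective:
  assumes card: "CARD('n::finite) < CARD('k::finite)"
  shows "for_general (\<lambda>T :: complex ^ (2 \<times> 'n \<times> 'k). \<forall>M. sym_form M \<longrightarrow> apply3 T M = 0 \<longrightarrow> M = 0)"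
proof -
  \<comment> \<open>The symmetry condition is appended as further coordinates, so injectivity on
    symmetric forms becomes injectivity of a single linear map.\<close>
  define W :: "complex ^ (2 \<times> 'n \<times> 'k) \<Rightarrow> complex ^ (3 \<times> 'n \<times> 'n) \<Rightarrow> complex ^ ((2 \<times> 'n \<times> 'k) + (3 \<times> 'n \<times> 'n))"
    where "W T M = (\<chi> t. case t of Inl p \<Rightarrow> apply3 T M $ p | Inr (s, j, l) \<Rightarrow> M $ (s, j, l) - M $ (s, l, j))" for T M
  have W0: "W T M = 0 \<longleftrightarrow> sym_form M \<and> apply3 T M = 0" for T M
    unfolding W_def vec_eq_iff sym_form_def by (auto split: sum.split)
  obtain e :: "'n \<Rightarrow> nat" where e: "bij_betw e UNIV {..<CARD('n)}"
    using ex_bij_betw_finite_nat[of "UNIV :: 'n set"] by (auto simp: atLeast0LessThan)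
  obtain f :: "nat \<Rightarrow> 'k" where f: "bij_betw f {..<CARD('k)} UNIV"
    using ex_bij_betw_nat_finite[of "UNIV :: 'k set"] by (auto simp: atLeast0LessThan)
  have e_less: "e j < CARD('n)" for j
    using e by (auto simp: bij_betw_def)
  have e_inj: "e j = e l \<longleftrightarrow> j = l" for j l
    using e by (auto simp: bij_betw_def inj_eq)
  have e_surj: "\<exists>j. e j = r" if "r < CARD('n)" for r
    using e that by (metis bij_betw_def imageE lessThan_iff)
  have f_inj: "f r = f s \<longleftrightarrow> r = s" if "r < CARD('k)" "s < CARD('k)" for r s
    using f that by (auto simp: bij_betw_def inj_on_def)
  \<comment> \<open>The witness is multiplication of polynomials of degree at most \<open>1\<close> and less than \<open>n\<close>.\<close>
  define T0 :: "complex ^ (2 \<times> 'n \<times> 'k)" where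
    "T0 = (\<chi> t. case t of (a, j, k) \<Rightarrow> if k = f (if a = 1 then e j else Suc (e j)) then 1 else 0)"
  have inj: "M = 0" if sym: "sym_form M" and zero: "apply3 T0 M = 0" for M
  proof -
    have s: "M $ (s, j, l) = M $ (s, l, j)" for s j l using sym by (simp add: sym_form_def)
    have key: "(\<Sum>l\<in>UNIV. if e l = r then M $ (monom2_index a 1, j, l) else 0) +
        (\<Sum>l\<in>UNIV. if Suc (e l) = r then M $ (monom2_index a 2, j, l) else 0) = 0"
      if r: "r \<le> CARD('n)" for a j r
    proof -
      have *: "T0 $ (1, l, f r) = (if e l = r then 1 else 0)" "T0 $ (2, l, f r) = (if Suc (e l) = r then 1 else 0)" for l
        using r e_less[of l] card by (auto simp: T0_def f_inj)
      have "0 = apply3 T0 M $ (a, j, f r)" by (simp add: zero)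
      also have "\<dots> = (\<Sum>l\<in>UNIV. (if e l = r then 1 else 0) * M $ (monom2_index a 1, j, l)) +
          (\<Sum>l\<in>UNIV. (if Suc (e l) = r then 1 else 0) * M $ (monom2_index a 2, j, l))"
        by (simp add: apply3_nth sum_2 *)
      finally show ?thesis by (simp add: if_distrib[where f = "\<lambda>x. x * _"] cong: if_cong)
    qed
    have first: "M $ (monom2_index a 1, j, l) = 0" if "e l = 0" for a j l
    proof -
      have "e i = 0 \<longleftrightarrow> i = l" for i using that e_inj[of i l] by auto
      then show ?thesis using key[of 0 a j] by simp
    qed
    have last: "M $ (monom2_index a 2, j, l) = 0" if l: "Suc (e l) = CARD('n)" for a j l
    proof -
      have "e l' \<noteq> CARD('n)" for l' using e_less[of l'] by simp
      moreover have "Suc (e i) = CARD('n) \<longleftrightarrow> i = l" for i using l e_inj[of i l] by auto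
      ultimately show ?thesis using key[of "CARD('n)" a j] by simp
    qed
    have step: "M $ (monom2_index a 1, j, l') = - M $ (monom2_index a 2, j, l)" if "e l' = Suc (e l)" for a j l l'
    proof -
      have "e i = Suc (e l) \<longleftrightarrow> i = l'" for i
        using that e_inj[of i l'] by auto
      then show ?thesis
        using key[of "Suc (e l)" a j] e_less[of l'] that by (simp add: e_inj add_eq_0_iff2)
    qed
    have idx: "monom2_index 1 1 = 1" "monom2_index 1 2 = 2" "monom2_index 2 1 = 2" "monom2_index 2 2 = 3"
      by (simp_all add: monom2_index_def)
    \<comment> \<open>Two applications of \<open>step\<close> and the symmetry in the last indices
      move the entry at \<open>(j, l)\<close> to the predecessor of \<open>j\<close> and the
      successor of \<open>l\<close>; it vanishes as soon as \<open>j\<close> is first or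
      \<open>l\<close> is last.\<close>
    have M2: "M $ (2, j, l) = 0" for j l
    proof (induction "e j" arbitrary: j l)
      case 0
      then show ?case using first[of j 2 l] by (simp add: idx s[of 2 j l])
    next
      case (Suc m)
      show ?case
      proof (cases "Suc (e l) = CARD('n)")
        case True
        then show ?thesis using last[of l 1 j] by (simp add: idx)
      next
        case False
        then obtain l' where l': "e l' = Suc (e l)"
          using e_surj[of "Suc (e l)"] e_less[of l] by auto
        obtain j' where j': "e j' = m" using e_surj[of m] e_less[of j] Suc.hyps(2) by auto
        have "M $ (2, j, l) = - M $ (1, j, l')" using step[OF l', of 1 j] by (simp add: idx)
        also have "\<dots> = - M $ (1, l', j)" by (simp add: s)
        also have "\<dots> = M $ (2, l', j')" using step[of j j' 1 l'] j' Suc.hyps(2) by (simp add: idx)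
        also have "\<dots> = M $ (2, j', l')" by (simp add: s)
        also have "\<dots> = 0" using Suc.hyps(1) j' by blast
        finally show ?thesis .
      qed
    qed
    have M1: "M $ (1, j, l) = 0" for j l
    proof (cases "e l")
      case 0
      then show ?thesis using first[of l 1 j] by (simp add: idx)
    next
      case (Suc m)
      then obtain l' where "e l' = m" using e_surj[of m] e_less[of l] by auto
      then show ?thesis using step[of l l' 1 j] Suc M2 by (simp add: idx)
    qed
    have M3: "M $ (3, j, l) = 0" for j l
    proof (cases "Suc (e l) = CARD('n)")
      case True
      then show ?thesis using last[of l 2 j] by (simp add: idx)
    next
      case False
      then obtain l' where l': "e l' = Suc (e l)"
        using e_surj[of "Suc (e l)"] e_less[of l] by auto
      then show ?thesis using step[OF l', of 2 j] M2 by (simp add: idx)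
    qed
    have "M $ (t, j, l) = 0" for t j l
      using M1 M2 M3 exhaust_3[of t] by auto
    then show "M = 0" by (simp add: vec_eq_iff)
  qed
  have lin: "Vector_Spaces.linear (*s) (*s) (W T)" for T
  proof -
    interpret Vector_Spaces.linear "(*s)" "(*s)" "apply3 T" by (rule linear_apply3)
    show ?thesis
      unfolding Vector_Spaces.linear_iff
      by (auto simp: vec.vector_space_axioms vec_eq_iff W_def add scale algebra_simps split: sum.split)
  qed
  have poly: "polynomial_fun (\<lambda>T. W T M $ t)" for M t
  proof (cases t)
    case (Inl p)
    obtain a j k where "p = (a, j, k)" by (cases p) auto
    then show ?thesis
      unfolding W_def Inl by (simp add: apply3_nth) (intro polynomial_fun_intros)
  next
    case (Inr q)
    then show ?thesis by (simp add: W_def polynomial_fun_const)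
  qed
  have "for_general (\<lambda>T. \<forall>M. W T M = 0 \<longrightarrow> M = 0)"
    using lin poly by (rule for_general_linear_injective[where ?T0.0 = T0]) (use W0 inj in blast)
  then show ?thesis by (rule for_general_mono) (use W0 in blast)
qed

section \<open>Independence of the equations of the critical space\<close>

type_synonym ('n, 'k) critical_index = "unit + 'n \<times> 'n + 'k \<times> 'k"

definition critical_forms ::
  "complex ^ (2 \<times> 'n::finite \<times> 'k::finite) \<Rightarrow> ('n, 'k) critical_index \<Rightarrow> complex ^ (2 \<times> 'n \<times> 'k)" where
  "critical_forms T = case_sum
     (\<lambda>_. \<chi> t. case t of (a, j, k) \<Rightarrow> if a = 2 then T $ (1, j, k) else - T $ (2, j, k))
     (case_sum
       (\<lambda>(p, q). \<chi> t. case t of (a, j, k) \<Rightarrow> (if j = q then T $ (a, p, k) else 0) - (if j = p then T $ (a, q, k) else 0))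
       (\<lambda>(p, q). \<chi> t. case t of (a, j, k) \<Rightarrow> (if k = q then T $ (a, j, p) else 0) - (if k = p then T $ (a, j, q) else 0)))"

lemma critical_forms_nth:
  "critical_forms T (Inl u) $ (a, j, k) = (if a = 2 then T $ (1, j, k) else - T $ (2, j, k))"
  "critical_forms T (Inr (Inl t)) $ (a, j, k) =
     (if j = snd t then T $ (a, fst t, k) else 0) - (if j = fst t then T $ (a, snd t, k) else 0)"
  "critical_forms T (Inr (Inr t')) $ (a, j, k) =
     (if k = snd t' then T $ (a, j, fst t') else 0) - (if k = fst t' then T $ (a, j, snd t') else 0)"
  by (simp_all add: critical_forms_def split: prod.split)

definition critical_indices :: "('n \<Rightarrow> nat) \<Rightarrow> ('k \<Rightarrow> nat) \<Rightarrow> ('n, 'k) critical_index set" where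
  "critical_indices e f = {()} <+> (pairs e <+> pairs f)"

lemma card_critical_indices:
  fixes e :: "'n :: finite \<Rightarrow> nat" and f :: "'k :: finite \<Rightarrow> nat"
  shows "card (critical_indices e f) = 1 + card (pairs e) + card (pairs f)"
  by (simp add: critical_indices_def card_Plus)

lemma bil_critical_forms:
  "bil (critical_forms T (Inl ())) z =
     (\<Sum>j\<in>UNIV. \<Sum>k\<in>UNIV. T $ (1, j, k) * z $ (2, j, k) - T $ (2, j, k) * z $ (1, j, k))"
  "bil (critical_forms T (Inr (Inl (p, q)))) z =
     (\<Sum>a\<in>UNIV. \<Sum>k\<in>UNIV. T $ (a, p, k) * z $ (a, q, k) - T $ (a, q, k) * z $ (a, p, k))"
  "bil (critical_forms T (Inr (Inr (r, s)))) z =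
     (\<Sum>a\<in>UNIV. \<Sum>j\<in>UNIV. T $ (a, j, r) * z $ (a, j, s) - T $ (a, j, s) * z $ (a, j, r))"
proof -
  show "bil (critical_forms T (Inl ())) z =
     (\<Sum>j\<in>UNIV. \<Sum>k\<in>UNIV. T $ (1, j, k) * z $ (2, j, k) - T $ (2, j, k) * z $ (1, j, k))"
    by (simp add: bil_def sum_UNIV_prod sum_2 critical_forms_def sum_subtractf sum_negf)
  have "(\<Sum>j\<in>UNIV. \<Sum>k\<in>UNIV. (if j = q then T $ (a, p, k) else 0) * z $ (a, j, k)) =
      (\<Sum>k\<in>UNIV. T $ (a, p, k) * z $ (a, q, k))" for a p q
  proof -
    have "(\<Sum>j\<in>UNIV. \<Sum>k\<in>UNIV. (if j = q then T $ (a, p, k) else 0) * z $ (a, j, k)) =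
        (\<Sum>j\<in>UNIV. if j = q then (\<Sum>k\<in>UNIV. T $ (a, p, k) * z $ (a, q, k)) else 0)"
      by (intro sum.cong refl) auto
    then show ?thesis by simp
  qed
  then show "bil (critical_forms T (Inr (Inl (p, q)))) z =
     (\<Sum>a\<in>UNIV. \<Sum>k\<in>UNIV. T $ (a, p, k) * z $ (a, q, k) - T $ (a, q, k) * z $ (a, p, k))"
    by (simp add: bil_def sum_UNIV_prod critical_forms_def left_diff_distrib sum_subtractf)
  have "(\<Sum>k\<in>UNIV. (if k = s then T $ (a, j, r) else 0) * z $ (a, j, k)) = T $ (a, j, r) * z $ (a, j, s)" for a j r s
  proof -
    have "(\<Sum>k\<in>UNIV. (if k = s then T $ (a, j, r) else 0) * z $ (a, j, k)) =
        (\<Sum>k\<in>UNIV. if k = s then T $ (a, j, r) * z $ (a, j, s) else 0)"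
      by (intro sum.cong refl) auto
    then show ?thesis by simp
  qed
  then show "bil (critical_forms T (Inr (Inr (r, s)))) z =
     (\<Sum>a\<in>UNIV. \<Sum>j\<in>UNIV. T $ (a, j, r) * z $ (a, j, s) - T $ (a, j, s) * z $ (a, j, r))"
    by (simp add: bil_def sum_UNIV_prod critical_forms_def left_diff_distrib sum_subtractf)
qed

lemma alternating_zero:
  fixes \<phi> :: "'a \<Rightarrow> 'a \<Rightarrow> complex"
  assumes "inj e" "\<And>p q. \<phi> q p = - \<phi> p q" "\<And>p q. (p, q) \<in> pairs e \<Longrightarrow> \<phi> p q = 0"
  shows "\<phi> p q = 0"
proof (cases "e p" "e q" rule: linorder_cases)
  case less
  then show ?thesis using assms(3) by (simp add: pairs_def)
next
  case equal
  then have "p = q" using assms(1) by (simp add: inj_eq)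
  then show ?thesis using assms(2)[of p p] by (simp add: equal_neg_zero)
next
  case greater
  then show ?thesis using assms(3)[of q p] assms(2)[of p q] by (simp add: pairs_def)
qed

lemma critical_space_annihilator:
  fixes T :: "complex ^ (2 \<times> 'n::finite \<times> 'k::finite)"
  assumes e: "inj e" and f: "inj f"
  shows "critical_space T = annihilator (critical_forms T ` critical_indices e f)"
proof -
  define h1 where "h1 z p q = (\<Sum>j\<in>UNIV. \<Sum>k\<in>UNIV. T $ (p, j, k) * z $ (q, j, k) - T $ (q, j, k) * z $ (p, j, k))" for z p q
  define h2 where "h2 z p q = (\<Sum>i\<in>UNIV. \<Sum>k\<in>UNIV. T $ (i, p, k) * z $ (i, q, k) - T $ (i, q, k) * z $ (i, p, k))" for z p q
  define h3 where "h3 z p q = (\<Sum>i\<in>UNIV. \<Sum>j\<in>UNIV. T $ (i, j, p) * z $ (i, j, q) - T $ (i, j, q) * z $ (i, j, p))" for z p q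
  have alt: "h1 z q p = - h1 z p q" "h2 z q' p' = - h2 z p' q'" "h3 z q'' p'' = - h3 z p'' q''" for z p q p' q' p'' q''
    by (simp_all add: h1_def h2_def h3_def sum_subtractf)
  have "z \<in> critical_space T \<longleftrightarrow> z \<in> annihilator (critical_forms T ` critical_indices e f)" for z
  proof
    assume "z \<in> critical_space T"
    then have "h1 z 1 2 = 0" "\<And>p q. h2 z p q = 0" "\<And>p q. h3 z p q = 0"
      by (auto simp: critical_space_def h1_def h2_def h3_def)
    then show "z \<in> annihilator (critical_forms T ` critical_indices e f)"
      by (auto simp: critical_indices_def bil_critical_forms h1_def h2_def h3_def intro!: annihilatorI)
  next
    assume "z \<in> annihilator (critical_forms T ` critical_indices e f)"
    then have *: "bil (critical_forms T i) z = 0" if "i \<in> critical_indices e f" for i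
      using that by (auto simp: annihilator_def)
    have h1: "h1 z 1 2 = 0"
      using *[of "Inl ()"] by (simp add: critical_indices_def bil_critical_forms h1_def InlI)
    have h1': "h1 z p q = 0" for p q
      using exhaust_2[of p] exhaust_2[of q] h1 alt(1)[of z 1 2] alt(1)[of z p p] by auto
    have h2: "h2 z p q = 0" for p q
      using e alt(2)
    proof (rule alternating_zero)
      fix p q assume "(p, q) \<in> pairs e"
      then show "h2 z p q = 0"
        using *[of "Inr (Inl (p, q))"] by (simp add: critical_indices_def bil_critical_forms h2_def InlI InrI)
    qed
    have h3: "h3 z p q = 0" for p q
      using f alt(3)
    proof (rule alternating_zero)
      fix p q assume "(p, q) \<in> pairs f"
      then show "h3 z p q = 0"
        using *[of "Inr (Inr (p, q))"] by (simp add: critical_indices_def bil_critical_forms h3_def InlI InrI)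
    qed
    show "z \<in> critical_space T"
      using h1' h2 h3 by (simp add: critical_space_def h1_def h2_def h3_def)
  qed
  then show ?thesis by blast
qed

text \<open>A relation among these forms is a triple of skew matrices, that is an infinitesimal
  rotation of the three factors, which annihilates \<open>T\<close>. Independence thus means that
  \<open>T\<close> has trivial stabiliser in the Lie algebra of
  \<open>SO_2 x SO_n x SO_{n+2}\<close>.\<close>

lemma for_general_critical_forms:
  fixes e :: "'n::finite \<Rightarrow> nat" and f :: "'k::finite \<Rightarrow> nat"
  assumes e: "inj e" and f: "inj f" and card: "CARD('k) = CARD('n) + 2"
  shows "for_general (\<lambda>T :: complex ^ (2 \<times> 'n \<times> 'k). indep_family (critical_indices e f) (critical_forms T))"
proof -
  obtain K :: "'k set" where K: "card K = CARD('n)"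
    using card obtain_subset_with_card_n[of "CARD('n)" "UNIV :: 'k set"] by auto
  then obtain \<iota> :: "'n \<Rightarrow> 'k" where \<iota>: "bij_betw \<iota> UNIV K"
    by (metis finite finite_same_card_bij)
  have "card (- K) = 2" using K card by (simp add: Compl_eq_Diff_UNIV card_Diff_subset)
  then obtain k1 k2 where k12: "- K = {k1, k2}" "k1 \<noteq> k2" by (auto simp: card_2_iff)
  have \<iota>_inj: "\<iota> j = \<iota> l \<longleftrightarrow> j = l" for j l using \<iota> by (auto simp: bij_betw_def inj_eq)
  have \<iota>_k: "\<iota> j \<noteq> k1" "\<iota> j \<noteq> k2" for j
    using \<iota> k12 by (auto simp: bij_betw_def)
  have k_cases: "(\<exists>j. k = \<iota> j) \<or> k = k1 \<or> k = k2" for k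
    using \<iota> k12(1) by (cases "k \<in> K") (auto simp: bij_betw_def)
  define j0 :: 'n where "j0 = undefined"
  \<comment> \<open>The first slice embeds the second factor into the third. The diagonal of the
    second slice is nonzero, which excludes a rotation of the first factor, and has distinct
    entries, which excludes simultaneous rotations of the other two. The entry at
    \<open>(j0, k1)\<close> excludes the rotation in the plane of \<open>k1\<close> and
    \<open>k2\<close>, which would fix a purely diagonal tensor.\<close>
  define T0 :: "complex ^ (2 \<times> 'n \<times> 'k)" where
    "T0 = (\<chi> t. case t of (a, j, k) \<Rightarrow> if a = 1 then (if k = \<iota> j then 1 else 0)
       else (if k = \<iota> j then of_nat (Suc (e j)) else 0) + (if j = j0 \<and> k = k1 then 1 else 0))"
  have T1: "T0 $ (1, j, k) = (if k = \<iota> j then 1 else 0)" for j k by (simp add: T0_def)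
  have T2: "T0 $ (2, j, k) = (if k = \<iota> j then of_nat (Suc (e j)) else 0) + (if j = j0 \<and> k = k1 then 1 else 0)" for j k
    by (simp add: T0_def)
  have "indep_family (critical_indices e f) (critical_forms T0)"
    unfolding indep_family_def
  proof (intro allI impI)
    fix c assume c: "(\<Sum>i\<in>critical_indices e f. c i *s critical_forms T0 i) = 0"
    define \<nu> where "\<nu> = c (Inl ())"
    define N where "N = skew_ext e (\<lambda>t. c (Inr (Inl t)))"
    define L where "L = skew_ext f (\<lambda>t. c (Inr (Inr t)))"
    have eq: "\<nu> * (if a = 2 then T0 $ (1, j, k) else - T0 $ (2, j, k)) + (\<Sum>p\<in>UNIV. N p j * T0 $ (a, p, k)) +
        (\<Sum>r\<in>UNIV. L r k * T0 $ (a, j, r)) = 0" for a j k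
    proof -
      have "0 = (\<Sum>i\<in>critical_indices e f. c i *s critical_forms T0 i) $ (a, j, k)" by (simp add: c)
      also have "\<dots> = \<nu> * (if a = 2 then T0 $ (1, j, k) else - T0 $ (2, j, k)) +
         ((\<Sum>(p, q)\<in>pairs e. c (Inr (Inl (p, q))) * ((if j = q then T0 $ (a, p, k) else 0) - (if j = p then T0 $ (a, q, k) else 0))) +
          (\<Sum>(r, s)\<in>pairs f. c (Inr (Inr (r, s))) * ((if k = s then T0 $ (a, j, r) else 0) - (if k = r then T0 $ (a, j, s) else 0))))"
        unfolding critical_indices_def
        by (simp add: sum.Plus \<nu>_def critical_forms_nth case_prod_beta)
      also have "\<dots> = \<nu> * (if a = 2 then T0 $ (1, j, k) else - T0 $ (2, j, k)) +
         ((\<Sum>p\<in>UNIV. N p j * T0 $ (a, p, k)) + (\<Sum>r\<in>UNIV. L r k * T0 $ (a, j, r)))"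
        unfolding N_def L_def sum_pairs[symmetric] by simp
      finally show ?thesis by (simp add: add.assoc)
    qed
    have s1: "(\<Sum>p\<in>UNIV. N p j * T0 $ (1, p, \<iota> l)) = N l j" for j l
      by (simp add: T1 \<iota>_inj if_distrib cong: if_cong)
    have s2: "(\<Sum>r\<in>UNIV. L r k * T0 $ (1, j, r)) = L (\<iota> j) k" for j k
      by (simp add: T1 if_distrib cong: if_cong)
    have s3: "(\<Sum>p\<in>UNIV. N p j * T0 $ (1, p, k)) = 0" if "k = k1 \<or> k = k2" for j k
    proof -
      have "k \<noteq> \<iota> p" for p using that \<iota>_k[of p] by auto
      then show ?thesis by (simp add: T1)
    qed
    have diag: "N p p = 0" "L r r = 0" for p r
      by (simp_all add: N_def L_def)
    have \<nu>: "\<nu> = 0"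
    proof -
      have "\<nu> * of_nat (Suc (e j0)) = 0"
        using eq[of 1 j0 "\<iota> j0"] by (simp add: s1 s2 T2 \<iota>_k diag del: of_nat_Suc)
      then show ?thesis by (simp del: of_nat_Suc)
    qed
    \<comment> \<open>By the first slice, the rotation of the third factor copies that of the second
      on the image of \<open>\<iota>\<close>.\<close>
    have LN: "L (\<iota> j) (\<iota> l) = - N l j" for j l
      using eq[of 1 j "\<iota> l"] by (simp add: s1 s2 \<nu> eq_neg_iff_add_eq_0 add.commute)
    have Lk: "L (\<iota> j) k = 0" if "k = k1 \<or> k = k2" for j k
      using eq[of 1 j k] by (simp add: s2 s3[OF that] \<nu>)
    have r2: "(\<Sum>r\<in>UNIV. L r k * T0 $ (2, j, r)) = L (\<iota> j) k * of_nat (Suc (e j)) + (if j = j0 then L k1 k else 0)" for j k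
    proof -
      have "(\<Sum>r\<in>UNIV. L r k * T0 $ (2, j, r)) =
         (\<Sum>r\<in>UNIV. (if r = \<iota> j then L r k * of_nat (Suc (e j)) else 0) + (if r = k1 then (if j = j0 then L r k else 0) else 0))"
        unfolding T2 by (intro sum.cong refl) (simp add: distrib_left del: of_nat_Suc)
      also have "\<dots> = L (\<iota> j) k * of_nat (Suc (e j)) + (if j = j0 then L k1 k else 0)"
        by (simp add: sum.distrib del: of_nat_Suc)
      finally show ?thesis .
    qed
    \<comment> \<open>The second slice repeats this relation weighted by its diagonal entries; as
      they are distinct, only zero remains.\<close>
    have N0: "N l j = 0" for l j
    proof (cases "l = j")
      case True then show ?thesis by (simp add: diag)
    next
      case False
      have "(\<Sum>p\<in>UNIV. N p j * T0 $ (2, p, \<iota> l)) = N l j * of_nat (Suc (e l))"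
      proof -
        have "(\<Sum>p\<in>UNIV. N p j * T0 $ (2, p, \<iota> l)) = (\<Sum>p\<in>UNIV. if l = p then N l j * of_nat (Suc (e l)) else 0)"
          by (intro sum.cong refl) (simp add: T2 \<iota>_inj \<iota>_k del: of_nat_Suc)
        then show ?thesis by simp
      qed
      moreover have Lk1: "L k1 (\<iota> l) = 0" using Lk[of k1 l] skew_ext_swap[of f _ k1 "\<iota> l"] by (simp add: L_def)
      ultimately have "N l j * of_nat (Suc (e l)) - N l j * of_nat (Suc (e j)) = 0"
        using eq[of 2 j "\<iota> l"] by (simp add: r2 \<nu> LN Lk1 del: of_nat_Suc cong: if_cong)
      then have "N l j * (of_nat (Suc (e l)) - of_nat (Suc (e j))) = 0"
        by (simp add: right_diff_distrib)
      moreover have "e l \<noteq> e j" using False e by (simp add: inj_eq)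
      ultimately show ?thesis by simp
    qed
    have "L k1 k2 = 0"
      using eq[of 2 j0 k2] by (simp add: r2 \<nu> N0 Lk)
    then have "L k2 k1 = 0" using skew_ext_swap[of f _ k2 k1] by (simp add: L_def)
    have L0: "L r s = 0" for r s
    proof -
      have Lk': "L k (\<iota> j) = 0" if "k = k1 \<or> k = k2" for j k
        using Lk[OF that, of j] skew_ext_swap[of f _ k "\<iota> j"] by (simp add: L_def)
      show ?thesis
        using k_cases[of r] k_cases[of s] LN N0 Lk Lk' diag \<open>L k1 k2 = 0\<close> \<open>L k2 k1 = 0\<close> by auto
    qed
    have "c i = 0" if i: "i \<in> critical_indices e f" for i
    proof -
      consider "i = Inl ()" | t where "i = Inr (Inl t)" "t \<in> pairs e" | t where "i = Inr (Inr t)" "t \<in> pairs f"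
        using i by (auto simp: critical_indices_def)
      then show ?thesis
      proof cases
        case 1 then show ?thesis using \<nu> by (simp add: \<nu>_def)
      next
        case 2
        have "skew_ext e (\<lambda>t. c (Inr (Inl t))) = (\<lambda>_ _. 0)" using N0 by (auto simp: N_def fun_eq_iff)
        from skew_ext_zeroD[OF this 2(2)] 2(1) show ?thesis by simp
      next
        case 3
        have "skew_ext f (\<lambda>t. c (Inr (Inr t))) = (\<lambda>_ _. 0)" using L0 by (auto simp: L_def fun_eq_iff)
        from skew_ext_zeroD[OF this 3(2)] 3(1) show ?thesis by simp
      qed
    qed
    then show "\<forall>i\<in>critical_indices e f. c i = 0" by blast
  qed
  moreover have "polynomial_fun (\<lambda>T :: complex ^ (2 \<times> 'n \<times> 'k). critical_forms T i $ t)" for i t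
  proof -
    obtain a j k where t: "t = (a, j, k)" by (cases t) auto
    consider u where "i = Inl u" | s where "i = Inr (Inl s)" | s where "i = Inr (Inr s)"
      by (metis sum.exhaust)
    then show ?thesis
      by cases (simp_all only: t critical_forms_nth, (intro polynomial_fun_intros)+)
  qed
  ultimately show ?thesis
    using for_general_indep_family[of "\<lambda>i T. critical_forms T i" "critical_indices e f" T0] by simp
qed

subsection \<open>A diagonal tensor\<close>

text \<open>Nondegeneracy: the linearisation of \<open>T(x, \<cdot>, T(x, y)) = \<mu> y\<close> and of the minor for \<open>x\<close> is injective on
  the slice where \<open>x \<bullet> \<xi> = 0\<close> and one coordinate of \<open>y\<close> is fixed.\<close>

definition regular_pair ::
  "complex ^ (2 \<times> 'n::finite \<times> 'k::finite) \<Rightarrow> complex ^ 2 \<Rightarrow> complex ^ 'n \<Rightarrow> bool" where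
  "regular_pair T x y \<longleftrightarrow> (\<exists>\<mu> i.
     contract2 T x (contract3 T x y) = \<mu> *s y \<and>
     contract1 T y (contract3 T x y) $ 1 * x $ 2 - contract1 T y (contract3 T x y) $ 2 * x $ 1 = 0 \<and>
     (\<forall>\<xi> \<eta> m.
        contract2 T \<xi> (contract3 T x y) + contract2 T x (contract3 T \<xi> y) + contract2 T x (contract3 T x \<eta>)
          = m *s y + \<mu> *s \<eta> \<longrightarrow>
        (let g = contract1 T y (contract3 T x y);
             h = contract1 T \<eta> (contract3 T x y) + contract1 T y (contract3 T \<xi> y) + contract1 T y (contract3 T x \<eta>)
         in (h $ 1 * x $ 2 + g $ 1 * \<xi> $ 2) - (h $ 2 * x $ 1 + g $ 2 * \<xi> $ 1) = 0) \<longrightarrow>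
        bil x \<xi> = 0 \<longrightarrow> \<eta> $ i = 0 \<longrightarrow> \<xi> = 0 \<and> \<eta> = 0 \<and> m = 0))"

definition diag_tensor :: "('n::finite \<Rightarrow> 'k::finite) \<Rightarrow> ('n \<Rightarrow> complex) \<Rightarrow> ('n \<Rightarrow> complex) \<Rightarrow> complex ^ (2 \<times> 'n \<times> 'k)" where
  "diag_tensor \<iota> P R = (\<chi> t. case t of (a, j, k) \<Rightarrow> if k = \<iota> j then (if a = 1 then P j else R j) else 0)"

text \<open>A binary quadratic form with two distinct zeros is a multiple of the product of two
  linear forms; since \<open>a2 * b2\<close> is nonzero, the multiple can be read off from the first
  coefficient.\<close>

lemma quadratic_two_zeros:
  fixes r1 r2 r3 :: complex
  assumes "r1 * (a1 * a1) + r2 * (a1 * a2) + r3 * (a2 * a2) = 0"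
    and "r1 * (b1 * b1) + r2 * (b1 * b2) + r3 * (b2 * b2) = 0"
    and "a2 * b2 \<noteq> 0" "a1 * b2 - a2 * b1 \<noteq> 0"
  obtains t where "r1 = t * (a2 * b2)" "r2 = - t * (a1 * b2 + a2 * b1)" "r3 = t * (a1 * b1)"
proof -
  define t where "t = r1 / (a2 * b2)"
  have r1: "r1 = t * (a2 * b2)" using assms(3) by (simp add: t_def)
  define s2 where "s2 = r2 + t * (a1 * b2 + a2 * b1)"
  define s3 where "s3 = r3 - t * (a1 * b1)"
  have "a2 * (s2 * a1 + s3 * a2) = 0"
    using assms(1) unfolding r1 s2_def s3_def by (simp add: algebra_simps)
  then have a: "s2 * a1 + s3 * a2 = 0" using assms(3) by simp
  have "b2 * (s2 * b1 + s3 * b2) = 0"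
    using assms(2) unfolding r1 s2_def s3_def by (simp add: algebra_simps)
  then have b: "s2 * b1 + s3 * b2 = 0" using assms(3) by simp
  have "s2 * (a1 * b2 - a2 * b1) = b2 * (s2 * a1 + s3 * a2) - a2 * (s2 * b1 + s3 * b2)"
    by (simp add: algebra_simps)
  then have "s2 = 0" using a b assms(4) by simp
  then have "s3 = 0" using a assms(3) by simp
  have "r2 = - t * (a1 * b2 + a2 * b1)" "r3 = t * (a1 * b1)"
    using \<open>s2 = 0\<close> \<open>s3 = 0\<close> by (simp_all add: s2_def s3_def add_eq_0_iff)
  with r1 show ?thesis by (rule that)
qed

text \<open>A non-isotropic \<open>x\<close> and its quarter turn form an orthogonal basis of the
  plane; an isotropic \<open>x\<close> would be orthogonal to itself.\<close>

lemma orthogonal_in_plane: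
  fixes x \<xi> :: "complex ^ 2"
  assumes "bil x \<xi> = 0" "bil x x \<noteq> 0"
  obtains \<tau> where "\<xi> $ 1 = - \<tau> * x $ 2" "\<xi> $ 2 = \<tau> * x $ 1"
proof -
  define N where "N = x $ 1 * x $ 1 + x $ 2 * x $ 2"
  have N: "N \<noteq> 0" using assms(2) by (simp add: N_def bil_def sum_2)
  have o: "x $ 1 * \<xi> $ 1 + x $ 2 * \<xi> $ 2 = 0" using assms(1) by (simp add: bil_def sum_2)
  define d where "d = x $ 1 * \<xi> $ 2 - x $ 2 * \<xi> $ 1"
  have "\<xi> $ 1 * N = x $ 1 * (x $ 1 * \<xi> $ 1 + x $ 2 * \<xi> $ 2) - d * x $ 2"
    by (simp add: N_def d_def algebra_simps)
  then have "\<xi> $ 1 * N = - (d * x $ 2)" unfolding o by simp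
  then have 1: "\<xi> $ 1 = - (d / N) * x $ 2" using N by (simp add: field_simps)
  have "\<xi> $ 2 * N = x $ 2 * (x $ 1 * \<xi> $ 1 + x $ 2 * \<xi> $ 2) + d * x $ 1"
    by (simp add: N_def d_def algebra_simps)
  then have "\<xi> $ 2 * N = d * x $ 1" unfolding o by simp
  then have "\<xi> $ 2 = d / N * x $ 1" using N by (simp add: field_simps)
  with 1 show ?thesis by (rule that)
qed

text \<open>The lines are \<open>l\<^sub>i(x) = P\<^sub>i x\<^sub>1 + R\<^sub>i x\<^sub>2\<close>. The last assumption says that \<open>l\<^sub>k\<^sup>2\<close> differs from
  \<open>l\<^sub>i\<^sup>2 = l\<^sub>j\<^sup>2\<close> at the zeros of \<open>l\<^sub>i \<plusminus> l\<^sub>j\<close>, so that eigenvalues only ever coincide in pairs.\<close>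

locale generic_lines =
  fixes P R :: "'n::finite \<Rightarrow> complex" and \<iota> :: "'n \<Rightarrow> 'k::finite"
  assumes inj_\<iota>: "inj \<iota>"
    and P_nz: "P i \<noteq> 0" and R_nz: "R i \<noteq> 0"
    and norm_nz: "P i * P i + R i * R i \<noteq> 0"
    and P_sq: "i \<noteq> j \<Longrightarrow> P i * P i \<noteq> P j * P j"
    and det_nz: "i \<noteq> j \<Longrightarrow> P i * R j - P j * R i \<noteq> 0"
    and scal_norm: "i \<noteq> j \<Longrightarrow> \<epsilon> \<in> {1, -1} \<Longrightarrow> P i * P i + R i * R i + \<epsilon> * (P i * P j + R i * R j) \<noteq> 0"
    and norm_sum: "i \<noteq> j \<Longrightarrow> \<epsilon> \<in> {1, -1} \<Longrightarrow>
      (R i + \<epsilon> * R j) * (R i + \<epsilon> * R j) + (P i + \<epsilon> * P j) * (P i + \<epsilon> * P j) \<noteq> 0"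
    and triple: "i \<noteq> j \<Longrightarrow> i \<noteq> k \<Longrightarrow> j \<noteq> k \<Longrightarrow> \<epsilon> \<in> {1, -1} \<Longrightarrow> \<epsilon>' \<in> {1, -1} \<Longrightarrow>
      (P i * R k - P k * R i) + \<epsilon> * (P j * R k - P k * R j) + \<epsilon>' * (P i * R j - P j * R i) \<noteq> 0"
begin

abbreviation D :: "complex ^ (2 \<times> 'n \<times> 'k)" where "D \<equiv> diag_tensor \<iota> P R"

definition lin :: "complex ^ 2 \<Rightarrow> 'n \<Rightarrow> complex" where "lin x j = P j * x $ 1 + R j * x $ 2"

text \<open>The line evaluated at a quarter turn of \<open>x\<close>. Hence
  \<open>lin * colin\<close> is, up to the factor \<open>- 2\<close>, the derivative of the square
  of \<open>lin\<close> under rotation of \<open>x\<close>, and criticality in \<open>x\<close> is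
  the vanishing of its sum weighted by the squares of the \<open>y $ j\<close>.\<close>

definition colin :: "complex ^ 2 \<Rightarrow> 'n \<Rightarrow> complex" where "colin x j = P j * x $ 2 - R j * x $ 1"

lemma \<iota>_eq: "\<iota> j = \<iota> l \<longleftrightarrow> j = l"
  using inj_\<iota> by (simp add: inj_eq)

lemma D_nth: "D $ (1, j, k) = (if k = \<iota> j then P j else 0)" "D $ (2, j, k) = (if k = \<iota> j then R j else 0)"
  by (simp_all add: diag_tensor_def)

lemma slice_D: "slice D 1 y (\<iota> j) = P j * y $ j" "slice D 2 y (\<iota> j) = R j * y $ j"
  by (simp_all add: slice_def D_nth \<iota>_eq if_distrib[where f = "\<lambda>x. x * _"] cong: if_cong)

lemma slice_D_outside: "k \<notin> range \<iota> \<Longrightarrow> slice D 1 y k = 0 \<and> slice D 2 y k = 0"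
  by (auto simp: slice_def D_nth intro!: sum.neutral)

lemma contract3_D: "contract3 D x y $ \<iota> j = lin x j * y $ j"
  by (simp add: contract3_slice slice_D lin_def algebra_simps)

lemma sum_range_\<iota>: "(\<And>k. k \<notin> range \<iota> \<Longrightarrow> f k = 0) \<Longrightarrow> (\<Sum>k\<in>UNIV. f k) = (\<Sum>j\<in>UNIV. f (\<iota> j))" for f :: "'k \<Rightarrow> complex"
proof -
  assume "\<And>k. k \<notin> range \<iota> \<Longrightarrow> f k = 0"
  then have "(\<Sum>k\<in>UNIV. f k) = (\<Sum>k\<in>range \<iota>. f k)"
    by (intro sum.mono_neutral_right) auto
  then show ?thesis by (simp add: sum.reindex[OF inj_\<iota>])
qed

lemma contract1_D:
  "contract1 D y z $ 1 = (\<Sum>j\<in>UNIV. P j * y $ j * z $ \<iota> j)"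
  "contract1 D y z $ 2 = (\<Sum>j\<in>UNIV. R j * y $ j * z $ \<iota> j)"
  unfolding contract1_slice by (subst sum_range_\<iota>; simp add: slice_D_outside slice_D)+

lemma contract2_D: "contract2 D x z $ j = lin x j * z $ \<iota> j"
proof -
  have "contract2 D x z $ j = (\<Sum>k\<in>UNIV. if k = \<iota> j then lin x j * z $ \<iota> j else 0)"
    unfolding contract2_2 by (intro sum.cong refl) (simp add: D_nth lin_def algebra_simps)
  then show ?thesis by simp
qed

lemma minor_D:
  "contract1 D y (contract3 D x y) $ 1 * x $ 2 - contract1 D y (contract3 D x y) $ 2 * x $ 1 =
     (\<Sum>j\<in>UNIV. lin x j * colin x j * (y $ j * y $ j))"
  by (simp add: contract1_D contract3_D colin_def sum_distrib_right sum_distrib_left sum_subtractf[symmetric] algebra_simps)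

lemma lin_colin_perp:
  assumes "\<xi> $ 1 = - \<tau> * x $ 2" "\<xi> $ 2 = \<tau> * x $ 1"
  shows "lin \<xi> j = - \<tau> * colin x j" "colin \<xi> j = \<tau> * lin x j"
  using assms by (simp_all add: lin_def colin_def algebra_simps)

text \<open>The tangent vector \<open>\<xi>\<close> is orthogonal to the non-isotropic
  \<open>x\<close>, hence \<open>\<tau>\<close> times its quarter turn. All contractions are
  diagonal, so regularity becomes a scalar system in \<open>\<tau>\<close>, \<open>\<eta>\<close>
  and \<open>m\<close>.\<close>

lemma regular_pair_D:
  assumes eig: "\<And>j. lin x j * lin x j * y $ j = \<mu> * y $ j"
    and minor: "(\<Sum>j\<in>UNIV. lin x j * colin x j * (y $ j * y $ j)) = 0"
    and x: "bil x x \<noteq> 0"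
    and inj: "\<And>\<tau> \<eta> m.
      (\<And>j. - 2 * \<tau> * (lin x j * colin x j) * y $ j + lin x j * lin x j * \<eta> $ j = m * y $ j + \<mu> * \<eta> $ j) \<Longrightarrow>
      (\<Sum>j\<in>UNIV. 2 * (lin x j * colin x j) * (y $ j * \<eta> $ j) +
        \<tau> * (lin x j * lin x j - colin x j * colin x j) * (y $ j * y $ j)) = 0 \<Longrightarrow>
      \<eta> $ i = 0 \<Longrightarrow> \<tau> = 0 \<and> \<eta> = 0 \<and> m = 0"
  shows "regular_pair D x y"
  unfolding regular_pair_def Let_def
proof (intro exI conjI allI impI)
  show "contract2 D x (contract3 D x y) = \<mu> *s y"
    by (simp add: vec_eq_iff contract2_D contract3_D flip: eig)
  show "contract1 D y (contract3 D x y) $ 1 * x $ 2 - contract1 D y (contract3 D x y) $ 2 * x $ 1 = 0"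
    using minor by (simp add: minor_D)
next
  fix \<xi> \<eta> m
  assume L2: "contract2 D \<xi> (contract3 D x y) + contract2 D x (contract3 D \<xi> y) + contract2 D x (contract3 D x \<eta>)
      = m *s y + \<mu> *s \<eta>"
    and L1: "((contract1 D \<eta> (contract3 D x y) + contract1 D y (contract3 D \<xi> y) + contract1 D y (contract3 D x \<eta>)) $ 1 * x $ 2 +
        contract1 D y (contract3 D x y) $ 1 * \<xi> $ 2) -
      ((contract1 D \<eta> (contract3 D x y) + contract1 D y (contract3 D \<xi> y) + contract1 D y (contract3 D x \<eta>)) $ 2 * x $ 1 +
        contract1 D y (contract3 D x y) $ 2 * \<xi> $ 1) = 0"
    and "bil x \<xi> = 0" and \<eta>i: "\<eta> $ i = 0"
  then obtain \<tau> where \<xi>: "\<xi> $ 1 = - \<tau> * x $ 2" "\<xi> $ 2 = \<tau> * x $ 1"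
    using orthogonal_in_plane x by blast
  note perp = lin_colin_perp[OF \<xi>]
  have 1: "- 2 * \<tau> * (lin x j * colin x j) * y $ j + lin x j * lin x j * \<eta> $ j = m * y $ j + \<mu> * \<eta> $ j" for j
    using arg_cong[OF L2, of "\<lambda>v. v $ j"] by (simp add: contract2_D contract3_D perp algebra_simps)
  have "0 = (\<Sum>j\<in>UNIV. (2 * lin x j * y $ j * \<eta> $ j + lin \<xi> j * (y $ j * y $ j)) * colin x j + lin x j * (y $ j * y $ j) * colin \<xi> j)"
    unfolding L1[symmetric]
    by (simp add: contract1_D contract3_D colin_def sum_distrib_right sum_distrib_left sum_subtractf sum.distrib algebra_simps)
  also have "\<dots> = (\<Sum>j\<in>UNIV. 2 * (lin x j * colin x j) * (y $ j * \<eta> $ j) +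
        \<tau> * (lin x j * lin x j - colin x j * colin x j) * (y $ j * y $ j))"
    by (rule sum.cong) (simp_all add: perp algebra_simps)
  finally have "\<tau> = 0 \<and> \<eta> = 0 \<and> m = 0" using inj[OF 1 _ \<eta>i] by simp
  moreover from this have "\<xi> = 0" using \<xi> by (simp add: vec_eq_iff forall_2)
  ultimately show "\<xi> = 0" "\<eta> = 0" "m = 0" by simp_all
qed

text \<open>The eigenvalue at \<open>i\<close> is simple, which forces \<open>\<eta>\<close> to
  vanish off \<open>i\<close>; the linearised minor is then \<open>\<tau>\<close> times the
  difference of the squares of \<open>lin x i\<close> and \<open>colin x i\<close>.\<close>

lemma regular_pair_axis:
  assumes lc: "lin x i * colin x i = 0" and lc': "lin x i * lin x i \<noteq> colin x i * colin x i"
    and x: "bil x x \<noteq> 0" and other: "\<And>k. k \<noteq> i \<Longrightarrow> lin x k * lin x k \<noteq> lin x i * lin x i"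
  shows "regular_pair D x (axis i 1)"
proof (rule regular_pair_D[where \<mu> = "lin x i * lin x i" and i = i])
  have s: "(\<Sum>j\<in>UNIV. f j * (axis i 1 $ j * axis i 1 $ j)) = f i" for f :: "'n \<Rightarrow> complex"
    by (simp add: axis_def if_distrib cong: if_cong)
  show "lin x j * lin x j * axis i 1 $ j = lin x i * lin x i * axis i 1 $ j" for j
    by (simp add: axis_def)
  show "(\<Sum>j\<in>UNIV. lin x j * colin x j * (axis i 1 $ j * axis i 1 $ j)) = 0"
    unfolding s by (rule lc)
  show "bil x x \<noteq> 0" by (rule x)
  fix \<tau> \<eta> m
  assume 1: "\<And>j. - 2 * \<tau> * (lin x j * colin x j) * axis i 1 $ j + lin x j * lin x j * \<eta> $ j =
      m * axis i 1 $ j + lin x i * lin x i * \<eta> $ j"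
    and 2: "(\<Sum>j\<in>UNIV. 2 * (lin x j * colin x j) * (axis i 1 $ j * \<eta> $ j) +
        \<tau> * (lin x j * lin x j - colin x j * colin x j) * (axis i 1 $ j * axis i 1 $ j)) = 0"
    and \<eta>i: "\<eta> $ i = 0"
  have "\<eta> $ k = 0" for k
  proof (cases "k = i")
    case False
    then show ?thesis using 1[of k] other[OF False] by (simp add: axis_def)
  qed (simp add: \<eta>i)
  then have \<eta>: "\<eta> = 0" by (simp add: vec_eq_iff)
  have "\<tau> * (lin x i * lin x i - colin x i * colin x i) = 0"
    using 2 unfolding \<eta> by (simp only: zero_index mult_zero_right add_0_left s)
  then have \<tau>: "\<tau> = 0" using lc' by simp
  have "m = 0" using 1[of i] by (simp add: \<tau> \<eta> axis_def)
  with \<eta> \<tau> show "\<tau> = 0 \<and> \<eta> = 0 \<and> m = 0" by simp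
qed

text \<open>Exactly two eigenvalues coincide, at \<open>i\<close> and \<open>j\<close>. Both
  equations express \<open>m\<close> by \<open>\<tau>\<close>, with different factors, so
  \<open>\<tau> = 0\<close>; the linearised minor then removes the one remaining coordinate of
  \<open>\<eta>\<close>.\<close>

lemma regular_pair_two:
  assumes ij: "i \<noteq> j" and eq: "lin x i * lin x i = lin x j * lin x j"
    and nz: "lin x j * colin x j \<noteq> 0"
    and minor: "\<alpha> * \<alpha> * (lin x i * colin x i) + \<beta> * \<beta> * (lin x j * colin x j) = 0"
    and \<alpha>\<beta>: "\<alpha> \<noteq> 0" "\<beta> \<noteq> 0"
    and diff: "lin x i * colin x i \<noteq> lin x j * colin x j"
    and x: "bil x x \<noteq> 0"
    and other: "\<And>k. k \<noteq> i \<Longrightarrow> k \<noteq> j \<Longrightarrow> lin x k * lin x k \<noteq> lin x i * lin x i"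
  shows "regular_pair D x (\<alpha> *s axis i 1 + \<beta> *s axis j 1)"
proof -
  define y where "y = \<alpha> *s axis i 1 + \<beta> *s axis j (1 :: complex)"
  have y: "y $ i = \<alpha>" "y $ j = \<beta>" "\<And>k. k \<noteq> i \<Longrightarrow> k \<noteq> j \<Longrightarrow> y $ k = 0"
    using ij by (auto simp: y_def axis_def)
  have s: "(\<Sum>k\<in>UNIV. f k) = f i + f j" if "\<And>k. k \<noteq> i \<Longrightarrow> k \<noteq> j \<Longrightarrow> f k = 0" for f :: "'n \<Rightarrow> complex"
  proof -
    have "(\<Sum>k\<in>UNIV. f k) = (\<Sum>k\<in>{i, j}. f k)"
      using that by (intro sum.mono_neutral_right) auto
    then show ?thesis using ij by simp
  qed
  have "regular_pair D x y"
  proof (rule regular_pair_D[where \<mu> = "lin x i * lin x i" and i = i])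
    show "lin x k * lin x k * y $ k = lin x i * lin x i * y $ k" for k
      using eq y(3)[of k] by (cases "k = i \<or> k = j") auto
    have "(\<Sum>k\<in>UNIV. lin x k * colin x k * (y $ k * y $ k)) =
        lin x i * colin x i * (y $ i * y $ i) + lin x j * colin x j * (y $ j * y $ j)"
      by (rule s) (simp add: y(3))
    then show "(\<Sum>k\<in>UNIV. lin x k * colin x k * (y $ k * y $ k)) = 0"
      using minor by (simp add: y(1,2) algebra_simps)
    show "bil x x \<noteq> 0" by (rule x)
    fix \<tau> \<eta> m
    assume 1: "\<And>k. - 2 * \<tau> * (lin x k * colin x k) * y $ k + lin x k * lin x k * \<eta> $ k =
        m * y $ k + lin x i * lin x i * \<eta> $ k"
      and 2: "(\<Sum>k\<in>UNIV. 2 * (lin x k * colin x k) * (y $ k * \<eta> $ k) +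
          \<tau> * (lin x k * lin x k - colin x k * colin x k) * (y $ k * y $ k)) = 0"
      and \<eta>i: "\<eta> $ i = 0"
    have \<eta>k: "\<eta> $ k = 0" if "k \<noteq> i" "k \<noteq> j" for k
      using 1[of k] other[OF that] y(3)[OF that] by simp
    have mi: "m = - 2 * \<tau> * (lin x i * colin x i)"
    proof -
      have "m * \<alpha> = - 2 * \<tau> * (lin x i * colin x i) * \<alpha>" using 1[of i] by (simp add: y \<eta>i)
      then show ?thesis using mult_right_cancel[OF \<alpha>\<beta>(1)] by blast
    qed
    have mj: "m = - 2 * \<tau> * (lin x j * colin x j)"
    proof -
      have "m * \<beta> = - 2 * \<tau> * (lin x j * colin x j) * \<beta>" using 1[of j] by (simp add: y eq)
      then show ?thesis using mult_right_cancel[OF \<alpha>\<beta>(2)] by blast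
    qed
    have "\<tau> * (lin x i * colin x i - lin x j * colin x j) =
        (- 2 * \<tau> * (lin x j * colin x j) - - 2 * \<tau> * (lin x i * colin x i)) / 2"
      by (simp add: field_simps)
    also have "\<dots> = 0" unfolding mi[symmetric] mj[symmetric] by simp
    finally have "\<tau> * (lin x i * colin x i - lin x j * colin x j) = 0" .
    then have \<tau>: "\<tau> = 0" using diff by simp
    have "(\<Sum>k\<in>UNIV. 2 * (lin x k * colin x k) * (y $ k * \<eta> $ k)) =
        2 * (lin x i * colin x i) * (y $ i * \<eta> $ i) + 2 * (lin x j * colin x j) * (y $ j * \<eta> $ j)"
      by (rule s) (simp add: y(3))
    then have "\<eta> $ j = 0"
      using 2 nz \<alpha>\<beta>(2) by (simp add: \<tau> \<eta>i y)
    then have "\<eta> = 0"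
      using \<eta>i \<eta>k by (metis vec_eq_iff zero_index)
    then show "\<tau> = 0 \<and> \<eta> = 0 \<and> m = 0" using \<tau> mi by simp
  qed
  then show ?thesis by (simp add: y_def)
qed

section \<open>Explicit regular pairs of the diagonal tensor\<close>

definition vec2 :: "complex \<Rightarrow> complex \<Rightarrow> complex ^ 2" where
  "vec2 a b = (\<chi> i. if i = 1 then a else b)"

lemma vec2_nth [simp]: "vec2 a b $ 1 = a" "vec2 a b $ 2 = b"
  by (simp_all add: vec2_def)

text \<open>The zero of the line \<open>l_i\<close>: the other lines do not vanish there, so the
  eigenvalue 0 is simple.\<close>

lemma regular_pair_kernel: "regular_pair D (vec2 (R i) (- P i)) (axis i 1)"
proof (rule regular_pair_axis)
  let ?x = "vec2 (R i) (- P i)"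
  have li: "lin ?x i = 0" by (simp add: lin_def)
  define N where "N = P i * P i + R i * R i"
  have N: "N \<noteq> 0" using norm_nz by (simp add: N_def)
  have ci: "colin ?x i = - N" by (simp add: colin_def N_def)
  show "lin ?x i * colin ?x i = 0" by (simp add: li)
  show "lin ?x i * lin ?x i \<noteq> colin ?x i * colin ?x i" using N by (simp add: li ci)
  show "bil ?x ?x \<noteq> 0" using norm_nz[of i] by (simp add: bil_def sum_2 add.commute[of "R i * R i"])
  show "lin ?x k * lin ?x k \<noteq> lin ?x i * lin ?x i" if "k \<noteq> i" for k
    using det_nz[OF that] by (simp add: li) (simp add: lin_def algebra_simps)
qed

text \<open>The normal direction of \<open>l_i\<close>, the other point where
  \<open>lin * colin\<close> vanishes at \<open>i\<close>; \<open>scal_norm\<close> keeps the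
  remaining eigenvalues different.\<close>

lemma regular_pair_normal: "regular_pair D (vec2 (P i) (R i)) (axis i 1)"
proof (rule regular_pair_axis)
  let ?x = "vec2 (P i) (R i)"
  have li: "lin ?x i = P i * P i + R i * R i" by (simp add: lin_def)
  have ci: "colin ?x i = 0" by (simp add: colin_def)
  show "lin ?x i * colin ?x i = 0" by (simp add: ci)
  show "lin ?x i * lin ?x i \<noteq> colin ?x i * colin ?x i" using norm_nz[of i] by (simp add: li ci)
  show "bil ?x ?x \<noteq> 0" using norm_nz[of i] by (simp add: bil_def sum_2)
  show "lin ?x k * lin ?x k \<noteq> lin ?x i * lin ?x i" if "k \<noteq> i" for k
  proof
    assume "lin ?x k * lin ?x k = lin ?x i * lin ?x i"
    then have "(lin ?x i + lin ?x k) * (lin ?x i + - 1 * lin ?x k) = 0"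
      by (simp add: algebra_simps)
    moreover have "lin ?x i + \<epsilon> * lin ?x k \<noteq> 0" if "\<epsilon> \<in> {1, -1}" for \<epsilon>
      using scal_norm[of i k \<epsilon>] \<open>k \<noteq> i\<close> that by (simp add: lin_def algebra_simps)
    from this[of 1] this[of "-1"] have "lin ?x i + lin ?x k \<noteq> 0" "lin ?x i + - 1 * lin ?x k \<noteq> 0" by simp_all
    ultimately show False by simp
  qed
qed

text \<open>For a sign \<open>\<epsilon>\<close> this is the zero of
  \<open>l_i + \<epsilon> * l_j\<close>, where the squares of the two lines agree.\<close>

definition cross_point :: "'n \<Rightarrow> 'n \<Rightarrow> complex \<Rightarrow> complex ^ 2" where
  "cross_point i j \<epsilon> = vec2 (R i + \<epsilon> * R j) (- (P i + \<epsilon> * P j))"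

lemma cross_point_lin:
  "lin (cross_point i j \<epsilon>) k = - ((P i * R k - P k * R i) + \<epsilon> * (P j * R k - P k * R j))"
  by (simp add: lin_def cross_point_def algebra_simps)

text \<open>Each genericity assumption has its task: \<open>scal_norm\<close> keeps
  \<open>lin * colin\<close> nonzero at \<open>i\<close> and \<open>j\<close>,
  \<open>norm_sum\<close> makes \<open>x\<close> non-isotropic and the two products different, and
  \<open>triple\<close> keeps the eigenvalues of the other coordinates away.\<close>

lemma regular_pair_cross:
  assumes ij: "i \<noteq> j" and \<epsilon>: "\<epsilon> \<in> {1, -1}" and x_def: "x = cross_point i j \<epsilon>"
  shows "lin x i * colin x i \<noteq> 0" "lin x j * colin x j \<noteq> 0"
    and "\<alpha> * \<alpha> * (lin x i * colin x i) + \<beta> * \<beta> * (lin x j * colin x j) = 0 \<Longrightarrow> \<alpha> \<noteq> 0 \<Longrightarrow> \<beta> \<noteq> 0 \<Longrightarrow>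
      regular_pair D x (\<alpha> *s axis i 1 + \<beta> *s axis j 1)"
proof -
  define d where "d = P i * R j - P j * R i"
  have d: "d \<noteq> 0" using det_nz[OF ij] by (simp add: d_def)
  have \<epsilon>2: "\<epsilon> * \<epsilon> = 1" "\<epsilon> \<noteq> 0" using \<epsilon> by auto
  have li: "lin x i = \<epsilon> * d" unfolding x_def cross_point_lin by (simp add: d_def algebra_simps)
  have lj: "lin x j = - d" unfolding x_def cross_point_lin by (simp add: d_def algebra_simps)
  have ci: "colin x i = - (P i * P i + R i * R i + \<epsilon> * (P i * P j + R i * R j))"
    by (simp add: x_def cross_point_def colin_def algebra_simps)
  have "colin x j = - (P j * P i + R j * R i + \<epsilon> * (P j * P j + R j * R j))"
    by (simp add: x_def cross_point_def colin_def algebra_simps)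
  also have "\<dots> = - (\<epsilon> * (P j * P j + R j * R j + \<epsilon> * (P j * P i + R j * R i)))"
    using \<epsilon>2 by (simp add: algebra_simps) (simp add: mult.assoc[symmetric])
  finally have cj: "colin x j = - (\<epsilon> * (P j * P j + R j * R j + \<epsilon> * (P j * P i + R j * R i)))" .
  show nzi: "lin x i * colin x i \<noteq> 0"
    using scal_norm[OF ij \<epsilon>] d \<epsilon>2 unfolding li ci mult_eq_0_iff neg_equal_0_iff_equal by blast
  show nzj: "lin x j * colin x j \<noteq> 0"
    using scal_norm[OF ij[symmetric] \<epsilon>] d \<epsilon>2 unfolding lj cj mult_eq_0_iff neg_equal_0_iff_equal by blast
  have N: "(R i + \<epsilon> * R j) * (R i + \<epsilon> * R j) + (P i + \<epsilon> * P j) * (P i + \<epsilon> * P j) \<noteq> 0"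
    using norm_sum[OF ij \<epsilon>] .
  assume minor: "\<alpha> * \<alpha> * (lin x i * colin x i) + \<beta> * \<beta> * (lin x j * colin x j) = 0"
    and \<alpha>\<beta>: "\<alpha> \<noteq> 0" "\<beta> \<noteq> 0"
  show "regular_pair D x (\<alpha> *s axis i 1 + \<beta> *s axis j 1)"
  proof (rule regular_pair_two[OF ij _ nzj minor \<alpha>\<beta>])
    show "lin x i * lin x i = lin x j * lin x j"
      using \<epsilon> by (auto simp: li lj)
    have "lin x i * colin x i - lin x j * colin x j =
       - (\<epsilon> * d * ((R i + \<epsilon> * R j) * (R i + \<epsilon> * R j) + (P i + \<epsilon> * P j) * (P i + \<epsilon> * P j)))"
      using \<epsilon> unfolding li lj ci cj by (auto simp: algebra_simps)
    then show "lin x i * colin x i \<noteq> lin x j * colin x j"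
      using N d \<epsilon>2 by (metis eq_iff_diff_eq_0 mult_eq_0_iff neg_equal_0_iff_equal)
    show "bil x x \<noteq> 0"
      using N by (simp add: bil_def sum_2 x_def cross_point_def algebra_simps)
    fix k assume k: "k \<noteq> i" "k \<noteq> j"
    define m where "m = (P i * R k - P k * R i) + \<epsilon> * (P j * R k - P k * R j)"
    have "m + \<epsilon>' * d \<noteq> 0" if "\<epsilon>' \<in> {1, -1}" for \<epsilon>'
      using triple[OF ij k[symmetric] \<epsilon> that] by (simp only: m_def d_def not_False_eq_True)
    from this[of 1] this[of "-1"] have "m + d \<noteq> 0" "m - d \<noteq> 0" by simp_all
    then have "(m + d) * (m - d) \<noteq> 0" by simp
    then have "m * m \<noteq> d * d" by (simp add: algebra_simps)
    moreover have "lin x k = - m" unfolding x_def cross_point_lin by (simp add: m_def)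
    moreover have "lin x i * lin x i = d * d" using \<epsilon> by (auto simp: li)
    ultimately show "lin x k * lin x k \<noteq> lin x i * lin x i" by simp
  qed
qed

lemma cross_coefficients:
  assumes "i \<noteq> j" "\<epsilon> \<in> {1, -1}" and x_def: "x = cross_point i j \<epsilon>"
  obtains \<alpha> \<beta> where "\<alpha> * \<alpha> * (lin x i * colin x i) + \<beta> * \<beta> * (lin x j * colin x j) = 0" "\<alpha> \<noteq> 0" "\<beta> \<noteq> 0"
proof -
  define u v where "u = lin x i * colin x i" and "v = lin x j * colin x j"
  have "u \<noteq> 0" "v \<noteq> 0"
    using regular_pair_cross(1,2)[OF assms] by (simp_all add: u_def v_def)
  show ?thesis
  \<comment> \<open>With these roots the weighted sum is \<open>v * u - u * v\<close>.\<close>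
  proof (rule that[of "csqrt v" "csqrt (- u)"])
    show "csqrt v * csqrt v * (lin x i * colin x i) + csqrt (- u) * csqrt (- u) * (lin x j * colin x j) = 0"
      by (simp add: u_def[symmetric] v_def[symmetric] flip: power2_eq_square)
  qed (use \<open>u \<noteq> 0\<close> \<open>v \<noteq> 0\<close> in simp_all)
qed

section \<open>Independence of the forms at the diagonal tensor\<close>

lemma gram_D: "gram D 1 1 j l = (if j = l then P j * P j else 0)" "gram D 1 2 j l = (if j = l then P j * R j else 0)"
  "gram D 2 1 j l = (if j = l then P j * R j else 0)" "gram D 2 2 j l = (if j = l then R j * R j else 0)"
proof -
  have s: "(\<Sum>k\<in>UNIV. (if k = \<iota> j then a else 0) * (if k = \<iota> l then b else 0)) = (if j = l then a * b else 0)" for a b :: complex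
  proof -
    have "(\<Sum>k\<in>UNIV. (if k = \<iota> j then a else 0) * (if k = \<iota> l then b else 0)) =
        (\<Sum>k\<in>UNIV. if k = \<iota> j then (if j = l then a * b else 0) else 0)"
      by (intro sum.cong refl) (auto simp: \<iota>_eq)
    then show ?thesis by simp
  qed
  show "gram D 1 1 j l = (if j = l then P j * P j else 0)" "gram D 1 2 j l = (if j = l then P j * R j else 0)"
    "gram D 2 1 j l = (if j = l then P j * R j else 0)" "gram D 2 2 j l = (if j = l then R j * R j else 0)"
    unfolding gram_def D_nth s by (simp_all add: mult.commute)
qed

lemma qcoeff_D: "j \<noteq> l \<Longrightarrow> qcoeff D s j l = 0" "qcoeff D 1 j j = P j * P j"
  by (simp_all add: qcoeff_def gram_D)

text \<open>In a relation, for each monomial of \<open>x\<close>, a skew matrix, a diagonal one from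
  \<open>form1\<close> and a product of \<open>N\<close> with a diagonal matrix cancel. The diagonal
  gives \<open>\<nu> = 0\<close>; the symmetric part off the diagonal gives \<open>N = 0\<close>,
  because the \<open>P i * P i\<close> are distinct.\<close>

lemma indep_family_forms_D:
  assumes e: "inj e"
  shows "indep_family (form_indices e) (forms D)"
  unfolding indep_family_def
proof (intro allI impI)
  fix c assume c: "(\<Sum>i\<in>form_indices e. c i *s forms D i) = 0"
  define \<nu> where "\<nu> = c (Inr (Inl ()))"
  define N where "N = skew_ext e (\<lambda>t. c (Inr (Inr t)))"
  define S where "S s = skew_ext e (\<lambda>t. c (Inl (s, t)))" for s
  have eq: "S s j l + \<nu> * form1 D $ (s, j, l) + (\<Sum>p\<in>UNIV. N p j * qcoeff D s p l) = 0" for s j l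
  proof -
    have sk: "skew_form s' p q $ (s, j, l) =
        (if s' = s then - ((if j = q then (if l = p then 1 else 0) else 0) - (if j = p then (if l = q then 1 else 0) else 0)) else 0)"
      for s' p q
      by (auto simp: skew_form_def axis_def)
    have "(\<Sum>u\<in>UNIV \<times> pairs e. c (Inl u) * forms D (Inl u) $ (s, j, l)) =
       (\<Sum>s'\<in>UNIV. \<Sum>t\<in>pairs e. c (Inl (s', t)) * forms D (Inl (s', t)) $ (s, j, l))"
      by (simp add: sum.cartesian_product)
    also have "\<dots> = (\<Sum>s'\<in>UNIV. if s' = s then
        - (\<Sum>(p, q)\<in>pairs e. c (Inl (s, (p, q))) * ((if j = q then (if l = p then 1 else 0) else 0) - (if j = p then (if l = q then 1 else 0) else 0))) else 0)"
    proof (intro sum.cong refl)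
      fix s'
      show "(\<Sum>t\<in>pairs e. c (Inl (s', t)) * forms D (Inl (s', t)) $ (s, j, l)) = (if s' = s then
        - (\<Sum>(p, q)\<in>pairs e. c (Inl (s, (p, q))) * ((if j = q then (if l = p then 1 else 0) else 0) - (if j = p then (if l = q then 1 else 0) else 0))) else 0)"
        by (cases "s' = s") (auto simp: forms_def sk sum_negf[symmetric] intro!: sum.cong sum.neutral)
    qed
    also have "\<dots> = - (\<Sum>p\<in>UNIV. S s p j * (if l = p then 1 else 0))"
      unfolding S_def sum_pairs[symmetric] by simp
    also have "\<dots> = S s j l"
      using skew_ext_swap[of e _ l j] by (simp add: S_def if_distrib cong: if_cong)
    finally have 1: "(\<Sum>u\<in>UNIV \<times> pairs e. c (Inl u) * forms D (Inl u) $ (s, j, l)) = S s j l" .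
    have "(\<Sum>t\<in>pairs e. c (Inr (Inr t)) * forms D (Inr (Inr t)) $ (s, j, l)) =
      (\<Sum>(p, q)\<in>pairs e. c (Inr (Inr (p, q))) * ((if j = q then qcoeff D s p l else 0) - (if j = p then qcoeff D s q l else 0)))"
      by (intro sum.cong refl) (auto simp: forms_def form2_def)
    also have "\<dots> = (\<Sum>p\<in>UNIV. N p j * qcoeff D s p l)"
      unfolding N_def by (rule sum_pairs)
    finally have 2: "(\<Sum>t\<in>pairs e. c (Inr (Inr t)) * forms D (Inr (Inr t)) $ (s, j, l)) = (\<Sum>p\<in>UNIV. N p j * qcoeff D s p l)" .
    have "0 = (\<Sum>i\<in>form_indices e. c i *s forms D i) $ (s, j, l)" by (simp add: c)
    also have "\<dots> = (\<Sum>u\<in>UNIV \<times> pairs e. c (Inl u) * forms D (Inl u) $ (s, j, l)) +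
        (\<nu> * forms D (Inr (Inl ())) $ (s, j, l) + (\<Sum>t\<in>pairs e. c (Inr (Inr t)) * forms D (Inr (Inr t)) $ (s, j, l)))"
      unfolding form_indices_def by (simp add: sum.Plus \<nu>_def)
    also have "\<dots> = S s j l + \<nu> * form1 D $ (s, j, l) + (\<Sum>p\<in>UNIV. N p j * qcoeff D s p l)"
      unfolding 1 2 by (simp add: forms_def)
    finally show ?thesis by simp
  qed
  have q: "(\<Sum>p\<in>UNIV. N p j * qcoeff D 1 p l) = N l j * (P l * P l)" for j l
  proof -
    have "(\<Sum>p\<in>UNIV. N p j * qcoeff D 1 p l) = (\<Sum>p\<in>UNIV. if p = l then N l j * (P l * P l) else 0)"
      by (intro sum.cong refl) (auto simp: qcoeff_D)
    then show ?thesis by simp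
  qed
  have f1: "form1 D $ (1, j, l) = (if j = l then - (P j * R j) else 0)" for j l
    by (simp add: form1_def gram_D)
  have diag: "S s j j = 0" "N j j = 0" for s j by (simp_all add: S_def N_def)
  have "\<nu> * - (P j * R j) = 0" for j
    using eq[of 1 j j] unfolding q f1 diag by simp
  from this[of undefined] have \<nu>: "\<nu> = 0" using P_nz R_nz by simp
  have N0: "N l j = 0" for j l
  proof (cases "j = l")
    case False
    have "S 1 j l + N l j * (P l * P l) = 0" "S 1 l j + N j l * (P j * P j) = 0"
      using eq[of 1 j l] eq[of 1 l j] unfolding q \<nu> by simp_all
    moreover have "S 1 l j = - S 1 j l" "N j l = - N l j"
      unfolding S_def N_def by (rule skew_ext_swap)+
    ultimately have "N l j * (P l * P l) - N l j * (P j * P j) = 0"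
      by (simp add: add_eq_0_iff)
    then have "N l j * (P l * P l - P j * P j) = 0" by (simp add: right_diff_distrib)
    then show ?thesis using P_sq[of l j] False by auto
  qed (simp add: diag)
  have S0: "S s j l = 0" for s j l
    using eq[of s j l] by (simp add: \<nu> N0)
  have "c i = 0" if i: "i \<in> form_indices e" for i
  proof -
    consider s t where "i = Inl (s, t)" "t \<in> pairs e" | "i = Inr (Inl ())" | t where "i = Inr (Inr t)" "t \<in> pairs e"
      using i by (auto simp: form_indices_def)
    then show ?thesis
    proof cases
      case (1 s t)
      have "skew_ext e (\<lambda>t. c (Inl (s, t))) = (\<lambda>_ _. 0)" using S0[of s] by (auto simp: S_def fun_eq_iff)
      from skew_ext_zeroD[OF this 1(2)] 1(1) show ?thesis by simp
    next
      case 2 then show ?thesis using \<nu> by (simp add: \<nu>_def)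
    next
      case 3
      have "skew_ext e (\<lambda>t. c (Inr (Inr t))) = (\<lambda>_ _. 0)" using N0 by (auto simp: N_def fun_eq_iff)
      from skew_ext_zeroD[OF this 3(2)] 3(1) show ?thesis by simp
    qed
  qed
  then show "\<forall>i\<in>form_indices e. c i = 0" by blast
qed

section \<open>The span of the regular Veronese points\<close>

definition regular_points :: "(complex ^ (3 \<times> 'n \<times> 'n)) set" where
  "regular_points = {veronese x y | x y. regular_pair D x y}"

definition qform :: "complex ^ (3 \<times> 'n \<times> 'n) \<Rightarrow> complex ^ 2 \<Rightarrow> 'n \<Rightarrow> 'n \<Rightarrow> complex" where
  "qform M x j l = M $ (1, j, l) * (x $ 1 * x $ 1) + M $ (2, j, l) * (x $ 1 * x $ 2) + M $ (3, j, l) * (x $ 2 * x $ 2)"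

lemma bil_veronese: "bil (veronese x y) M = (\<Sum>j\<in>UNIV. \<Sum>l\<in>UNIV. qform M x j l * (y $ j * y $ l))"
  by (simp add: bil_def sum_UNIV_prod sum_3 monom2_def qform_def sum.distrib algebra_simps)

lemma bil_veronese_axis: "bil (veronese x (axis i 1)) M = qform M x i i"
proof -
  have "bil (veronese x (axis i 1)) M = (\<Sum>j\<in>UNIV. if j = i then (\<Sum>l\<in>UNIV. if l = i then qform M x i i else 0) else 0)"
    unfolding bil_veronese by (intro sum.cong refl) (auto simp: axis_def if_distrib cong: if_cong)
  then show ?thesis by simp
qed

lemma bil_veronese_two:
  assumes "i \<noteq> j"
  shows "bil (veronese x (\<alpha> *s axis i 1 + \<beta> *s axis j 1)) M =
    \<alpha> * \<alpha> * qform M x i i + \<beta> * \<beta> * qform M x j j + \<alpha> * \<beta> * (qform M x i j + qform M x j i)"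
proof -
  define y where "y = \<alpha> *s axis i 1 + \<beta> *s axis j (1 :: complex)"
  have y: "y $ i = \<alpha>" "y $ j = \<beta>" "\<And>k. k \<noteq> i \<Longrightarrow> k \<noteq> j \<Longrightarrow> y $ k = 0"
    using assms by (auto simp: y_def axis_def)
  have s: "(\<Sum>k\<in>UNIV. f k) = f i + f j" if "\<And>k. k \<noteq> i \<Longrightarrow> k \<noteq> j \<Longrightarrow> f k = 0" for f :: "'n \<Rightarrow> complex"
  proof -
    have "(\<Sum>k\<in>UNIV. f k) = (\<Sum>k\<in>{i, j}. f k)"
      using that by (intro sum.mono_neutral_right) auto
    then show ?thesis using assms by simp
  qed
  have "(\<Sum>l\<in>UNIV. qform M x k l * (y $ k * y $ l)) = qform M x k i * (y $ k * \<alpha>) + qform M x k j * (y $ k * \<beta>)" for k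
    by (subst s) (simp_all add: y)
  then have "bil (veronese x y) M = (\<Sum>k\<in>UNIV. qform M x k i * (y $ k * \<alpha>) + qform M x k j * (y $ k * \<beta>))"
    by (simp add: bil_veronese)
  also have "\<dots> = \<alpha> * \<alpha> * qform M x i i + \<beta> * \<beta> * qform M x j j + \<alpha> * \<beta> * (qform M x i j + qform M x j i)"
    by (subst s) (simp_all add: y algebra_simps)
  finally show ?thesis by (simp add: y_def)
qed

text \<open>Each diagonal entry is a quadratic form in \<open>x\<close> with the kernel and the
  normal point as zeros, hence a multiple \<open>t i\<close> of \<open>lin * colin\<close>. The
  crossing points give \<open>t i = t j\<close> and two zeros of each symmetrised off-diagonal
  entry. Up to skew parts there remain one scalar for the diagonal and one for each pair of indices,
  exactly as many as there are forms for \<open>x\<close> and \<open>y\<close>.\<close>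

lemma annihilator_regular_points:
  assumes M: "M \<in> annihilator regular_points"
  obtains t where "\<And>i. M $ (1, i, i) = - t * (P i * R i)" "\<And>i. M $ (2, i, i) = - t * (R i * R i - P i * P i)"
    "\<And>i. M $ (3, i, i) = t * (P i * R i)"
    "\<And>i j s. i \<noteq> j \<Longrightarrow> M $ (1, i, j) + M $ (1, j, i) = 0 \<Longrightarrow> M $ (s, i, j) + M $ (s, j, i) = 0"
proof -
  have zero: "bil (veronese x y) M = 0" if "regular_pair D x y" for x y
    using that M by (auto simp: regular_points_def intro!: annihilatorD)
  have "\<exists>t. M $ (1, i, i) = t * (- P i * R i) \<and> M $ (2, i, i) = - t * (R i * R i + - P i * P i) \<and> M $ (3, i, i) = t * (R i * P i)" for i
  proof -
    have 1: "M $ (1, i, i) * (R i * R i) + M $ (2, i, i) * (R i * - P i) + M $ (3, i, i) * (- P i * - P i) = 0"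
      using zero[OF regular_pair_kernel[of i]] unfolding bil_veronese_axis qform_def vec2_nth .
    have 2: "M $ (1, i, i) * (P i * P i) + M $ (2, i, i) * (P i * R i) + M $ (3, i, i) * (R i * R i) = 0"
      using zero[OF regular_pair_normal[of i]] unfolding bil_veronese_axis qform_def vec2_nth .
    have 3: "- P i * R i \<noteq> 0" using P_nz R_nz by simp
    have 4: "R i * R i - - P i * P i \<noteq> 0" using norm_nz[of i] by (simp add: add.commute)
    from quadratic_two_zeros[OF 1 2 3 4] show ?thesis by metis
  qed
  then obtain t where t: "\<And>i. M $ (1, i, i) = t i * (- P i * R i)" "\<And>i. M $ (2, i, i) = - t i * (R i * R i + - P i * P i)"
    "\<And>i. M $ (3, i, i) = t i * (R i * P i)" by metis
  have qii: "qform M x i i = t i * (lin x i * colin x i)" for x i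
    unfolding qform_def t by (simp add: lin_def colin_def algebra_simps)
  have cross: "qform M x i j + qform M x j i = 0 \<and> t i = t j"
    if ij: "i \<noteq> j" and \<epsilon>: "\<epsilon> \<in> {1, -1}" and x: "x = cross_point i j \<epsilon>" for i j \<epsilon> x
  proof -
    obtain \<alpha> \<beta> where \<alpha>\<beta>: "\<alpha> * \<alpha> * (lin x i * colin x i) + \<beta> * \<beta> * (lin x j * colin x j) = 0" "\<alpha> \<noteq> 0" "\<beta> \<noteq> 0"
      using cross_coefficients[OF ij \<epsilon> x] by blast
    have p: "\<alpha> * \<alpha> * qform M x i i + \<beta> * \<beta> * qform M x j j + \<alpha> * \<beta> * (qform M x i j + qform M x j i) = 0"
      using zero[OF regular_pair_cross(3)[OF ij \<epsilon> x \<alpha>\<beta>]] unfolding bil_veronese_two[OF ij] .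
    \<comment> \<open>Changing the sign of \<open>\<beta>\<close> affects only the mixed term, so
      the diagonal and the off-diagonal contributions vanish separately.\<close>
    have "\<alpha> * \<alpha> * (lin x i * colin x i) + - \<beta> * - \<beta> * (lin x j * colin x j) = 0" "- \<beta> \<noteq> 0"
      using \<alpha>\<beta> by simp_all
    from zero[OF regular_pair_cross(3)[OF ij \<epsilon> x this(1) \<alpha>\<beta>(2) this(2)]]
    have n: "\<alpha> * \<alpha> * qform M x i i + \<beta> * \<beta> * qform M x j j - \<alpha> * \<beta> * (qform M x i j + qform M x j i) = 0"
      unfolding bil_veronese_two[OF ij] by simp
    have "2 * (\<alpha> * \<beta> * (qform M x i j + qform M x j i)) =
        (\<alpha> * \<alpha> * qform M x i i + \<beta> * \<beta> * qform M x j j + \<alpha> * \<beta> * (qform M x i j + qform M x j i)) -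
        (\<alpha> * \<alpha> * qform M x i i + \<beta> * \<beta> * qform M x j j - \<alpha> * \<beta> * (qform M x i j + qform M x j i))"
      by (simp only: mult_2) (simp only: algebra_simps)
    then have "2 * (\<alpha> * \<beta> * (qform M x i j + qform M x j i)) = 0" unfolding p n by simp
    then have off: "qform M x i j + qform M x j i = 0" using \<alpha>\<beta> by simp
    \<comment> \<open>The square of \<open>\<beta>\<close> is eliminated by the relation that
      defines the two coefficients.\<close>
    have "\<alpha> * \<alpha> * (lin x i * colin x i) * (t i - t j) =
      (\<alpha> * \<alpha> * qform M x i i + \<beta> * \<beta> * qform M x j j + \<alpha> * \<beta> * (qform M x i j + qform M x j i)) -
      t j * (\<alpha> * \<alpha> * (lin x i * colin x i) + \<beta> * \<beta> * (lin x j * colin x j))"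
      unfolding off qii by (simp add: algebra_simps)
    also have "\<dots> = 0" unfolding p \<alpha>\<beta>(1) by simp
    finally have "t i = t j" using \<alpha>\<beta>(2) regular_pair_cross(1)[OF ij \<epsilon> x] by simp
    with off show ?thesis by blast
  qed
  have t_eq: "t i = t undefined" for i
    using cross[of i undefined 1] by (cases "i = undefined") auto
  have offdiag: "M $ (s, i, j) + M $ (s, j, i) = 0"
    if ij: "i \<noteq> j" and first: "M $ (1, i, j) + M $ (1, j, i) = 0" for i j s
  proof -
    define r where "r s = M $ (s, i, j) + M $ (s, j, i)" for s
    have q: "r 1 * (x $ 1 * x $ 1) + r 2 * (x $ 1 * x $ 2) + r 3 * (x $ 2 * x $ 2) = qform M x i j + qform M x j i" for x
      by (simp add: r_def qform_def algebra_simps)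
    have 1: "r 1 * ((R i + R j) * (R i + R j)) + r 2 * ((R i + R j) * - (P i + P j)) + r 3 * (- (P i + P j) * - (P i + P j)) = 0"
      using q[of "cross_point i j 1"] cross[OF ij _ refl, of 1] by (simp add: cross_point_def)
    have 2: "r 1 * ((R i - R j) * (R i - R j)) + r 2 * ((R i - R j) * - (P i - P j)) + r 3 * (- (P i - P j) * - (P i - P j)) = 0"
      using q[of "cross_point i j (-1)"] cross[OF ij _ refl, of "-1"] by (simp add: cross_point_def)
    \<comment> \<open>Distinct squares keep the second coordinates of both zeros nonzero; for the
      same reason a vanishing first coefficient below forces \<open>u = 0\<close>.\<close>
    have p: "- (P i + P j) * - (P i - P j) \<noteq> 0"
      using P_sq[OF ij] by (simp add: algebra_simps add_eq_0_iff)
    have d: "(R i + R j) * - (P i - P j) - - (P i + P j) * (R i - R j) \<noteq> 0"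
    proof -
      have "(R i + R j) * - (P i - P j) - - (P i + P j) * (R i - R j) = - 2 * (P i * R j - P j * R i)"
        by (simp add: algebra_simps)
      then show ?thesis using det_nz[OF ij] by simp
    qed
    obtain u where u: "r 1 = u * (- (P i + P j) * - (P i - P j))"
      "r 2 = - u * ((R i + R j) * - (P i - P j) + - (P i + P j) * (R i - R j))" "r 3 = u * ((R i + R j) * (R i - R j))"
      using quadratic_two_zeros[OF 1 2 p d] by blast
    have "r 1 = 0" using first by (simp add: r_def)
    then have "u = 0" using u(1) p by (metis mult_eq_0_iff)
    then have "r s = 0" for s using u exhaust_3[of s] by auto
    then show ?thesis by (simp add: r_def)
  qed
  have "M $ (1, i, i) = - t undefined * (P i * R i)" "M $ (2, i, i) = - t undefined * (R i * R i - P i * P i)"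
    "M $ (3, i, i) = t undefined * (P i * R i)" for i
    unfolding t t_eq[of i] by simp_all
  then show ?thesis using offdiag by (rule that)
qed

text \<open>One vector is added for each form, chosen to detect what an annihilator of the regular
  points can still contain: upper entries, one diagonal entry, and symmetrised off-diagonal entries.
  Together they leave only 0, so at most \<open>card (form_indices e)\<close> dimensions are
  missing.\<close>

lemma dim_regular_points:
  fixes e :: "'n \<Rightarrow> nat"
  assumes e: "inj e"
  shows "CARD(3 \<times> 'n \<times> 'n) \<le> vec.dim regular_points + card (form_indices e)"
proof -
  define i0 :: 'n where "i0 = undefined"
  define \<phi> :: "'n form_index \<Rightarrow> complex ^ (3 \<times> 'n \<times> 'n)" where
    "\<phi> = case_sum (\<lambda>t. axis t 1) (case_sum (\<lambda>_. axis (1, i0, i0) 1) (\<lambda>(p, q). axis (1, p, q) 1 + axis (1, q, p) 1))"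
  have "annihilator (regular_points \<union> \<phi> ` form_indices e) \<subseteq> {0}"
  proof
    fix M assume M: "M \<in> annihilator (regular_points \<union> \<phi> ` form_indices e)"
    then have "M \<in> annihilator regular_points" by (auto simp: annihilator_def)
    then obtain t where t: "\<And>i. M $ (1, i, i) = - t * (P i * R i)" "\<And>i. M $ (2, i, i) = - t * (R i * R i - P i * P i)"
      "\<And>i. M $ (3, i, i) = t * (P i * R i)"
      "\<And>i j s. i \<noteq> j \<Longrightarrow> M $ (1, i, j) + M $ (1, j, i) = 0 \<Longrightarrow> M $ (s, i, j) + M $ (s, j, i) = 0"
      by (rule annihilator_regular_points) blast
    have z: "bil (\<phi> i) M = 0" if "i \<in> form_indices e" for i
      using M that by (auto simp: annihilator_def)
    have "M $ (1, i0, i0) = 0"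
      using z[of "Inr (Inl ())"] by (simp add: \<phi>_def form_indices_def bil_commute[of _ M] bil_axis_right InlI InrI)
    then have "t = 0" using t(1)[of i0] P_nz[of i0] R_nz[of i0] by simp
    then have diag: "M $ (s, i, i) = 0" for s i
      using t(1-3)[of i] exhaust_3[of s] by auto
    have upper: "M $ (s, p, q) = 0" if "e p < e q" for s p q
      using z[of "Inl (s, p, q)"] that
      by (simp add: \<phi>_def form_indices_def bil_commute[of _ M] bil_axis_right InlI InrI pairs_def)
    have sum0: "M $ (1, p, q) + M $ (1, q, p) = 0" if "e p < e q" for p q
      using z[of "Inr (Inr (p, q))"] that
      by (simp add: \<phi>_def form_indices_def bil_commute[of _ M] bil_axis_right bil_add_right InlI InrI pairs_def)
    have "M $ (s, p, q) = 0" for s p q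
    proof (cases "e p" "e q" rule: linorder_cases)
      case less then show ?thesis by (rule upper)
    next
      case equal
      then show ?thesis using e diag by (simp add: inj_eq)
    next
      case greater
      then have "q \<noteq> p" by auto
      from t(4)[OF this sum0[OF greater], of s] upper[OF greater, of s] show ?thesis by simp
    qed
    then show "M \<in> {0}" by (simp add: vec_eq_iff)
  qed
  then have "vec.span (regular_points \<union> \<phi> ` form_indices e) = UNIV"
    by (rule span_eq_UNIV_of_annihilator)
  then have "CARD(3 \<times> 'n \<times> 'n) = vec.dim (regular_points \<union> \<phi> ` form_indices e)"
    using vec_dim_card[where 'n = "3 \<times> 'n \<times> 'n" and 'a = complex] by (metis vec.dim_span)
  also have "\<dots> \<le> vec.dim regular_points + card (form_indices e)"
  proof -
    obtain B where B: "B \<subseteq> regular_points" "vec.independent B" "regular_points \<subseteq> vec.span B" "card B = vec.dim regular_points"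
      using vec.basis_exists by blast
    have fin: "finite B" using B(2) by (rule vec.finiteI_independent)
    have "vec.dim (regular_points \<union> \<phi> ` form_indices e) \<le> card (B \<union> \<phi> ` form_indices e)"
    proof (rule vec.dim_le_card)
      have "vec.span B \<subseteq> vec.span (B \<union> \<phi> ` form_indices e)" by (rule vec.span_mono) simp
      then show "regular_points \<union> \<phi> ` form_indices e \<subseteq> vec.span (B \<union> \<phi> ` form_indices e)"
        using B(3) by (auto intro: vec.span_base)
      show "finite (B \<union> \<phi> ` form_indices e)" using fin by simp
    qed
    also have "\<dots> \<le> card B + card (\<phi> ` form_indices e)" by (rule card_Un_le)
    also have "\<dots> \<le> card B + card (form_indices e)" by (simp add: card_image_le)
    finally show ?thesis by (simp add: B(4))
  qed
  finally show ?thesis .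
qed

end

subsection \<open>Persistence of regular critical pairs\<close>

lemma has_derivative_vec_lambda:
  fixes f :: "'a::real_normed_vector \<Rightarrow> 'i::finite \<Rightarrow> complex"
  assumes "\<And>k. ((\<lambda>x. f x k) has_derivative (\<lambda>h. f' h k)) (at a)"
  shows "((\<lambda>x. \<chi> k. f x k) has_derivative (\<lambda>h. \<chi> k. f' h k)) (at a)"
proof (rule has_derivative_componentwise_within[THEN iffD2], rule ballI)
  fix b :: "complex ^ 'i" assume "b \<in> Basis"
  then obtain k u where b: "b = axis k u" by (auto simp: Basis_vec_def)
  show "((\<lambda>x. (\<chi> k. f x k) \<bullet> b) has_derivative (\<lambda>h. (\<chi> k. f' h k) \<bullet> b)) (at a)"
    unfolding b by (simp add: inner_axis has_derivative_inner_left[OF assms])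
qed

lemma has_derivative_vec_nth:
  assumes "(g has_derivative g') F"
  shows "((\<lambda>x. g x $ k) has_derivative (\<lambda>h. g' h $ k)) F"
  using bounded_linear.has_derivative[OF bounded_linear_vec_nth assms] .

lemma has_derivative_trilinear_sum:
  fixes t x y :: "'a::real_normed_vector \<Rightarrow> 'i::finite \<Rightarrow> 'j::finite \<Rightarrow> complex"
  assumes "\<And>i j. ((\<lambda>p. t p i j) has_derivative (\<lambda>h. t' h i j)) (at a)"
    and "\<And>i j. ((\<lambda>p. x p i j) has_derivative (\<lambda>h. x' h i j)) (at a)"
    and "\<And>i j. ((\<lambda>p. y p i j) has_derivative (\<lambda>h. y' h i j)) (at a)"
  shows "((\<lambda>p. \<Sum>i\<in>UNIV. \<Sum>j\<in>UNIV. t p i j * x p i j * y p i j) has_derivative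
    (\<lambda>h. (\<Sum>i\<in>UNIV. \<Sum>j\<in>UNIV. t' h i j * x a i j * y a i j) + (\<Sum>i\<in>UNIV. \<Sum>j\<in>UNIV. t a i j * x' h i j * y a i j)
      + (\<Sum>i\<in>UNIV. \<Sum>j\<in>UNIV. t a i j * x a i j * y' h i j))) (at a)"
proof -
  have "((\<lambda>p. t p i j * x p i j * y p i j) has_derivative
     (\<lambda>h. t' h i j * x a i j * y a i j + t a i j * x' h i j * y a i j + t a i j * x a i j * y' h i j)) (at a)" for i j
  proof -
    have "((\<lambda>p. t p i j * x p i j * y p i j) has_derivative
       (\<lambda>h. t a i j * x a i j * y' h i j + (t a i j * x' h i j + t' h i j * x a i j) * y a i j)) (at a)"
      by (rule has_derivative_mult[OF has_derivative_mult[OF assms(1)[of i j] assms(2)[of i j]] assms(3)[of i j]])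
    moreover have "(\<lambda>h. t a i j * x a i j * y' h i j + (t a i j * x' h i j + t' h i j * x a i j) * y a i j) =
       (\<lambda>h. t' h i j * x a i j * y a i j + t a i j * x' h i j * y a i j + t a i j * x a i j * y' h i j)"
      by (rule ext) (simp only: algebra_simps)
    ultimately show ?thesis by (simp only:)
  qed
  then have "((\<lambda>p. \<Sum>i\<in>UNIV. \<Sum>j\<in>UNIV. t p i j * x p i j * y p i j) has_derivative
    (\<lambda>h. \<Sum>i\<in>UNIV. \<Sum>j\<in>UNIV. t' h i j * x a i j * y a i j + t a i j * x' h i j * y a i j + t a i j * x a i j * y' h i j)) (at a)"
    by (intro has_derivative_sum)
  then show ?thesis by (simp only: sum.distrib)
qed

lemma has_derivative_contract3:
  assumes "(T has_derivative T') (at a)" "(x has_derivative x') (at a)" "(y has_derivative y') (at a)"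
  shows "((\<lambda>p. contract3 (T p) (x p) (y p)) has_derivative
    (\<lambda>h. contract3 (T' h) (x a) (y a) + contract3 (T a) (x' h) (y a) + contract3 (T a) (x a) (y' h))) (at a)"
proof -
  note c = has_derivative_trilinear_sum[of "\<lambda>p i j. T p $ (i, j, k)" "\<lambda>h i j. T' h $ (i, j, k)" a
      "\<lambda>p i j. x p $ i" "\<lambda>h i j. x' h $ i" "\<lambda>p i j. y p $ j" "\<lambda>h i j. y' h $ j" for k,
      OF has_derivative_vec_nth[OF assms(1)] has_derivative_vec_nth[OF assms(2)] has_derivative_vec_nth[OF assms(3)]]
  have eq: "contract3 (T' h) (x a) (y a) + contract3 (T a) (x' h) (y a) + contract3 (T a) (x a) (y' h) =
     (\<chi> k. contract3 (T' h) (x a) (y a) $ k + contract3 (T a) (x' h) (y a) $ k + contract3 (T a) (x a) (y' h) $ k)" for h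
    by (simp add: vec_eq_iff)
  show ?thesis
    unfolding eq unfolding contract3_def vec_lambda_beta by (rule has_derivative_vec_lambda[OF c])
qed

lemma has_derivative_contract2:
  assumes "(T has_derivative T') (at a)" "(x has_derivative x') (at a)" "(y has_derivative y') (at a)"
  shows "((\<lambda>p. contract2 (T p) (x p) (y p)) has_derivative
    (\<lambda>h. contract2 (T' h) (x a) (y a) + contract2 (T a) (x' h) (y a) + contract2 (T a) (x a) (y' h))) (at a)"
proof -
  note c = has_derivative_trilinear_sum[of "\<lambda>p i k. T p $ (i, j, k)" "\<lambda>h i k. T' h $ (i, j, k)" a
      "\<lambda>p i k. x p $ i" "\<lambda>h i k. x' h $ i" "\<lambda>p i k. y p $ k" "\<lambda>h i k. y' h $ k" for j,
      OF has_derivative_vec_nth[OF assms(1)] has_derivative_vec_nth[OF assms(2)] has_derivative_vec_nth[OF assms(3)]]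
  have eq: "contract2 (T' h) (x a) (y a) + contract2 (T a) (x' h) (y a) + contract2 (T a) (x a) (y' h) =
     (\<chi> k. contract2 (T' h) (x a) (y a) $ k + contract2 (T a) (x' h) (y a) $ k + contract2 (T a) (x a) (y' h) $ k)" for h
    by (simp add: vec_eq_iff)
  show ?thesis
    unfolding eq unfolding contract2_def vec_lambda_beta by (rule has_derivative_vec_lambda[OF c])
qed

lemma has_derivative_contract1:
  assumes "(T has_derivative T') (at a)" "(x has_derivative x') (at a)" "(y has_derivative y') (at a)"
  shows "((\<lambda>p. contract1 (T p) (x p) (y p)) has_derivative
    (\<lambda>h. contract1 (T' h) (x a) (y a) + contract1 (T a) (x' h) (y a) + contract1 (T a) (x a) (y' h))) (at a)"
proof -
  note c = has_derivative_trilinear_sum[of "\<lambda>p j k. T p $ (i, j, k)" "\<lambda>h j k. T' h $ (i, j, k)" a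
      "\<lambda>p j k. x p $ j" "\<lambda>h j k. x' h $ j" "\<lambda>p j k. y p $ k" "\<lambda>h j k. y' h $ k" for i,
      OF has_derivative_vec_nth[OF assms(1)] has_derivative_vec_nth[OF assms(2)] has_derivative_vec_nth[OF assms(3)]]
  have eq: "contract1 (T' h) (x a) (y a) + contract1 (T a) (x' h) (y a) + contract1 (T a) (x a) (y' h) =
     (\<chi> k. contract1 (T' h) (x a) (y a) $ k + contract1 (T a) (x' h) (y a) $ k + contract1 (T a) (x a) (y' h) $ k)" for h
    by (simp add: vec_eq_iff)
  show ?thesis
    unfolding eq unfolding contract1_def vec_lambda_beta by (rule has_derivative_vec_lambda[OF c])
qed

lemma has_derivative_scalar_mult_vec:
  fixes m :: "'a::real_normed_vector \<Rightarrow> complex" and y :: "'a \<Rightarrow> complex ^ 'i::finite"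
  assumes "(m has_derivative m') (at a)" "(y has_derivative y') (at a)"
  shows "((\<lambda>p. m p *s y p) has_derivative (\<lambda>h. m' h *s y a + m a *s y' h)) (at a)"
proof -
  have "((\<lambda>p. m p *s y p) has_derivative (\<lambda>h. \<chi> k. m a * y' h $ k + m' h * y a $ k)) (at a)"
    unfolding vector_scalar_mult_def
    by (intro has_derivative_vec_lambda has_derivative_mult has_derivative_vec_nth assms)
  moreover have "(\<lambda>h. \<chi> k. m a * y' h $ k + m' h * y a $ k) = (\<lambda>h. m' h *s y a + m a *s y' h)"
    by (auto simp: vec_eq_iff)
  ultimately show ?thesis by simp
qed

lemma has_derivative_bil:
  assumes "(x has_derivative x') (at a)"
  shows "((\<lambda>p. bil c (x p)) has_derivative (\<lambda>h. bil c (x' h))) (at a)"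
  unfolding bil_def
  by (intro has_derivative_sum has_derivative_mult_right has_derivative_vec_nth assms)

lemma contract_zero [simp]: "contract1 0 y z = 0" "contract2 0 x z = 0" "contract3 0 x y = 0"
  by (simp_all add: contract1_def contract2_def contract3_def vec_eq_iff)

lemma contract_add_right:
  "contract1 T y (z + z') = contract1 T y z + contract1 T y z'"
  "contract2 T x (z + z') = contract2 T x z + contract2 T x z'"
  by (simp_all add: contract1_def contract2_def vec_eq_iff distrib_left sum.distrib)

text \<open>Fixing \<open>bil x0 x\<close> and one coordinate of \<open>y\<close> removes the
  scaling freedom, so there are as many equations as unknowns \<open>x\<close>, \<open>y\<close> and
  multiplier. Regularity makes the derivative injective, hence bijective, and openness of the image
  at one point yields nearby solutions for every nearby \<open>T\<close>.\<close>

lemma regular_pair_persists: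
  fixes T0 :: "complex ^ (2 \<times> 'n::finite \<times> 'k::finite)"
  assumes "regular_pair T0 x0 y0" and \<epsilon>: "\<epsilon> > 0"
  obtains U where "open U" "T0 \<in> U"
    "\<And>T. T \<in> U \<Longrightarrow> \<exists>x y. critical_pair T x y \<and> dist x x0 < \<epsilon> \<and> dist y y0 < \<epsilon>"
proof -
  define z0 where "z0 = contract3 T0 x0 y0"
  define g0 where "g0 = contract1 T0 y0 z0"
  have "\<exists>\<mu> i. contract2 T0 x0 z0 = \<mu> *s y0 \<and> g0 $ 1 * x0 $ 2 - g0 $ 2 * x0 $ 1 = 0 \<and>
     (\<forall>\<xi> \<eta> m.
        contract2 T0 \<xi> z0 + contract2 T0 x0 (contract3 T0 \<xi> y0) + contract2 T0 x0 (contract3 T0 x0 \<eta>)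
          = m *s y0 + \<mu> *s \<eta> \<longrightarrow>
        (let h = contract1 T0 \<eta> z0 + contract1 T0 y0 (contract3 T0 \<xi> y0) + contract1 T0 y0 (contract3 T0 x0 \<eta>)
         in (h $ 1 * x0 $ 2 + g0 $ 1 * \<xi> $ 2) - (h $ 2 * x0 $ 1 + g0 $ 2 * \<xi> $ 1) = 0) \<longrightarrow>
        bil x0 \<xi> = 0 \<longrightarrow> \<eta> $ i = 0 \<longrightarrow> \<xi> = 0 \<and> \<eta> = 0 \<and> m = 0)"
    using assms(1) unfolding regular_pair_def Let_def z0_def g0_def .
  then obtain \<mu> i where eig: "contract2 T0 x0 z0 = \<mu> *s y0" and minor: "g0 $ 1 * x0 $ 2 - g0 $ 2 * x0 $ 1 = 0"
    and inj: "\<And>\<xi> \<eta> m.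
        contract2 T0 \<xi> z0 + contract2 T0 x0 (contract3 T0 \<xi> y0) + contract2 T0 x0 (contract3 T0 x0 \<eta>)
          = m *s y0 + \<mu> *s \<eta> \<Longrightarrow>
        (let h = contract1 T0 \<eta> z0 + contract1 T0 y0 (contract3 T0 \<xi> y0) + contract1 T0 y0 (contract3 T0 x0 \<eta>)
         in (h $ 1 * x0 $ 2 + g0 $ 1 * \<xi> $ 2) - (h $ 2 * x0 $ 1 + g0 $ 2 * \<xi> $ 1) = 0) \<Longrightarrow>
        bil x0 \<xi> = 0 \<Longrightarrow> \<eta> $ i = 0 \<Longrightarrow> \<xi> = 0 \<and> \<eta> = 0 \<and> m = 0"
    by (elim exE conjE) (rule that, assumption, assumption, iprover)
  define t where "t p = fst p" for p :: "(complex ^ (2 \<times> 'n \<times> 'k)) \<times> (complex ^ 2) \<times> (complex ^ 'n) \<times> complex"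
  define x where "x p = fst (snd p)" for p :: "(complex ^ (2 \<times> 'n \<times> 'k)) \<times> (complex ^ 2) \<times> (complex ^ 'n) \<times> complex"
  define y where "y p = fst (snd (snd p))" for p :: "(complex ^ (2 \<times> 'n \<times> 'k)) \<times> (complex ^ 2) \<times> (complex ^ 'n) \<times> complex"
  define m where "m p = snd (snd (snd p))" for p :: "(complex ^ (2 \<times> 'n \<times> 'k)) \<times> (complex ^ 2) \<times> (complex ^ 'n) \<times> complex"
  define p0 where "p0 = (T0, x0, y0, \<mu>)"
  have p0: "t p0 = T0" "x p0 = x0" "y p0 = y0" "m p0 = \<mu>"
    by (simp_all add: p0_def t_def x_def y_def m_def)
  have dt: "(t has_derivative t) (at a)" and dx: "(x has_derivative x) (at a)"
    and dy: "(y has_derivative y) (at a)" and dm: "(m has_derivative m) (at a)" for a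
    unfolding t_def x_def y_def m_def
    by (intro has_derivative_fst has_derivative_snd has_derivative_ident)+
  define z where "z p = contract3 (t p) (x p) (y p)" for p
  define z' where "z' h = contract3 (t h) x0 y0 + contract3 T0 (x h) y0 + contract3 T0 x0 (y h)" for h
  define g where "g p = contract1 (t p) (y p) (z p)" for p
  define g' where "g' h = contract1 (t h) y0 z0 + contract1 T0 (y h) z0 + contract1 T0 y0 (z' h)" for h
  define c' where "c' h = contract2 (t h) x0 z0 + contract2 T0 (x h) z0 + contract2 T0 x0 (z' h)" for h
  have zp: "z p0 = z0" "g p0 = g0" by (simp_all add: z_def z0_def g_def g0_def p0)
  have dz: "(z has_derivative z') (at p0)"
    using has_derivative_contract3[OF dt dx dy, of p0] unfolding z_def z'_def p0 .
  have dg: "(g has_derivative g') (at p0)"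
    using has_derivative_contract1[OF dt dy dz] unfolding g_def g'_def p0 zp .
  have dc: "((\<lambda>p. contract2 (t p) (x p) (z p)) has_derivative c') (at p0)"
    using has_derivative_contract2[OF dt dx dz] unfolding c'_def p0 zp .
  \<comment> \<open>\<open>T\<close> itself is the first component, so a neighbourhood of the value
    at \<open>p0\<close> contains \<open>(T, 0, 0, 0)\<close> for all \<open>T\<close> near
    \<open>T0\<close>.\<close>
  define \<Phi> where "\<Phi> p = (t p,
      (\<chi> a :: 2. if a = 1 then g p $ 1 * x p $ 2 - g p $ 2 * x p $ 1 else bil x0 (x p) - bil x0 x0),
      contract2 (t p) (x p) (z p) - m p *s y p, y p $ i - y0 $ i)" for p
  define \<Phi>' where "\<Phi>' h = (t h,
      (\<chi> a :: 2. if a = 1 then (g0 $ 1 * x h $ 2 + g' h $ 1 * x0 $ 2) - (g0 $ 2 * x h $ 1 + g' h $ 2 * x0 $ 1) else bil x0 (x h)),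
      c' h - (m h *s y0 + \<mu> *s y h), y h $ i)" for h
  have d1: "((\<lambda>p. g p $ 1 * x p $ 2 - g p $ 2 * x p $ 1) has_derivative
      (\<lambda>h. (g0 $ 1 * x h $ 2 + g' h $ 1 * x0 $ 2) - (g0 $ 2 * x h $ 1 + g' h $ 2 * x0 $ 1))) (at p0)"
    using has_derivative_diff[OF
       has_derivative_mult[OF has_derivative_vec_nth[OF dg, of 1] has_derivative_vec_nth[OF dx, of 2]]
       has_derivative_mult[OF has_derivative_vec_nth[OF dg, of 2] has_derivative_vec_nth[OF dx, of 1]]]
    unfolding p0 zp .
  have d2: "((\<lambda>p. bil x0 (x p) - bil x0 x0) has_derivative (\<lambda>h. bil x0 (x h))) (at p0)"
    using has_derivative_diff[OF has_derivative_bil[OF dx] has_derivative_const] by simp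
  have d12: "((\<lambda>p. \<chi> a :: 2. if a = 1 then g p $ 1 * x p $ 2 - g p $ 2 * x p $ 1 else bil x0 (x p) - bil x0 x0) has_derivative
     (\<lambda>h. \<chi> a. if a = 1 then (g0 $ 1 * x h $ 2 + g' h $ 1 * x0 $ 2) - (g0 $ 2 * x h $ 1 + g' h $ 2 * x0 $ 1) else bil x0 (x h))) (at p0)"
  proof (rule has_derivative_vec_lambda)
    fix a :: 2
    show "((\<lambda>p. if a = 1 then g p $ 1 * x p $ 2 - g p $ 2 * x p $ 1 else bil x0 (x p) - bil x0 x0) has_derivative
     (\<lambda>h. if a = 1 then (g0 $ 1 * x h $ 2 + g' h $ 1 * x0 $ 2) - (g0 $ 2 * x h $ 1 + g' h $ 2 * x0 $ 1) else bil x0 (x h))) (at p0)"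
      using d1 d2 by (cases "a = 1") simp_all
  qed
  have d3: "((\<lambda>p. contract2 (t p) (x p) (z p) - m p *s y p) has_derivative (\<lambda>h. c' h - (m h *s y0 + \<mu> *s y h))) (at p0)"
    using has_derivative_diff[OF dc has_derivative_scalar_mult_vec[OF dm dy]] unfolding p0 .
  have d4: "((\<lambda>p. y p $ i - y0 $ i) has_derivative (\<lambda>h. y h $ i)) (at p0)"
    using has_derivative_diff[OF has_derivative_vec_nth[OF dy] has_derivative_const] by simp
  have d\<Phi>: "(\<Phi> has_derivative \<Phi>') (at p0)"
    unfolding \<Phi>_def \<Phi>'_def by (intro has_derivative_Pair dt d12 d3 d4)
  then have lin: "linear \<Phi>'" by (rule has_derivative_linear)
  have "inj \<Phi>'"
    unfolding linear_injective_0[OF lin]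
  proof (intro allI impI)
    fix h assume h: "\<Phi>' h = 0"
    then have th: "t h = 0" by (simp add: \<Phi>'_def zero_prod_def)
    have a: "(g0 $ 1 * x h $ 2 + g' h $ 1 * x0 $ 2) - (g0 $ 2 * x h $ 1 + g' h $ 2 * x0 $ 1) = 0" "bil x0 (x h) = 0"
      using h by (auto simp: \<Phi>'_def zero_prod_def vec_eq_iff forall_2)
    have b: "c' h = m h *s y0 + \<mu> *s y h" "y h $ i = 0"
      using h by (auto simp: \<Phi>'_def zero_prod_def)
    have "x h = 0 \<and> y h = 0 \<and> m h = 0"
    proof (rule inj)
      show "contract2 T0 (x h) z0 + contract2 T0 x0 (contract3 T0 (x h) y0) + contract2 T0 x0 (contract3 T0 x0 (y h))
          = m h *s y0 + \<mu> *s y h"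
        unfolding b(1)[symmetric] by (simp add: c'_def z'_def th contract_add_right)
      show "let k = contract1 T0 (y h) z0 + contract1 T0 y0 (contract3 T0 (x h) y0) + contract1 T0 y0 (contract3 T0 x0 (y h))
         in (k $ 1 * x0 $ 2 + g0 $ 1 * x h $ 2) - (k $ 2 * x0 $ 1 + g0 $ 2 * x h $ 1) = 0"
        using a(1) by (simp add: g'_def z'_def th contract_add_right Let_def algebra_simps)
    qed (use a b in simp_all)
    then show "h = 0" using th by (simp add: t_def x_def y_def m_def prod_eq_iff)
  qed
  then obtain \<Psi> where \<Psi>: "linear \<Psi>" "\<And>h. \<Phi>' (\<Psi> h) = h"
    using linear_injective_isomorphism[OF lin] by blast
  define N where "N = (UNIV :: (complex ^ (2 \<times> 'n \<times> 'k)) set) \<times> ball x0 \<epsilon> \<times> ball y0 \<epsilon> \<times> (UNIV :: complex set)"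
  have cont: "continuous_on UNIV \<Phi>"
  proof -
    have ct: "continuous_on UNIV t" "continuous_on UNIV x" "continuous_on UNIV y" "continuous_on UNIV m"
      unfolding t_def x_def y_def m_def by (intro continuous_intros)+
    have n: "continuous_on UNIV (\<lambda>p. f p $ k)" if "continuous_on UNIV f"
      for f :: "_ \<Rightarrow> complex ^ 'i" and k
      using that by (intro continuous_intros)
    have cz: "continuous_on UNIV z"
      unfolding z_def contract3_def by (intro continuous_intros ct)
    have cg: "continuous_on UNIV g"
      unfolding g_def contract1_def by (intro continuous_intros ct cz)
    have c12: "continuous_on UNIV (\<lambda>p. if a = 1 then g p $ 1 * x p $ 2 - g p $ 2 * x p $ 1 else bil x0 (x p) - bil x0 x0)" for a :: 2
      unfolding bil_def by (cases "a = 1") (auto intro!: continuous_intros ct cg)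
    show ?thesis
      unfolding \<Phi>_def contract2_def vector_scalar_mult_def by (intro continuous_intros ct cz c12)
  qed
  have "open N" unfolding N_def by (intro open_Times) auto
  then have int: "p0 \<in> interior N"
    using \<epsilon> by (simp add: interior_open N_def p0_def)
  have "\<Phi> p0 \<in> interior (\<Phi> ` N)"
  proof (rule sussmann_open_mapping[OF open_UNIV cont UNIV_I d\<Phi> _ _ subset_UNIV int])
    show "bounded_linear \<Psi>" using \<Psi>(1) by (simp add: linear_conv_bounded_linear)
    show "\<Phi>' \<circ> \<Psi> = id" using \<Psi>(2) by (simp add: fun_eq_iff)
  qed
  moreover have "\<Phi> p0 = (T0, 0, 0, 0)"
    using eig minor by (simp add: \<Phi>_def p0 zp vec_eq_iff)
  ultimately have "(T0, 0, 0, 0) \<in> interior (\<Phi> ` N)" by simp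
  moreover define U where "U = (\<lambda>T. (T, 0, 0, 0)) -` interior (\<Phi> ` N)"
  ultimately have "T0 \<in> U" by simp
  have "open U"
    unfolding U_def by (intro continuous_open_vimage open_interior) (auto intro!: continuous_intros)
  moreover note \<open>T0 \<in> U\<close>
  moreover have "\<exists>x y. critical_pair T x y \<and> dist x x0 < \<epsilon> \<and> dist y y0 < \<epsilon>" if "T \<in> U" for T
  proof -
    have "(T, 0, 0, 0) \<in> \<Phi> ` N" using that interior_subset unfolding U_def by blast
    then obtain p where p: "\<Phi> p = (T, 0, 0, 0)" "p \<in> N" by (metis imageE)
    have tp: "t p = T" and cp: "contract2 (t p) (x p) (z p) = m p *s y p"
      using p(1) unfolding \<Phi>_def by auto
    have "(\<chi> a :: 2. if a = 1 then g p $ 1 * x p $ 2 - g p $ 2 * x p $ 1 else bil x0 (x p) - bil x0 x0) $ 1 = 0"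
      using p(1) by (simp add: \<Phi>_def)
    then have mp: "g p $ 1 * x p $ 2 - g p $ 2 * x p $ 1 = 0" by simp
    have "minors_vanish (g p) (x p)"
      using mp unfolding minors_vanish_def forall_2 by (simp add: mult.commute)
    moreover have "minors_vanish (m p *s y p) (y p)"
      by (simp add: minors_vanish_def)
    ultimately have "critical_pair T (x p) (y p)"
      unfolding critical_pair_def by (simp add: g_def z_def tp flip: cp[unfolded z_def tp])
    moreover have "dist (x p) x0 < \<epsilon>" "dist (y p) y0 < \<epsilon>"
      using p(2) by (auto simp: N_def x_def y_def dist_commute)
    ultimately show ?thesis by blast
  qed
  ultimately show ?thesis by (rule that)
qed

subsection \<open>Critical pairs of a general tensor\<close>

text \<open>The expression is symmetric in \<open>X\<^sup>2\<close>, \<open>Y\<^sup>2\<close>, \<open>Z\<^sup>2\<close> and vanishes iff \<open>X \<plusminus> Y \<plusminus> Z = 0\<close> for some signs.\<close>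

lemma heron_nonzero:
  fixes X Y Z :: real
  assumes "0 < X" "0 < Z" "Z < Y - X"
  shows "(Z\<^sup>2 - X\<^sup>2 - Y\<^sup>2)\<^sup>2 - 4 * X\<^sup>2 * Y\<^sup>2 \<noteq> 0"
proof -
  have "Z\<^sup>2 < (Y - X)\<^sup>2" using assms by (intro power_strict_mono) auto
  then have 1: "2 * X * Y < X\<^sup>2 + Y\<^sup>2 - Z\<^sup>2" by (simp add: power2_diff algebra_simps)
  have "0 < 2 * X * Y" using assms by simp
  with 1 have "(2 * X * Y)\<^sup>2 < (X\<^sup>2 + Y\<^sup>2 - Z\<^sup>2)\<^sup>2" by (intro power_strict_mono) auto
  moreover have "(X\<^sup>2 + Y\<^sup>2 - Z\<^sup>2)\<^sup>2 = (Z\<^sup>2 - X\<^sup>2 - Y\<^sup>2)\<^sup>2"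
    by (simp add: power2_eq_square algebra_simps)
  ultimately show ?thesis by (simp add: power_mult_distrib)
qed

text \<open>The coefficients \<open>a\<close> grow slowly and \<open>b\<close> rapidly: in any
  triple the two minors with the largest index differ by more than the third minor, which excludes
  signed relations. As all entries are positive reals, the norm conditions follow from positivity
  and monotonicity.\<close>

lemma generic_lines_exist:
  fixes \<iota> :: "'n::finite \<Rightarrow> 'k::finite"
  assumes "inj \<iota>"
  obtains P R where "generic_lines P R \<iota>"
proof -
  obtain e :: "'n \<Rightarrow> nat" where e: "bij_betw e UNIV {..<CARD('n)}"
    using ex_bij_betw_finite_nat[of "UNIV :: 'n set"] by (auto simp: atLeast0LessThan)
  have e_less: "e j < CARD('n)" for j
    using e by (auto simp: bij_betw_def)
  have e_inj: "e j = e l \<longleftrightarrow> j = l" for j l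
    using e by (auto simp: bij_betw_def inj_eq)
  define n where "n = real CARD('n)"
  \<comment> \<open>\<open>C > 2 * n\<close> makes \<open>b k\<close> exceed
    \<open>2 * n * b j\<close> for \<open>e j < e k\<close>; in \<open>sorted\<close>,
    \<open>n * b j\<close> bounds both the third minor and the loss in the difference of the other
    two.\<close>
  define C where "C = 2 * n + 1"
  define a where "a i = real (e i) + 1" for i
  define b where "b i = C ^ e i" for i
  have n: "n \<ge> 1" by (simp add: n_def Suc_leI)
  have C: "C > 2 * n" "C > 1" using n by (simp_all add: C_def)
  have a1: "1 \<le> a i" "a i \<le> n" for i
    using e_less[of i] by (simp_all add: a_def n_def)
  have b1: "0 < b i" for i using C by (simp add: b_def)
  have a_less: "a i + 1 \<le> a j" if "e i < e j" for i j using that by (simp add: a_def)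
  have b_less: "C * b i \<le> b j" if "e i < e j" for i j
  proof -
    have "C ^ Suc (e i) \<le> C ^ e j" using that C by (intro power_increasing) auto
    then show ?thesis by (simp add: b_def)
  qed
  have b_less': "b i < b j" if "e i < e j" for i j
    using that C by (simp add: b_def)
  define \<Delta> where "\<Delta> i j = a i * b j - a j * b i" for i j
  have \<Delta>_pos: "0 < \<Delta> i j" "\<Delta> i j \<le> n * b j" if "e i < e j" for i j
  proof -
    have "a j * b i \<le> n * b i" using a1 b1[of i] by (intro mult_right_mono) auto
    also have "\<dots> < C * b i" using C n b1[of i] by (intro mult_strict_right_mono) auto
    also have "\<dots> \<le> b j" by (rule b_less[OF that])
    also have "\<dots> \<le> a i * b j" using a1[of i] b1[of j] by (simp add: mult_le_cancel_right1)
    finally show "0 < \<Delta> i j" by (simp add: \<Delta>_def)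
    have "a i * b j \<le> n * b j" using a1 b1[of j] by (intro mult_right_mono) auto
    moreover have "0 \<le> a j * b i" using a1[of j] b1[of i] by simp
    ultimately show "\<Delta> i j \<le> n * b j" by (simp add: \<Delta>_def)
  qed
  \<comment> \<open>In terms of squares the condition sees neither the signs nor the order of the
    three indices, so sorted triples suffice.\<close>
  define heron where "heron x y z = (z - x - y)\<^sup>2 - 4 * x * y" for x y z :: real
  have heron_sym: "heron y x z = heron x y z" "heron x z y = heron x y z" for x y z
    by (simp_all add: heron_def power2_eq_square algebra_simps)
  have \<Delta>_sq: "(\<Delta> j i)\<^sup>2 = (\<Delta> i j)\<^sup>2" for i j
    by (simp add: \<Delta>_def power2_commute)
  have sorted: "heron ((\<Delta> i k)\<^sup>2) ((\<Delta> j k)\<^sup>2) ((\<Delta> i j)\<^sup>2) \<noteq> 0" if ij: "e i < e j" and jk: "e j < e k" for i j k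
  proof -
    have "\<Delta> i j < \<Delta> j k - \<Delta> i k"
    proof -
      have "b k \<le> (a j - a i) * b k" using a_less[OF ij] b1[of k] by (simp add: mult_le_cancel_right1)
      moreover have "a k * (b j - b i) \<le> n * b j"
      proof -
        have "a k * (b j - b i) \<le> a k * b j" using a1[of k] b1[of i] by (intro mult_left_mono) auto
        also have "\<dots> \<le> n * b j" using a1 b1[of j] by (intro mult_right_mono) auto
        finally show ?thesis .
      qed
      moreover have "\<Delta> j k - \<Delta> i k = (a j - a i) * b k - a k * (b j - b i)"
        by (simp add: \<Delta>_def algebra_simps)
      moreover have "2 * n * b j < b k"
      proof -
        have "2 * n * b j < C * b j" using C b1[of j] by (intro mult_strict_right_mono) auto
        then show ?thesis using b_less[OF jk] by linarith
      qed
      ultimately show ?thesis using \<Delta>_pos(2)[OF ij] by linarith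
    qed
    then show ?thesis
      using heron_nonzero[of "\<Delta> i k" "\<Delta> i j" "\<Delta> j k"] \<Delta>_pos(1)[OF ij] \<Delta>_pos(1)[of i k] ij jk
      by (simp add: heron_def)
  qed
  have heron_nz: "heron ((\<Delta> i k)\<^sup>2) ((\<Delta> j k)\<^sup>2) ((\<Delta> i j)\<^sup>2) \<noteq> 0" if "i \<noteq> j" "i \<noteq> k" "j \<noteq> k" for i j k
  proof -
    have "e i \<noteq> e j" "e i \<noteq> e k" "e j \<noteq> e k" using that by (simp_all add: e_inj)
    then consider "e i < e j" "e j < e k" | "e i < e k" "e k < e j" | "e j < e i" "e i < e k"
      | "e j < e k" "e k < e i" | "e k < e i" "e i < e j" | "e k < e j" "e j < e i" by linarith
    then show ?thesis
      by cases (use sorted[of i j k] sorted[of i k j] sorted[of j i k] sorted[of j k i] sorted[of k i j] sorted[of k j i]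
        in \<open>simp_all add: heron_sym \<Delta>_sq\<close>)
  qed
  have real_triple: "\<Delta> i k + s * \<Delta> j k + s' * \<Delta> i j \<noteq> 0"
    if "i \<noteq> j" "i \<noteq> k" "j \<noteq> k" "s \<in> {1, -1}" "s' \<in> {1, -1}" for i j k s s'
  proof
    assume "\<Delta> i k + s * \<Delta> j k + s' * \<Delta> i j = 0"
    then have "s' * \<Delta> i j = - (\<Delta> i k + s * \<Delta> j k)" by simp
    then have "(s' * \<Delta> i j)\<^sup>2 = (- (\<Delta> i k + s * \<Delta> j k))\<^sup>2" by (rule arg_cong)
    then have "(s' * \<Delta> i j)\<^sup>2 = (\<Delta> i k + s * \<Delta> j k)\<^sup>2" by (simp only: power2_minus)
    moreover have "(s' * \<Delta> i j)\<^sup>2 = (\<Delta> i j)\<^sup>2" using that by (auto simp: power_mult_distrib)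
    moreover have "(\<Delta> i k + s * \<Delta> j k)\<^sup>2 = (\<Delta> i k)\<^sup>2 + (\<Delta> j k)\<^sup>2 + 2 * s * \<Delta> i k * \<Delta> j k"
      using that by (auto simp: power2_sum power2_diff)
    ultimately have eq: "(\<Delta> i j)\<^sup>2 - (\<Delta> i k)\<^sup>2 - (\<Delta> j k)\<^sup>2 = 2 * s * \<Delta> i k * \<Delta> j k" by simp
    have "heron ((\<Delta> i k)\<^sup>2) ((\<Delta> j k)\<^sup>2) ((\<Delta> i j)\<^sup>2) = 0"
      unfolding heron_def eq using that by (auto simp: power_mult_distrib)
    with heron_nz[OF that(1-3)] show False by simp
  qed
  have cross: "a i * a i + b i * b i + s * (a i * a j + b i * b j) \<noteq> 0" if ij: "i \<noteq> j" and s: "s \<in> {1, -1}" for i j s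
  proof -
    have eq: "a i * a i + b i * b i - (a i * a j + b i * b j) = a i * (a i - a j) + b i * (b i - b j)"
      by (simp add: algebra_simps)
    have "a i * a i + b i * b i - (a i * a j + b i * b j) \<noteq> 0"
    proof (cases "e i < e j")
      case True
      then have "a i * (a i - a j) < 0" "b i * (b i - b j) < 0"
        using a_less[OF True] b_less'[OF True] a1[of i] b1[of i] by (auto intro!: mult_pos_neg)
      then show ?thesis unfolding eq by linarith
    next
      case False
      then have lt: "e j < e i" using ij e_inj[of i j] by linarith
      then have "0 < a i * (a i - a j)" "0 < b i * (b i - b j)"
        using a_less[OF lt] b_less'[OF lt] a1[of i] b1[of i] by (auto intro!: mult_pos_pos)
      then show ?thesis unfolding eq by linarith
    qed
    moreover have "0 < a i * a i + b i * b i + (a i * a j + b i * b j)"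
      using a1[of i] a1[of j] b1[of i] b1[of j] by (intro add_pos_pos mult_pos_pos) auto
    ultimately show ?thesis using s by auto
  qed
  have a_ne: "a i \<noteq> a j" if "i \<noteq> j" for i j using that e_inj[of i j] by (simp add: a_def)
  have "generic_lines (\<lambda>i. complex_of_real (a i)) (\<lambda>i. complex_of_real (b i)) \<iota>"
  proof
    show "inj \<iota>" by (rule assms)
    fix i show "complex_of_real (a i) \<noteq> 0" "complex_of_real (b i) \<noteq> 0"
      using a1[of i] b1[of i] by auto
    have "0 < a i * a i + b i * b i" using a1[of i] b1[of i] by (intro add_pos_pos mult_pos_pos) auto
    then have "a i * a i + b i * b i \<noteq> 0" by (rule less_imp_neq[symmetric])
    then show "complex_of_real (a i) * complex_of_real (a i) + complex_of_real (b i) * complex_of_real (b i) \<noteq> 0"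
      unfolding of_real_mult[symmetric] of_real_add[symmetric] of_real_eq_0_iff .
  next
    fix i j :: 'n assume ij: "i \<noteq> j"
    have "a i * a i \<noteq> a j * a j"
      using a_ne[OF ij] a1[of i] a1[of j] by (simp add: square_eq_iff)
    then show "complex_of_real (a i) * complex_of_real (a i) \<noteq> complex_of_real (a j) * complex_of_real (a j)"
      by (simp flip: of_real_mult)
    have "\<Delta> i j \<noteq> 0"
    proof (cases "e i < e j")
      case True then show ?thesis using \<Delta>_pos by force
    next
      case False
      then have "e j < e i" using ij e_inj[of i j] by linarith
      then have "0 < \<Delta> j i" by (rule \<Delta>_pos)
      then show ?thesis by (simp add: \<Delta>_def)
    qed
    then show "complex_of_real (a i) * complex_of_real (b j) - complex_of_real (a j) * complex_of_real (b i) \<noteq> 0"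
      by (simp add: \<Delta>_def flip: of_real_mult of_real_diff)
  next
    fix i j :: 'n and \<epsilon> :: complex assume ij: "i \<noteq> j" and "\<epsilon> \<in> {1, -1}"
    then have "\<epsilon> = of_real 1 \<or> \<epsilon> = of_real (- 1)" by simp
    then obtain s :: real where s: "s \<in> {1, -1}" "\<epsilon> = of_real s" by blast
    show "complex_of_real (a i) * complex_of_real (a i) + complex_of_real (b i) * complex_of_real (b i) +
        \<epsilon> * (complex_of_real (a i) * complex_of_real (a j) + complex_of_real (b i) * complex_of_real (b j)) \<noteq> 0"
      using cross[OF ij s(1)] unfolding s(2) of_real_mult[symmetric] of_real_add[symmetric] of_real_eq_0_iff .
    have "a i + s * a j \<noteq> 0" using a_ne[OF ij] a1[of i] a1[of j] s(1) by auto
    then have "0 < (a i + s * a j)\<^sup>2" by simp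
    then have "0 < (a i + s * a j) * (a i + s * a j)" by (simp only: power2_eq_square)
    moreover have "0 \<le> (b i + s * b j) * (b i + s * b j)" by simp
    ultimately have "(b i + s * b j) * (b i + s * b j) + (a i + s * a j) * (a i + s * a j) \<noteq> 0" by linarith
    then show "(complex_of_real (b i) + \<epsilon> * complex_of_real (b j)) * (complex_of_real (b i) + \<epsilon> * complex_of_real (b j)) +
        (complex_of_real (a i) + \<epsilon> * complex_of_real (a j)) * (complex_of_real (a i) + \<epsilon> * complex_of_real (a j)) \<noteq> 0"
      unfolding s(2) of_real_mult[symmetric] of_real_add[symmetric] of_real_eq_0_iff .
  next
    fix i j k :: 'n and \<epsilon> \<epsilon>' :: complex
    assume ijk: "i \<noteq> j" "i \<noteq> k" "j \<noteq> k" and "\<epsilon> \<in> {1, -1}" "\<epsilon>' \<in> {1, -1}"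
    then have "\<epsilon> = of_real 1 \<or> \<epsilon> = of_real (- 1)" "\<epsilon>' = of_real 1 \<or> \<epsilon>' = of_real (- 1)" by simp_all
    then obtain s s' :: real where s: "s \<in> {1, -1}" "\<epsilon> = of_real s" "s' \<in> {1, -1}" "\<epsilon>' = of_real s'" by blast
    show "(complex_of_real (a i) * complex_of_real (b k) - complex_of_real (a k) * complex_of_real (b i)) +
        \<epsilon> * (complex_of_real (a j) * complex_of_real (b k) - complex_of_real (a k) * complex_of_real (b j)) +
        \<epsilon>' * (complex_of_real (a i) * complex_of_real (b j) - complex_of_real (a j) * complex_of_real (b i)) \<noteq> 0"
      using real_triple[OF ijk s(1) s(3)]
      unfolding s(2,4) \<Delta>_def of_real_mult[symmetric] of_real_add[symmetric] of_real_diff[symmetric] of_real_eq_0_iff .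
  qed
  then show ?thesis by (rule that)
qed

section \<open>Families of independent critical pairs\<close>

lemma indep_family_of_independent:
  fixes b :: "'a \<Rightarrow> complex ^ 'i"
  assumes "finite I" "inj_on b I" "vec.independent (b ` I)"
  shows "indep_family I b"
  unfolding indep_family_def
proof (intro allI impI ballI)
  fix c i assume c: "(\<Sum>i\<in>I. c i *s b i) = 0" and i: "i \<in> I"
  have "(\<Sum>v\<in>b ` I. c (the_inv_into I b v) *s v) = (\<Sum>i\<in>I. c i *s b i)"
    using assms(2) by (simp add: sum.reindex the_inv_into_f_f)
  then have "(\<Sum>v\<in>b ` I. c (the_inv_into I b v) *s v) = 0" using c by simp
  from vec.independentD[OF assms(3) finite_imageI[OF assms(1)] order_refl this imageI[OF i]]
  have "c (the_inv_into I b (b i)) = 0" .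
  then show "c i = 0" using assms(2) i by (simp add: the_inv_into_f_f)
qed

text \<open>The index set lies in a finite type, so that the pairs and a dual family together are
  finitely many complex unknowns.\<close>

definition many_critical_pairs ::
  "(3 \<times> 'n \<times> 'n) set \<Rightarrow> complex ^ (2 \<times> 'n::finite \<times> 'k::finite) \<Rightarrow> bool" where
  "many_critical_pairs I T \<longleftrightarrow> (\<exists>x y. (\<forall>i\<in>I. critical_pair T (x i) (y i)) \<and> indep_family I (\<lambda>i. veronese (x i) (y i)))"

lemma continuous_on_veronese: "continuous_on UNIV (\<lambda>p. veronese (fst p) (snd p))"
proof -
  have c1: "continuous_on UNIV (\<lambda>p :: (complex ^ 2) \<times> (complex ^ 'n). fst p $ i)"
    and c2: "continuous_on UNIV (\<lambda>p :: (complex ^ 2) \<times> (complex ^ 'n). snd p $ j)" for i j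
    by (intro continuous_intros)+
  have m: "continuous_on UNIV (\<lambda>p :: (complex ^ 2) \<times> (complex ^ 'n). monom2 (fst p) s)" for s
  proof -
    consider "s = 1" | "s = 2" | "s = 3" using exhaust_3[of s] by blast
    then show ?thesis
      by cases (simp_all add: monom2_def continuous_on_mult c1)
  qed
  show ?thesis
    unfolding veronese_def by (intro continuous_on_vec_lambda continuous_on_mult m c2)
qed

lemma many_critical_pairs_near_regular:
  fixes T0 :: "complex ^ (2 \<times> 'n::finite \<times> 'k::finite)"
  assumes reg: "\<And>i. i \<in> I \<Longrightarrow> regular_pair T0 (x0 i) (y0 i)"
    and ind: "indep_family I (\<lambda>i. veronese (x0 i) (y0 i))"
  obtains U where "open U" "T0 \<in> U" "\<And>T. T \<in> U \<Longrightarrow> many_critical_pairs I T"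
proof -
  obtain \<epsilon> where \<epsilon>: "\<epsilon> > 0" "\<And>w. (\<And>i. dist (w i) (veronese (x0 i) (y0 i)) < \<epsilon>) \<Longrightarrow> indep_family I w"
    using indep_family_open[OF ind] by blast
  have "\<exists>\<delta>>0. \<forall>x y. dist x (x0 i) < \<delta> \<longrightarrow> dist y (y0 i) < \<delta> \<longrightarrow> dist (veronese x y) (veronese (x0 i) (y0 i)) < \<epsilon>" for i
  proof -
    let ?S = "(\<lambda>p. veronese (fst p) (snd p)) -` ball (veronese (x0 i) (y0 i)) \<epsilon>"
    have "open ?S"
      by (rule continuous_open_vimage[OF open_ball])
        (use continuous_on_veronese continuous_on_eq_continuous_at[OF open_UNIV] in blast)
    moreover have "(x0 i, y0 i) \<in> ?S" using \<epsilon>(1) by simp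
    ultimately obtain A B where "open A" "open B" "(x0 i, y0 i) \<in> A \<times> B" "A \<times> B \<subseteq> ?S"
      by (rule open_prod_elim)
    then have AB: "open A" "open B" "x0 i \<in> A" "y0 i \<in> B" "A \<times> B \<subseteq> ?S" by auto
    obtain r where r: "r > 0" "ball (x0 i) r \<subseteq> A" using AB(1,3) by (rule openE)
    obtain s where s: "s > 0" "ball (y0 i) s \<subseteq> B" using AB(2,4) by (rule openE)
    have "dist (veronese x y) (veronese (x0 i) (y0 i)) < \<epsilon>" if "dist x (x0 i) < min r s" "dist y (y0 i) < min r s" for x y
    proof -
      have "x \<in> A" "y \<in> B" using that r(2) s(2) by (auto simp: dist_commute subset_iff)
      then have "(x, y) \<in> ?S" using AB(5) by blast
      then show ?thesis by (simp add: dist_commute)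
    qed
    then show ?thesis using r(1) s(1) by (intro exI[of _ "min r s"]) auto
  qed
  then obtain \<delta> where \<delta>: "\<And>i. \<delta> i > 0"
    "\<And>i x y. dist x (x0 i) < \<delta> i \<Longrightarrow> dist y (y0 i) < \<delta> i \<Longrightarrow> dist (veronese x y) (veronese (x0 i) (y0 i)) < \<epsilon>"
    by metis
  have "\<exists>U. open U \<and> T0 \<in> U \<and> (\<forall>T\<in>U. \<exists>x y. critical_pair T x y \<and> dist x (x0 i) < \<delta> i \<and> dist y (y0 i) < \<delta> i)" if "i \<in> I" for i
    using regular_pair_persists[OF reg[OF that] \<delta>(1)] by metis
  then obtain U where U: "\<And>i. i \<in> I \<Longrightarrow> open (U i)" "\<And>i. i \<in> I \<Longrightarrow> T0 \<in> U i"
    "\<And>i T. i \<in> I \<Longrightarrow> T \<in> U i \<Longrightarrow> \<exists>x y. critical_pair T x y \<and> dist x (x0 i) < \<delta> i \<and> dist y (y0 i) < \<delta> i"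
    by metis
  show ?thesis
  proof (rule that[of "\<Inter>i\<in>I. U i"])
    show "open (\<Inter>i\<in>I. U i)" using U(1) by (intro open_INT) auto
    show "T0 \<in> (\<Inter>i\<in>I. U i)" using U(2) by blast
    fix T assume T: "T \<in> (\<Inter>i\<in>I. U i)"
    then have "\<exists>x y. critical_pair T x y \<and> dist x (x0 i) < \<delta> i \<and> dist y (y0 i) < \<delta> i" if "i \<in> I" for i
      using U(3)[OF that, of T] that by blast
    then obtain x y where xy: "\<And>i. i \<in> I \<Longrightarrow> critical_pair T (x i) (y i)"
      "\<And>i. i \<in> I \<Longrightarrow> dist (x i) (x0 i) < \<delta> i" "\<And>i. i \<in> I \<Longrightarrow> dist (y i) (y0 i) < \<delta> i"
      by metis
    \<comment> \<open>Openness of independence asks for closeness at every index of the type;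
      outside \<open>I\<close> the original points are kept.\<close>
    have "indep_family I (\<lambda>i. if i \<in> I then veronese (x i) (y i) else veronese (x0 i) (y0 i))"
      using \<epsilon> \<delta>(2) xy by (intro \<epsilon>(2)) auto
    moreover have "(\<Sum>i\<in>I. c i *s (if i \<in> I then veronese (x i) (y i) else veronese (x0 i) (y0 i))) = (\<Sum>i\<in>I. c i *s veronese (x i) (y i))" for c
      by (rule sum.cong) auto
    ultimately have "indep_family I (\<lambda>i. veronese (x i) (y i))"
      unfolding indep_family_def by simp
    with xy(1) show "many_critical_pairs I T" unfolding many_critical_pairs_def by blast
  qed
qed

text \<open>Criticality is given by equations in \<open>T\<close>, \<open>x\<close> and
  \<open>y\<close>, and independence by the equations of a dual family \<open>r\<close>. So the
  property is a projection of an algebraic set, and the Euclidean open set decides which alternative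
  holds generically.\<close>

lemma for_general_many_critical_pairs:
  fixes T0 :: "complex ^ (2 \<times> 'n::finite \<times> 'k::finite)" and I :: "(3 \<times> 'n \<times> 'n) set"
  assumes U: "open U" "T0 \<in> U" "\<And>T. T \<in> U \<Longrightarrow> many_critical_pairs I T"
  shows "for_general (many_critical_pairs I :: complex ^ (2 \<times> 'n \<times> 'k) \<Rightarrow> bool)"
proof -
  define t where "t w = (\<chi> p. w (Inl p))"
    for w :: "(2 \<times> 'n \<times> 'k) + (((3 \<times> 'n \<times> 'n) \<times> (2 + 'n)) + ((3 \<times> 'n \<times> 'n) \<times> (3 \<times> 'n \<times> 'n))) \<Rightarrow> complex"
  define x where "x w i = (\<chi> a. w (Inr (Inl (i, Inl a))))"
    for w :: "(2 \<times> 'n \<times> 'k) + (((3 \<times> 'n \<times> 'n) \<times> (2 + 'n)) + ((3 \<times> 'n \<times> 'n) \<times> (3 \<times> 'n \<times> 'n))) \<Rightarrow> complex" and i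
  define y where "y w i = (\<chi> j. w (Inr (Inl (i, Inr j))))"
    for w :: "(2 \<times> 'n \<times> 'k) + (((3 \<times> 'n \<times> 'n) \<times> (2 + 'n)) + ((3 \<times> 'n \<times> 'n) \<times> (3 \<times> 'n \<times> 'n))) \<Rightarrow> complex" and i
  define r where "r w i = (\<chi> s. w (Inr (Inr (i, s))))"
    for w :: "(2 \<times> 'n \<times> 'k) + (((3 \<times> 'n \<times> 'n) \<times> (2 + 'n)) + ((3 \<times> 'n \<times> 'n) \<times> (3 \<times> 'n \<times> 'n))) \<Rightarrow> complex" and i
  have pt: "(\<lambda>w. t w $ p) \<in> polys" and px: "(\<lambda>w. x w i $ a) \<in> polys" and py: "(\<lambda>w. y w i $ j) \<in> polys"
    and pr: "(\<lambda>w. r w i $ s) \<in> polys" for p i a j s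
    by (simp_all add: t_def x_def y_def r_def polys_var)
  have pz: "(\<lambda>w. contract3 (t w) (x w i) (y w i) $ k) \<in> polys" for i k
    unfolding contract3_def vec_lambda_beta by (intro polys_sum polys_mult pt px py)
  have pg: "(\<lambda>w. contract1 (t w) (y w i) (contract3 (t w) (x w i) (y w i)) $ a) \<in> polys" for i a
    unfolding contract1_def vec_lambda_beta by (intro polys_sum polys_mult pt pz py)
  have ph: "(\<lambda>w. contract2 (t w) (x w i) (contract3 (t w) (x w i) (y w i)) $ j) \<in> polys" for i j
    unfolding contract2_def vec_lambda_beta by (intro polys_sum polys_mult pt pz px)
  have pm: "(\<lambda>w. monom2 (x w i) s) \<in> polys" for i s
    unfolding monom2_def by (cases "s = 1"; cases "s = 2") (auto intro!: polys_mult px)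
  have pv: "(\<lambda>w. veronese (x w i) (y w i) $ s) \<in> polys" for i s
    unfolding veronese_def vec_lambda_beta by (intro polys_mult pm py)
  have pb: "(\<lambda>w. bil (r w i) (veronese (x w j) (y w j))) \<in> polys" for i j
    unfolding bil_def by (intro polys_sum polys_mult pr pv)
  define S1 where "S1 i = (\<Inter>p. \<Inter>q. {w. contract1 (t w) (y w i) (contract3 (t w) (x w i) (y w i)) $ p * x w i $ q -
      contract1 (t w) (y w i) (contract3 (t w) (x w i) (y w i)) $ q * x w i $ p = 0})" for i
  define S2 where "S2 i = (\<Inter>p. \<Inter>q. {w. contract2 (t w) (x w i) (contract3 (t w) (x w i) (y w i)) $ p * y w i $ q -
      contract2 (t w) (x w i) (contract3 (t w) (x w i) (y w i)) $ q * y w i $ p = 0})" for i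
  define S3 where "S3 i = (\<Inter>j\<in>I. {w. bil (r w i) (veronese (x w j) (y w j)) - (if i = j then 1 else 0) = 0})" for i
  define S where "S = (\<Inter>i\<in>I. S1 i \<inter> S2 i \<inter> S3 i)"
  have "S1 i \<in> constructible" "S2 i \<in> constructible" "S3 i \<in> constructible" for i
    unfolding S1_def S2_def S3_def
    by (intro constructible_INT constructible_zeros polys_diff polys_mult pg ph px py pb polys_const finite)+
  then have S: "S \<in> constructible"
    unfolding S_def by (intro constructible_INT constructible_Int finite)
  have mem: "w \<in> S \<longleftrightarrow> (\<forall>i\<in>I. critical_pair (t w) (x w i) (y w i)) \<and>
      (\<forall>i\<in>I. \<forall>j\<in>I. bil (r w i) (veronese (x w j) (y w j)) = (if i = j then 1 else 0))" for w
    unfolding S_def S1_def S2_def S3_def critical_pair_def minors_vanish_def by auto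
  show ?thesis
  proof (rule for_general_of_constructible[OF S _ U])
    fix T :: "complex ^ (2 \<times> 'n \<times> 'k)"
    show "many_critical_pairs I T \<longleftrightarrow> (\<exists>w. (\<forall>p. w (Inl p) = T $ p) \<and> w \<in> S)"
    proof
      assume "many_critical_pairs I T"
      then obtain x' y' where xy: "\<And>i. i \<in> I \<Longrightarrow> critical_pair T (x' i) (y' i)"
        "indep_family I (\<lambda>i. veronese (x' i) (y' i))"
        unfolding many_critical_pairs_def by blast
      obtain r' where r': "\<And>i j. i \<in> I \<Longrightarrow> j \<in> I \<Longrightarrow> bil (r' i) (veronese (x' j) (y' j)) = (if i = j then 1 else 0)"
        using indep_family_dual[OF finite xy(2)] by blast
      define w where "w = case_sum (($) T) (case_sum (\<lambda>(i, c). case_sum (($) (x' i)) (($) (y' i)) c) (\<lambda>(i, s). r' i $ s))"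
      have "t w = T" "\<And>i. x w i = x' i" "\<And>i. y w i = y' i" "\<And>i. r w i = r' i"
        by (simp_all add: t_def x_def y_def r_def w_def vec_eq_iff)
      then have "w \<in> S" using xy(1) r' by (simp add: mem)
      moreover have "\<forall>p. w (Inl p) = T $ p" by (simp add: w_def)
      ultimately show "\<exists>w. (\<forall>p. w (Inl p) = T $ p) \<and> w \<in> S" by blast
    next
      assume "\<exists>w. (\<forall>p. w (Inl p) = T $ p) \<and> w \<in> S"
      then obtain w where w: "\<forall>p. w (Inl p) = T $ p" "w \<in> S" by blast
      have "t w = T" using w(1) by (simp add: t_def vec_eq_iff)
      then have "\<forall>i\<in>I. critical_pair T (x w i) (y w i)" using w(2) mem by blast
      moreover have "indep_family I (\<lambda>i. veronese (x w i) (y w i))"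
        using w(2) mem by (intro indep_family_of_dual[of I "r w"]) auto
      ultimately show "many_critical_pairs I T"
        unfolding many_critical_pairs_def by (intro exI[of _ "x w"] exI[of _ "y w"]) simp
    qed
  qed
qed

subsection \<open>The span of the singular triples\<close>

lemma for_general_forms_indep:
  fixes e :: "'n::finite \<Rightarrow> nat"
  assumes "inj e" "generic_lines P R (\<iota> :: 'n \<Rightarrow> 'k::finite)"
  shows "for_general (\<lambda>T :: complex ^ (2 \<times> 'n \<times> 'k). indep_family (form_indices e) (forms T))"
proof -
  interpret generic_lines P R \<iota> by (rule assms(2))
  have gram: "polynomial_fun (\<lambda>T :: complex ^ (2 \<times> 'n \<times> 'k). gram T a b j l)" for a b j l
    unfolding gram_def by (intro polynomial_fun_sum polynomial_fun_mult polynomial_fun_nth)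
  have qcoeff: "polynomial_fun (\<lambda>T :: complex ^ (2 \<times> 'n \<times> 'k). qcoeff T s j l)" for s j l
    unfolding qcoeff_def by (intro polynomial_fun_if polynomial_fun_add gram)
  have "polynomial_fun (\<lambda>T :: complex ^ (2 \<times> 'n \<times> 'k). forms T i $ t)" for i t
  proof -
    obtain s j l where t: "t = (s, j, l)" by (cases t) auto
    show ?thesis
    proof (cases i)
      case (Inl a)
      then show ?thesis by (simp add: forms_def polynomial_fun_const)
    next
      case (Inr b)
      show ?thesis
      proof (cases b)
        case (Inl c)
        then show ?thesis
          by (simp add: Inr forms_def form1_def t)
            (intro polynomial_fun_if polynomial_fun_diff polynomial_fun_uminus gram)
      next
        case (Inr c)
        obtain p q where "c = (p, q)" by (cases c)
        then show ?thesis
          by (simp add: \<open>i = Inr b\<close> Inr forms_def form2_def t)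
            (intro polynomial_fun_if polynomial_fun_diff polynomial_fun_const qcoeff)
      qed
    qed
  qed
  then show ?thesis
    by (rule for_general_indep_family) (rule indep_family_forms_D[OF assms(1)])
qed

text \<open>The dimension bound at the diagonal tensor supplies as many independent regular points
  as the forms leave dimensions; being finitely many, they persist on a common
  neighbourhood.\<close>

lemma for_general_many_critical_pairs_exists:
  fixes e :: "'n::finite \<Rightarrow> nat"
  assumes "inj e" "generic_lines P R (\<iota> :: 'n \<Rightarrow> 'k::finite)"
  obtains I :: "(3 \<times> 'n \<times> 'n) set"
  where "card I + card (form_indices e) = CARD(3 \<times> 'n \<times> 'n)"
    "for_general (many_critical_pairs I :: complex ^ (2 \<times> 'n \<times> 'k) \<Rightarrow> bool)"
proof -
  interpret generic_lines P R \<iota> by (rule assms(2))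
  define d where "d = CARD(3 \<times> 'n \<times> 'n) - card (form_indices e)"
  have le: "card (form_indices e) \<le> CARD(3 \<times> 'n \<times> 'n)"
  proof -
    have "finite (form_indices e)" by (simp add: form_indices_def)
    from dim_annihilator_family[OF this indep_family_forms_D[OF assms(1)]] show ?thesis by linarith
  qed
  obtain B where B: "B \<subseteq> regular_points" "vec.independent B" "regular_points \<subseteq> vec.span B"
    "card B = vec.dim regular_points"
    using vec.basis_exists by blast
  have "d \<le> card B" using dim_regular_points[OF assms(1)] by (simp add: d_def B(4))
  then obtain B' where B': "B' \<subseteq> B" "card B' = d" by (metis obtain_subset_with_card_n)
  have ind: "vec.independent B'" using vec.independent_mono[OF B(2) B'(1)] .
  then have fin: "finite B'" by (rule vec.finiteI_independent)
  have "d \<le> CARD(3 \<times> 'n \<times> 'n)" by (simp only: d_def diff_le_self)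
  then obtain I :: "(3 \<times> 'n \<times> 'n) set" where I: "card I = d"
    by (metis obtain_subset_with_card_n)
  then obtain b where b: "bij_betw b I B'"
    using B'(2) fin by (metis finite finite_same_card_bij)
  have "\<exists>x y. regular_pair D x y \<and> b i = veronese x y" if "i \<in> I" for i
  proof -
    have "b i \<in> regular_points" using that b B' B(1) by (auto simp: bij_betw_def)
    then show ?thesis by (auto simp: regular_points_def)
  qed
  then obtain x y where xy: "\<And>i. i \<in> I \<Longrightarrow> regular_pair D (x i) (y i)" "\<And>i. i \<in> I \<Longrightarrow> b i = veronese (x i) (y i)"
    by metis
  have "indep_family I b"
    using b ind by (intro indep_family_of_independent) (auto simp: bij_betw_def)
  moreover have "(\<Sum>i\<in>I. c i *s b i) = (\<Sum>i\<in>I. c i *s veronese (x i) (y i))" for c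
    by (rule sum.cong) (simp_all add: xy(2))
  ultimately have "indep_family I (\<lambda>i. veronese (x i) (y i))"
    unfolding indep_family_def by simp
  from many_critical_pairs_near_regular[OF xy(1) this]
  obtain U where "open U" "D \<in> U" "\<And>T. T \<in> U \<Longrightarrow> many_critical_pairs I T" by blast
  then have "for_general (many_critical_pairs I :: complex ^ (2 \<times> 'n \<times> 'k) \<Rightarrow> bool)"
    by (rule for_general_many_critical_pairs)
  moreover have "card I + card (form_indices e) = CARD(3 \<times> 'n \<times> 'n)"
    using le by (simp add: I d_def)
  ultimately show ?thesis using that by blast
qed

lemma minors_vanish_parallel:
  assumes "minors_vanish u v" "u \<noteq> 0"
  obtains c where "v = c *s u"
proof -
  obtain p where p: "u $ p \<noteq> 0" using assms(2) by (metis vec_eq_iff zero_index)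
  have "v $ q = v $ p / u $ p * u $ q" for q
  proof -
    have "u $ p * v $ q = u $ q * v $ p" using assms(1) by (simp add: minors_vanish_def)
    then show ?thesis using p by (simp add: field_simps)
  qed
  then have "v = (v $ p / u $ p) *s u" unfolding vec_eq_iff vector_smult_component by blast
  then show ?thesis by (rule that)
qed

lemma minors_vanish_scale:
  assumes "minors_vanish (c *s u) v" "c \<noteq> 0"
  shows "minors_vanish u v"
  unfolding minors_vanish_def
proof (intro allI)
  fix p q
  have "c * (u $ p * v $ q - u $ q * v $ p) = 0"
    using assms(1) by (auto simp: minors_vanish_def algebra_simps)
  then show "u $ p * v $ q - u $ q * v $ p = 0" using assms(2) by simp
qed

lemma minors_vanish_self_scale: "minors_vanish u (c *s u)"
  by (simp add: minors_vanish_def)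

lemma contract_scale_right:
  "contract1 T y (c *s z) = c *s contract1 T y z" "contract2 T x (c *s z) = c *s contract2 T x z"
  by (simp_all add: contract1_def contract2_def vec_eq_iff sum_distrib_left mult_ac)

lemma tensor3_nth [simp]: "tensor3 x y z $ (i, j, k) = x $ i * y $ j * z $ k"
  by (simp add: tensor3_def)

lemma tensor3_scale: "tensor3 x y (c *s z) = c *s tensor3 x y z"
  by (auto simp: vec_eq_iff)

lemma tensor3_zero [simp]: "tensor3 0 y z = 0" "tensor3 x 0 z = 0"
  by (auto simp: vec_eq_iff)

lemma tensor3_nonzero:
  assumes "x \<noteq> 0" "y \<noteq> 0" "z \<noteq> 0"
  shows "tensor3 x y z \<noteq> 0"
proof -
  obtain i j k where "x $ i \<noteq> 0" "y $ j \<noteq> 0" "z $ k \<noteq> 0"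
    using assms by (metis vec_eq_iff zero_index)
  then have "tensor3 x y z $ (i, j, k) \<noteq> 0" by simp
  then show ?thesis by (metis zero_index)
qed

lemma veronese_nonzero:
  assumes "x \<noteq> 0" "y \<noteq> 0"
  shows "veronese x y \<noteq> 0"
proof -
  obtain i j where ij: "x $ i \<noteq> 0" "y $ j \<noteq> 0"
    using assms by (metis vec_eq_iff zero_index)
  have "veronese x y $ (monom2_index i i, j, j) \<noteq> 0"
    using ij by (simp add: monom2_index)
  then show ?thesis by (metis zero_index)
qed

lemma tensor3_critical:
  assumes "singular_triple T x y z"
  shows "tensor3 x y z \<in> critical_space T"
proof -
  have m: "minors_vanish (contract1 T y z) x" "minors_vanish (contract2 T x z) y" "minors_vanish (contract3 T x y) z"
    using assms by (simp_all add: singular_triple_def)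
  have "(\<Sum>j\<in>UNIV. \<Sum>k\<in>UNIV. T $ (p, j, k) * tensor3 x y z $ (q, j, k) - T $ (q, j, k) * tensor3 x y z $ (p, j, k))
      = contract1 T y z $ p * x $ q - contract1 T y z $ q * x $ p" for p q
    by (simp add: contract1_def sum_subtractf sum_distrib_right sum_distrib_left mult_ac)
  moreover have "(\<Sum>i\<in>UNIV. \<Sum>k\<in>UNIV. T $ (i, p, k) * tensor3 x y z $ (i, q, k) - T $ (i, q, k) * tensor3 x y z $ (i, p, k))
      = contract2 T x z $ p * y $ q - contract2 T x z $ q * y $ p" for p q
    by (simp add: contract2_def sum_subtractf sum_distrib_right sum_distrib_left mult_ac)
  moreover have "(\<Sum>i\<in>UNIV. \<Sum>j\<in>UNIV. T $ (i, j, p) * tensor3 x y z $ (i, j, q) - T $ (i, j, q) * tensor3 x y z $ (i, j, p))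
      = contract3 T x y $ p * z $ q - contract3 T x y $ q * z $ p" for p q
    by (simp add: contract3_def sum_subtractf sum_distrib_right sum_distrib_left mult_ac)
  ultimately show ?thesis using m by (simp add: critical_space_def minors_vanish_def)
qed

section \<open>Projective spans and dimensions\<close>

lemma projectivization_mono: "W \<subseteq> W' \<Longrightarrow> projectivization W \<subseteq> projectivization W'"
  by (auto simp: projectivization_def)

text \<open>As \<open>S\<close> avoids 0, a subspace contains \<open>S\<close> iff its
  projectivization contains the points of \<open>S\<close>; among these subspaces the linear span is
  the least.\<close>

lemma proj_span_points:
  assumes "0 \<notin> S"
  shows "proj_span (proj_point ` S) = projectivization (vec.span S)"
proof -
  have iff: "proj_point ` S \<subseteq> projectivization W \<longleftrightarrow> S \<subseteq> W" if W: "vec.subspace W" for W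
  proof
    assume *: "proj_point ` S \<subseteq> projectivization W"
    show "S \<subseteq> W"
    proof
      fix v assume "v \<in> S"
      then obtain w where w: "w \<in> W" "proj_point v = proj_point w"
        using * by (auto simp: projectivization_def)
      have "v \<in> vec.span {v}" by (simp add: vec.span_base)
      also have "\<dots> = vec.span {w}" using w(2) by (simp add: proj_point_def)
      also have "\<dots> \<subseteq> W" using W w(1) by (intro vec.span_minimal) auto
      finally show "v \<in> W" .
    qed
  next
    assume "S \<subseteq> W"
    then show "proj_point ` S \<subseteq> projectivization W" using assms by (auto simp: projectivization_def)
  qed
  show ?thesis
  proof
    have "projectivization (vec.span S) \<in> {projectivization W | W. vec.subspace W \<and> proj_point ` S \<subseteq> projectivization W}"
      using iff[OF vec.subspace_span[of S]] by (blast intro: vec.subspace_span vec.span_base)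
    then show "proj_span (proj_point ` S) \<subseteq> projectivization (vec.span S)"
      unfolding proj_span_def by (rule Inter_lower)
    show "projectivization (vec.span S) \<subseteq> proj_span (proj_point ` S)"
      unfolding proj_span_def
    proof (rule Inter_greatest)
      fix X assume "X \<in> {projectivization W | W. vec.subspace W \<and> proj_point ` S \<subseteq> projectivization W}"
      then obtain W where W: "X = projectivization W" "vec.subspace W" "proj_point ` S \<subseteq> projectivization W" by blast
      then have "S \<subseteq> W" using iff by blast
      then have "vec.span S \<subseteq> W" using W(2) by (rule vec.span_minimal)
      then show "projectivization (vec.span S) \<subseteq> X" unfolding W(1) by (rule projectivization_mono)
    qed
  qed
qed

lemma proj_dim_projectivization:
  assumes W: "vec.subspace W"
  shows "proj_dim (projectivization W) = int (vec.dim W) - 1"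
proof -
  have "\<Union> (projectivization W) \<subseteq> W"
    using W by (auto simp: projectivization_def proj_point_def) (meson empty_subsetI insert_subset vec.span_minimal subsetD)
  moreover have "W - {0} \<subseteq> \<Union> (projectivization W)"
    by (auto simp: projectivization_def proj_point_def intro: vec.span_base)
  moreover have "vec.dim (W - {0}) = vec.dim W"
    by (metis vec.dim_span vec.span_delete_0)
  ultimately have "vec.dim (\<Union> (projectivization W)) = vec.dim W"
    by (metis vec.dim_subset order_antisym)
  then show ?thesis by (simp add: proj_dim_def)
qed

text \<open>Injectivity at the nonzero Veronese point shows that \<open>T(x, y)\<close> is nonzero.
  Hence \<open>z\<close> is a nonzero multiple of it, the remaining conditions are homogeneous in
  \<open>z\<close>, and both spans have the same nonzero generators up to scalars.\<close>

lemma span_singular_points: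
  assumes inj: "\<And>M. sym_form M \<Longrightarrow> apply3 T M = 0 \<Longrightarrow> M = 0"
  shows "vec.span {tensor3 x y z | x y z. singular_triple T x y z} =
    apply3 T ` vec.span {veronese x y | x y. critical_pair T x y}"
proof -
  interpret A: Vector_Spaces.linear "(*s)" "(*s)" "apply3 T" by (rule linear_apply3)
  have "vec.span {tensor3 x y z | x y z. singular_triple T x y z} =
    vec.span (apply3 T ` {veronese x y | x y. critical_pair T x y})"
  proof (rule antisym; rule vec.span_minimal[OF _ vec.subspace_span]; rule subsetI)
    fix w assume "w \<in> {tensor3 x y z | x y z. singular_triple T x y z}"
    then obtain x y z where w: "w = tensor3 x y z" and s: "singular_triple T x y z" by blast
    have nz: "x \<noteq> 0" "y \<noteq> 0" "z \<noteq> 0" using s by (simp_all add: singular_triple_def)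
    have "apply3 T (veronese x y) \<noteq> 0"
      using inj[OF sym_form_veronese] veronese_nonzero[OF nz(1,2)] by blast
    then have "contract3 T x y \<noteq> 0" by (auto simp: apply3_veronese vec_eq_iff)
    then obtain c where c: "z = c *s contract3 T x y"
      using s minors_vanish_parallel unfolding singular_triple_def by metis
    then have "c \<noteq> 0" using nz(3) by auto
    have "minors_vanish (c *s contract1 T y (contract3 T x y)) x" "minors_vanish (c *s contract2 T x (contract3 T x y)) y"
      using s by (simp_all add: singular_triple_def c contract_scale_right)
    then have "critical_pair T x y"
      using \<open>c \<noteq> 0\<close> by (simp add: critical_pair_def minors_vanish_scale[where c = c])
    then have "apply3 T (veronese x y) \<in> apply3 T ` {veronese x y | x y. critical_pair T x y}" by blast
    moreover have "w = c *s apply3 T (veronese x y)"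
      by (simp add: w c apply3_veronese tensor3_scale)
    ultimately show "w \<in> vec.span (apply3 T ` {veronese x y | x y. critical_pair T x y})"
      by (simp only: vec.span_scale vec.span_base)
  next
    fix w assume "w \<in> apply3 T ` {veronese x y | x y. critical_pair T x y}"
    then obtain x y where w: "w = tensor3 x y (contract3 T x y)" and c: "critical_pair T x y"
      by (auto simp: apply3_veronese)
    show "w \<in> vec.span {tensor3 x y z | x y z. singular_triple T x y z}"
    \<comment> \<open>A critical pair may contain a zero vector; its Veronese point is then mapped
      to 0 and does not enlarge the span.\<close>
    proof (cases "x = 0 \<or> y = 0")
      case True
      then have "w = 0" using w by auto
      then show ?thesis by (simp add: vec.span_zero)
    next
      case False
      then have "apply3 T (veronese x y) \<noteq> 0"
        using inj[OF sym_form_veronese] veronese_nonzero by blast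
      then have "contract3 T x y \<noteq> 0" by (auto simp: apply3_veronese vec_eq_iff)
      then have "singular_triple T x y (contract3 T x y)"
        using False c minors_vanish_self_scale[of "contract3 T x y" 1]
        by (simp add: singular_triple_def critical_pair_def)
      then show ?thesis unfolding w by (intro vec.span_base) blast
    qed
  qed
  then show ?thesis by (simp add: A.span_image)
qed

theorem theorem5p2:
  fixes n :: nat
  assumes "n \<ge> 2"
    and "CARD('n::finite) = n"
    and "CARD('k::finite) = n + 2"
  shows "for_general (\<lambda>T :: complex ^ (2 \<times> 'n \<times> 'k).
           has_codim_in (proj_span (singular_points T)) (projectivization (critical_space T)) (n - 1))"
proof -
  obtain e :: "'n \<Rightarrow> nat" where e: "inj e"
    using ex_bij_betw_finite_nat[of "UNIV :: 'n set"] by (auto simp: bij_betw_def)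
  obtain f :: "'k \<Rightarrow> nat" where f: "inj f"
    using ex_bij_betw_finite_nat[of "UNIV :: 'k set"] by (auto simp: bij_betw_def)
  have "card (UNIV :: 'n set) \<le> card (UNIV :: 'k set)" using assms by simp
  then obtain \<iota> :: "'n \<Rightarrow> 'k" where "inj \<iota>"
    by (metis card_le_inj finite subset_UNIV)
  then obtain P R where PR: "generic_lines P R \<iota>" by (rule generic_lines_exist)
  obtain I :: "(3 \<times> 'n \<times> 'n) set" where I: "card I + card (form_indices e) = CARD(3 \<times> 'n \<times> 'n)"
    and many: "for_general (many_critical_pairs I :: complex ^ (2 \<times> 'n \<times> 'k) \<Rightarrow> bool)"
    using for_general_many_critical_pairs_exists[OF e PR] by blast
  have "for_general (\<lambda>T :: complex ^ (2 \<times> 'n \<times> 'k). (many_critical_pairs I T \<and> indep_family (form_indices e) (forms T)) \<and>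
      indep_family (critical_indices e f) (critical_forms T) \<and> (\<forall>M. sym_form M \<longrightarrow> apply3 T M = 0 \<longrightarrow> M = 0))"
    using assms by (intro for_general_conj many for_general_forms_indep[OF e PR]
        for_general_critical_forms[OF e f] for_general_apply3_injective) simp_all
  then show ?thesis
  proof (rule for_general_mono, elim conjE)
    fix T :: "complex ^ (2 \<times> 'n \<times> 'k)"
    assume many: "many_critical_pairs I T" and forms: "indep_family (form_indices e) (forms T)"
      and crit: "indep_family (critical_indices e f) (critical_forms T)"
      and inj: "\<forall>M. sym_form M \<longrightarrow> apply3 T M = 0 \<longrightarrow> M = 0"
    define V where "V = {veronese x y | x y. critical_pair T x y}"
    define S where "S = {tensor3 x y z | x y z. singular_triple T x y z}"
    have fin: "finite (form_indices e)" "finite (critical_indices e f)"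
      by (simp_all add: form_indices_def critical_indices_def)
    \<comment> \<open>Bounded above by the independent forms that vanish on critical pairs and below
      by \<open>card I\<close> independent Veronese points; the size of \<open>I\<close> was chosen
      so that the bounds meet.\<close>
    have dimV: "vec.dim (vec.span V) + card (form_indices e) = CARD(3 \<times> 'n \<times> 'n)"
    proof (rule antisym)
      have "V \<subseteq> annihilator (forms T ` form_indices e)"
        unfolding V_def using veronese_critical by blast
      then have "vec.dim (vec.span V) \<le> vec.dim (annihilator (forms T ` form_indices e))"
        by (simp add: vec.dim_subset)
      then show "vec.dim (vec.span V) + card (form_indices e) \<le> CARD(3 \<times> 'n \<times> 'n)"
        using dim_annihilator_family[OF fin(1) forms] by linarith
      obtain x y where xy: "\<And>i. i \<in> I \<Longrightarrow> critical_pair T (x i) (y i)" "indep_family I (\<lambda>i. veronese (x i) (y i))"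
        using many unfolding many_critical_pairs_def by blast
      have "veronese (x i) (y i) \<in> V" if "i \<in> I" for i
        unfolding V_def using xy(1)[OF that] by blast
      then have "(\<lambda>i. veronese (x i) (y i)) ` I \<subseteq> vec.span V" by (blast intro: vec.span_base)
      then have "card I \<le> vec.dim (vec.span V)"
        by (rule indep_family_card_le[OF finite xy(2)])
      then show "CARD(3 \<times> 'n \<times> 'n) \<le> vec.dim (vec.span V) + card (form_indices e)"
        using I by linarith
    qed
    have span: "vec.span S = apply3 T ` vec.span V"
      unfolding S_def V_def using inj by (intro span_singular_points) blast
    have dimS: "vec.dim (vec.span S) = vec.dim (vec.span V)"
      unfolding span
    proof (rule vec.dim_image_eq[OF linear_apply3])
      \<comment> \<open>The span stays within the forms symmetric in the last two indices, and there
        the map is injective.\<close>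
      have "V \<subseteq> {M. sym_form M}" by (auto simp: V_def sym_form_veronese)
      then have sub: "vec.span V \<subseteq> {M. sym_form M}" by (rule vec.span_minimal[OF _ subspace_sym_form])
      interpret A: Vector_Spaces.linear "(*s)" "(*s)" "apply3 T" by (rule linear_apply3)
      show "inj_on (apply3 T) (vec.span (vec.span V))"
      proof (rule inj_onI)
        fix M N assume MN: "M \<in> vec.span (vec.span V)" "N \<in> vec.span (vec.span V)" "apply3 T M = apply3 T N"
        then have "M - N \<in> vec.span V" by (simp only: vec.span_span vec.span_diff)
        then have "sym_form (M - N)" using sub by blast
        moreover have "apply3 T (M - N) = 0" using MN(3) by (simp add: A.diff)
        ultimately show "M = N" using inj by (metis right_minus_eq)
      qed
    qed
    have H: "critical_space T = annihilator (critical_forms T ` critical_indices e f)"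
      by (rule critical_space_annihilator[OF e f])
    have dimH: "vec.dim (critical_space T) + card (critical_indices e f) = CARD(2 \<times> 'n \<times> 'k)"
      unfolding H by (rule dim_annihilator_family[OF fin(2) crit])
    have subH: "vec.subspace (critical_space T)" unfolding H by (rule subspace_annihilator)
    have "S \<subseteq> critical_space T" unfolding S_def using tensor3_critical by blast
    then have "vec.span S \<subseteq> critical_space T" using subH by (rule vec.span_minimal)
    then have sub: "projectivization (vec.span S) \<subseteq> projectivization (critical_space T)"
      by (rule projectivization_mono)
    have "0 \<notin> S" unfolding S_def singular_triple_def using tensor3_nonzero by fastforce
    then have L: "proj_span (proj_point ` S) = projectivization (vec.span S)" by (rule proj_span_points)
    have "singular_points T = proj_point ` S" unfolding singular_points_def S_def by blast
    \<comment> \<open>With \<open>p = n(n-1)/2\<close> and \<open>p' = (n+2)(n+1)/2\<close> the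
      dimensions are \<open>2n(n+2) - 1 - p - p'\<close> and \<open>3n^2 - 4p - 1\<close>.\<close>
    moreover have "int (vec.dim (critical_space T)) - int (vec.dim (vec.span S)) = int (n - 1)"
    proof -
      have "2 * card (pairs e) + n = n * n" using card_pairs[OF e] assms(2) by simp
      moreover have "2 * card (pairs f) + (n + 2) = n * n + 4 * n + 4"
        using card_pairs[OF f] assms(3) by (simp add: algebra_simps)
      moreover have "vec.dim (critical_space T) + 1 + card (pairs e) + card (pairs f) = 2 * (n * n) + 4 * n"
        using dimH assms(2,3) by (simp add: card_critical_indices card_prod algebra_simps)
      moreover have "vec.dim (vec.span S) + 4 * card (pairs e) + 1 = 3 * (n * n)"
        using dimV dimS assms(2) by (simp add: card_form_indices card_prod)
      ultimately show ?thesis using assms(1) by linarith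
    qed
    ultimately show "has_codim_in (proj_span (singular_points T)) (projectivization (critical_space T)) (n - 1)"
      unfolding has_codim_in_def
      using L sub proj_dim_projectivization[OF subH] proj_dim_projectivization[OF vec.subspace_span[of S]] by simp
  qed
qed

end
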